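(* Let $n \ge 1$ and let $H\leq G$ denote either the subgroup inclusion $\mathrm{O}(n)\leq\mathrm{U}(n)$ or the subgroup inclusion $\mathrm{U}(n)\leq\mathrm{O}(2n)$, with inclusion map $\iota$. The square of adjunctions formed by $G_+\wedge_H(-)\colon\mathsf{Sp}^{\mathbf{O}}[H]\rightleftarrows\mathsf{Sp}^{\mathbf{O}}[G]\colon\iota^*$, $G_+\wedge_H(-)\colon\mathsf{Sp}^{\mathbf{U}}[H]\rightleftarrows\mathsf{Sp}^{\mathbf{U}}[G]\colon\iota^*$, $r_!\colon\mathsf{Sp}^{\mathbf{U}}[H]\rightleftarrows\mathsf{Sp}^{\mathbf{O}}[H]\colon r^*$ and $r_!\colon\mathsf{Sp}^{\mathbf{U}}[G]\rightleftarrows\mathsf{Sp}^{\mathbf{O}}[G]\colon r^*$ commutes up to natural isomorphism; that is, $\iota^*\circ r^*\cong r^*\circ\iota^*$ as functors $\mathsf{Sp}^{\mathbf{O}}[G]\to\mathsf{Sp}^{\mathbf{U}}[H]$ and $r_!\circ(G_+\wedge_H(-))\cong(G_+\wedge_H(-))\circ r_!$ as functors $\mathsf{Sp}^{\mathbf{U}}[H]\to\mathsf{Sp}^{\mathbf{O}}[G]$.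
   Context: Let $\mathbb{F}=\mathbb{R}$ (superscript $\mathbf{O}$) or $\mathbb{F}=\mathbb{C}$ (superscript $\mathbf{U}$). $\mathsf{Top}_*$: based compactly generated weak Hausdorff spaces. $\mathcal{J}_1$ is the $\mathsf{Top}_*$-enriched category whose objects are finite-dimensional $\mathbb{F}$-inner product subspaces of $\mathbb{F}^\infty$ and whose morphism space $\mathcal{J}_1(U,V)$ is the Thom space of the bundle $\{(f,x): f\colon U\to V\text{ an }\mathbb{F}\text{-linear isometry},\ x\in f(U)^\perp\}$ over the space of linear isometries, with composition $(g,y)\circ(f,x)=(gf,y+gx)$. $\mathsf{Sp}^{\mathbf{O}}$ and $\mathsf{Sp}^{\mathbf{U}}$ (orthogonal and unitary spectra) are the categories of $\mathsf{Top}_*$-enriched functors $\mathcal{J}_1^{\mathbf{O}}\to\mathsf{Top}_*$ and $\mathcal{J}_1^{\mathbf{U}}\to\mathsf{Top}_*$. For a compact Lie group $K$, $\mathsf{Sp}[K]$ is the category of objects $X$ of $\mathsf{Sp}$ with a continuous homomorphism $K\to\mathrm{Aut}(X)$, and $K$-equivariant maps. $\iota^*$ restricts the group action, with left adjoint $(G_+\wedge_H\Theta)(V)=G_+\wedge_H\Theta(V)$. Realification $r\colon\mathcal{J}_1^{\mathbf{U}}\to\mathcal{J}_1^{\mathbf{O}}$ sends $V$ to its underlying real inner product space $V_{\mathbb{R}}$ (real part of the Hermitian inner product) and $(f,x)$ to $(f_{\mathbb{R}},x)$; $(r^*\Theta)(V)=\Theta(V_{\mathbb{R}})$ with the inherited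 group action, and $r_!$ is its left adjoint, the left Kan extension along $r$. *)

theory Defs
  imports "HOL-Analysis.Analysis" "HOL-Algebra.Group"
begin

section \<open>Compactly generated weak Hausdorff spaces\<close>

text \<open>
  A test map is a continuous map from a compact Hausdorff space. Taking test spaces with points in
  \<open>'a set set\<close> is no restriction for weak Hausdorffness: a test map out of \<open>K\<close> has the same image as
  its restriction to the closure of a set of at most \<open>|'a|\<close> points of \<open>K\<close>, and such a closure has at
  most \<open>2 ^ 2 ^ |'a|\<close> points. In a weak Hausdorff space the images of test maps are compact
  Hausdorff subspaces, so there the restriction does not affect k-openness either.
\<close>

definition test_map :: "'a topology \<Rightarrow> 'a set set topology \<Rightarrow> ('a set set \<Rightarrow> 'a) \<Rightarrow> bool" where
  "test_map X K u \<longleftrightarrow> compact_space K \<and> Hausdorff_space K \<and> continuous_map K X u"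

definition weak_Hausdorff :: "'a topology \<Rightarrow> bool" where
  "weak_Hausdorff X \<longleftrightarrow> (\<forall>K u. test_map X K u \<longrightarrow> closedin X (u ` topspace K))"

definition kify :: "'a topology \<Rightarrow> 'a topology" where
  "kify X = topology (\<lambda>U. U \<subseteq> topspace X \<and>
     (\<forall>K u. test_map X K u \<longrightarrow> openin K {p \<in> topspace K. u p \<in> U}))"

definition CGWH :: "'a topology \<Rightarrow> bool" where
  "CGWH X \<longleftrightarrow> kify X = X \<and> weak_Hausdorff X"

type_synonym 'a based = "'a topology \<times> 'a"

definition based_CGWH :: "'a based \<Rightarrow> bool" where
  "based_CGWH X \<longleftrightarrow> CGWH (fst X) \<and> snd X \<in> topspace (fst X)"

abbreviation pts :: "'a based \<Rightarrow> 'a set" where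
  "pts X \<equiv> topspace (fst X)"

definition compact_open :: "'a topology \<Rightarrow> 'b topology \<Rightarrow> ('a \<Rightarrow> 'b) topology" where
  "compact_open X Y = topology_generated_by
     {{f \<in> extensional (topspace X). continuous_map X Y f \<and> f ` u ` topspace K \<subseteq> U} | K u U.
        test_map X K u \<and> openin Y U}"

text \<open>The mapping object of the category of based CGWH spaces.\<close>

definition based_maps :: "'a based \<Rightarrow> 'b based \<Rightarrow> ('a \<Rightarrow> 'b) topology" where
  "based_maps X Y = kify (subtopology (compact_open (fst X) (fst Y)) {f. f (snd X) = snd Y})"

section \<open>Categories, functors, adjunctions\<close>

text \<open>\<open>Cmp C X Y Z g f\<close> is the composite of \<open>f : X \<rightarrow> Y\<close> and \<open>g : Y \<rightarrow> Z\<close>.\<close>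

record ('o, 'm) cat =
  Obj :: "'o set"
  Hom :: "'o \<Rightarrow> 'o \<Rightarrow> 'm set"
  Id :: "'o \<Rightarrow> 'm"
  Cmp :: "'o \<Rightarrow> 'o \<Rightarrow> 'o \<Rightarrow> 'm \<Rightarrow> 'm \<Rightarrow> 'm"

definition iso_in :: "('o, 'm) cat \<Rightarrow> 'o \<Rightarrow> 'o \<Rightarrow> 'm \<Rightarrow> bool" where
  "iso_in C X Y f \<longleftrightarrow> f \<in> Hom C X Y \<and>
     (\<exists>g \<in> Hom C Y X. Cmp C X Y X g f = Id C X \<and> Cmp C Y X Y f g = Id C Y)"

definition aut_group :: "('o, 'm) cat \<Rightarrow> 'o \<Rightarrow> 'm monoid" where
  "aut_group C X = \<lparr>carrier = {f. iso_in C X X f}, mult = Cmp C X X X, one = Id C X\<rparr>"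

type_synonym ('o, 'm, 'p, 'n) ftor = "('o \<Rightarrow> 'p) \<times> ('o \<Rightarrow> 'o \<Rightarrow> 'm \<Rightarrow> 'n)"

definition is_functor :: "('o, 'm) cat \<Rightarrow> ('p, 'n) cat \<Rightarrow> ('o, 'm, 'p, 'n) ftor \<Rightarrow> bool" where
  "is_functor C D F \<longleftrightarrow>
     (\<forall>X \<in> Obj C. fst F X \<in> Obj D \<and> snd F X X (Id C X) = Id D (fst F X)) \<and>
     (\<forall>X \<in> Obj C. \<forall>Y \<in> Obj C. \<forall>f \<in> Hom C X Y. snd F X Y f \<in> Hom D (fst F X) (fst F Y)) \<and>
     (\<forall>X \<in> Obj C. \<forall>Y \<in> Obj C. \<forall>Z \<in> Obj C. \<forall>f \<in> Hom C X Y. \<forall>g \<in> Hom C Y Z.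
        snd F X Z (Cmp C X Y Z g f) =
        Cmp D (fst F X) (fst F Y) (fst F Z) (snd F Y Z g) (snd F X Y f))"

definition fcomp :: "('p, 'n, 'q, 'l) ftor \<Rightarrow> ('o, 'm, 'p, 'n) ftor \<Rightarrow> ('o, 'm, 'q, 'l) ftor"
    (infixr "\<circ>\<^sub>F" 55) where
  "G \<circ>\<^sub>F F = (\<lambda>X. fst G (fst F X), \<lambda>X Y f. snd G (fst F X) (fst F Y) (snd F X Y f))"

definition nat_isomorphic ::
    "('o, 'm) cat \<Rightarrow> ('p, 'n) cat \<Rightarrow> ('o, 'm, 'p, 'n) ftor \<Rightarrow> ('o, 'm, 'p, 'n) ftor \<Rightarrow> bool" where
  "nat_isomorphic C D F G \<longleftrightarrow> is_functor C D F \<and> is_functor C D G \<and>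
     (\<exists>\<tau>. (\<forall>X \<in> Obj C. iso_in D (fst F X) (fst G X) (\<tau> X)) \<and>
          (\<forall>X \<in> Obj C. \<forall>Y \<in> Obj C. \<forall>f \<in> Hom C X Y.
             Cmp D (fst F X) (fst F Y) (fst G Y) (\<tau> Y) (snd F X Y f) =
             Cmp D (fst F X) (fst G X) (fst G Y) (snd G X Y f) (\<tau> X)))"

text \<open>\<open>left_adjoint C D L R\<close>: the functor \<open>L : C \<rightarrow> D\<close> is left adjoint to \<open>R : D \<rightarrow> C\<close>.\<close>

definition left_adjoint ::
    "('o, 'm) cat \<Rightarrow> ('p, 'n) cat \<Rightarrow> ('o, 'm, 'p, 'n) ftor \<Rightarrow> ('p, 'n, 'o, 'm) ftor \<Rightarrow> bool" where
  "left_adjoint C D L R \<longleftrightarrow> is_functor C D L \<and> is_functor D C R \<and>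
     (\<exists>\<Phi>. (\<forall>X \<in> Obj C. \<forall>Y \<in> Obj D. bij_betw (\<Phi> X Y) (Hom D (fst L X) Y) (Hom C X (fst R Y))) \<and>
          (\<forall>X \<in> Obj C. \<forall>X' \<in> Obj C. \<forall>Y \<in> Obj D. \<forall>Y' \<in> Obj D.
             \<forall>f \<in> Hom C X' X. \<forall>g \<in> Hom D Y Y'. \<forall>\<psi> \<in> Hom D (fst L X) Y.
               \<Phi> X' Y' (Cmp D (fst L X') Y Y' g (Cmp D (fst L X') (fst L X) Y \<psi> (snd L X' X f))) =
               Cmp C X' (fst R Y) (fst R Y') (snd R Y Y' g) (Cmp C X' X (fst R Y) (\<Phi> X Y \<psi>) f)))"

section \<open>Spectra and spectra with a group action\<close>

text \<open>Small categories enriched in based spaces; \<open>tBase J U V\<close> is the basepoint of \<open>tHom J U V\<close>.\<close>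

record ('o, 'm) tcat =
  tObj :: "'o set"
  tHom :: "'o \<Rightarrow> 'o \<Rightarrow> 'm topology"
  tBase :: "'o \<Rightarrow> 'o \<Rightarrow> 'm"
  tId :: "'o \<Rightarrow> 'm"
  tCmp :: "'o \<Rightarrow> 'o \<Rightarrow> 'o \<Rightarrow> 'm \<Rightarrow> 'm \<Rightarrow> 'm"

text \<open>
  Enriched functors from \<open>J\<close> to based CGWH spaces. The universe of spaces consists of the topologies
  on subsets of a fixed type \<open>'u\<close>.
\<close>

record ('o, 'm, 'u) spec =
  sp :: "'o \<Rightarrow> 'u based"
  str :: "'o \<Rightarrow> 'o \<Rightarrow> 'm \<Rightarrow> 'u \<Rightarrow> 'u"

definition is_spec :: "('o, 'm) tcat \<Rightarrow> ('o, 'm, 'u) spec \<Rightarrow> bool" where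
  "is_spec J X \<longleftrightarrow>
     (\<forall>V \<in> tObj J. based_CGWH (sp X V) \<and> str X V V (tId J V) = (\<lambda>x \<in> pts (sp X V). x)) \<and>
     (\<forall>U \<in> tObj J. \<forall>V \<in> tObj J.
        continuous_map (tHom J U V) (based_maps (sp X U) (sp X V)) (str X U V) \<and>
        str X U V (tBase J U V) = (\<lambda>x \<in> pts (sp X U). snd (sp X V))) \<and>
     (\<forall>U \<in> tObj J. \<forall>V \<in> tObj J. \<forall>W \<in> tObj J.
        \<forall>i \<in> topspace (tHom J U V). \<forall>j \<in> topspace (tHom J V W).
          str X U W (tCmp J U V W j i) = compose (pts (sp X U)) (str X V W j) (str X U V i))"

definition spec_maps :: "('o, 'm) tcat \<Rightarrow> ('o, 'm, 'u) spec \<Rightarrow> ('o, 'm, 'u) spec \<Rightarrow>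
    ('o \<Rightarrow> 'u \<Rightarrow> 'u) set" where
  "spec_maps J X Y = {\<phi> \<in> (\<Pi>\<^sub>E V \<in> tObj J. topspace (based_maps (sp X V) (sp Y V))).
     \<forall>U \<in> tObj J. \<forall>V \<in> tObj J. \<forall>j \<in> topspace (tHom J U V). \<forall>x \<in> pts (sp X U).
       \<phi> V (str X U V j x) = str Y U V j (\<phi> U x)}"

definition Sp :: "('o, 'm) tcat \<Rightarrow> (('o, 'm, 'u) spec, 'o \<Rightarrow> 'u \<Rightarrow> 'u) cat" where
  "Sp J = \<lparr>Obj = {X. is_spec J X},
           Hom = spec_maps J,
           Id = (\<lambda>X. \<lambda>V \<in> tObj J. \<lambda>x \<in> pts (sp X V). x),
           Cmp = (\<lambda>X Y Z \<psi> \<phi>. \<lambda>V \<in> tObj J. compose (pts (sp X V)) (\<psi> V) (\<phi> V))\<rparr>"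

text \<open>
  The mapping space of two spectra is the end of the mapping spaces of their levels, a subspace of
  the product. Its k-ification is omitted: only continuous maps out of compact groups into
  automorphism groups are considered, and these are unaffected.
\<close>

definition aut_top :: "('o, 'm) tcat \<Rightarrow> ('o, 'm, 'u) spec \<Rightarrow> ('o \<Rightarrow> 'u \<Rightarrow> 'u) topology" where
  "aut_top J X = subtopology (product_topology (\<lambda>V. based_maps (sp X V) (sp X V)) (tObj J))
     (carrier (aut_group (Sp J) X))"

text \<open>The topological groups below are groups whose carrier is a subspace of a topological space.\<close>

type_synonym ('o, 'm, 'g, 'u) gspec = "('o, 'm, 'u) spec \<times> ('g \<Rightarrow> 'o \<Rightarrow> 'u \<Rightarrow> 'u)"

definition is_gspec ::
    "('o, 'm) tcat \<Rightarrow> ('g::topological_space) monoid \<Rightarrow> ('o, 'm, 'g, 'u) gspec \<Rightarrow> bool" where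
  "is_gspec J K X \<longleftrightarrow> is_spec J (fst X) \<and> snd X \<in> hom K (aut_group (Sp J) (fst X)) \<and>
     continuous_map (top_of_set (carrier K)) (aut_top J (fst X)) (snd X)"

definition gspec_maps :: "('o, 'm) tcat \<Rightarrow> 'g monoid \<Rightarrow> ('o, 'm, 'g, 'u) gspec \<Rightarrow>
    ('o, 'm, 'g, 'u) gspec \<Rightarrow> ('o \<Rightarrow> 'u \<Rightarrow> 'u) set" where
  "gspec_maps J K X Y = {\<phi> \<in> spec_maps J (fst X) (fst Y).
     \<forall>k \<in> carrier K. \<forall>V \<in> tObj J. \<forall>x \<in> pts (sp (fst X) V).
       \<phi> V (snd X k V x) = snd Y k V (\<phi> V x)}"

definition SpG :: "('o, 'm) tcat \<Rightarrow> ('g::topological_space) monoid \<Rightarrow>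
    (('o, 'm, 'g, 'u) gspec, 'o \<Rightarrow> 'u \<Rightarrow> 'u) cat" where
  "SpG J K = \<lparr>Obj = {X. is_gspec J K X},
              Hom = gspec_maps J K,
              Id = (\<lambda>X. Id (Sp J) (fst X)),
              Cmp = (\<lambda>X Y Z. Cmp (Sp J) (fst X) (fst Y) (fst Z))\<rparr>"

section \<open>Restriction, induction and pullback\<close>

definition res :: "('h \<Rightarrow> 'g) \<Rightarrow> (('o, 'm, 'g, 'u) gspec, 'o \<Rightarrow> 'u \<Rightarrow> 'u,
    ('o, 'm, 'h, 'u) gspec, 'o \<Rightarrow> 'u \<Rightarrow> 'u) ftor" where
  "res \<iota> = (\<lambda>X. (fst X, \<lambda>h. snd X (\<iota> h)), \<lambda>X Y \<phi>. \<phi>)"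

text \<open>
  Quotients inside the universe: the class of a point under an equivalence relation \<open>R\<close> is
  represented by the code in \<open>'u\<close> of a chosen element. This is meaningful if \<open>'p\<close> injects into \<open>'u\<close>.
\<close>

definition code_in :: "'p \<Rightarrow> 'u" where
  "code_in = (SOME e. inj e)"

definition qproj :: "('p \<times> 'p) set \<Rightarrow> 'p \<Rightarrow> 'u" where
  "qproj R p = code_in (SOME p'. (p, p') \<in> R)"

definition qtop :: "'p topology \<Rightarrow> ('p \<times> 'p) set \<Rightarrow> 'u topology" where
  "qtop P R = topology (\<lambda>U. U \<subseteq> qproj R ` topspace P \<and> openin P {p \<in> topspace P. qproj R p \<in> U})"

text \<open>The map between quotients induced by a map \<open>f\<close> respecting the relations.\<close>

definition qmap :: "'p topology \<Rightarrow> ('p \<times> 'p) set \<Rightarrow> ('p \<times> 'p) set \<Rightarrow> ('p \<Rightarrow> 'p) \<Rightarrow> 'u \<Rightarrow> 'u" where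
  "qmap P R R' f = (\<lambda>z \<in> topspace (qtop P R). qproj R' (f (inv_into (topspace P) (qproj R) z)))"

text \<open>
  The based space \<open>G\<^sub>+ \<and>\<^sub>H X(V)\<close> is the quotient of \<open>G \<times> X(V)\<close> by \<open>(g h, x) \<sim> (g, h x)\<close> and by
  \<open>(g, *) \<sim> (g', *)\<close>. These pairs already form an equivalence relation. It is closed as \<open>H\<close> and \<open>G\<close>
  are compact, so the quotient is weak Hausdorff as it stands.
\<close>

definition ind_prod :: "('g::topological_space) monoid \<Rightarrow> 'u based \<Rightarrow> ('g \<times> 'u) topology" where
  "ind_prod G X = kify (prod_topology (top_of_set (carrier G)) (fst X))"

definition ind_rel :: "'h monoid \<Rightarrow> 'g monoid \<Rightarrow> ('h \<Rightarrow> 'g) \<Rightarrow> ('o, 'm, 'h, 'u) gspec \<Rightarrow> 'o \<Rightarrow>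
    (('g \<times> 'u) \<times> ('g \<times> 'u)) set" where
  "ind_rel H G \<iota> X V =
     {((g \<otimes>\<^bsub>G\<^esub> \<iota> h, x), (g, snd X h V x)) | g h x.
        g \<in> carrier G \<and> h \<in> carrier H \<and> x \<in> pts (sp (fst X) V)} \<union>
     {((g, snd (sp (fst X) V)), (g', snd (sp (fst X) V))) | g g'. g \<in> carrier G \<and> g' \<in> carrier G}"

definition ind_spec :: "('h::topological_space) monoid \<Rightarrow> ('g::topological_space) monoid \<Rightarrow>
    ('h \<Rightarrow> 'g) \<Rightarrow> ('o, 'm, 'h, 'u) gspec \<Rightarrow> ('o, 'm, 'u) spec" where
  "ind_spec H G \<iota> X =
     \<lparr>sp = (\<lambda>V. (qtop (ind_prod G (sp (fst X) V)) (ind_rel H G \<iota> X V),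
                 qproj (ind_rel H G \<iota> X V) (\<one>\<^bsub>G\<^esub>, snd (sp (fst X) V)))),
      str = (\<lambda>U V j. qmap (ind_prod G (sp (fst X) U)) (ind_rel H G \<iota> X U) (ind_rel H G \<iota> X V)
                       (\<lambda>(g, x). (g, str (fst X) U V j x)))\<rparr>"

definition ind :: "('o, 'm) tcat \<Rightarrow> ('h::topological_space) monoid \<Rightarrow>
    ('g::topological_space) monoid \<Rightarrow> ('h \<Rightarrow> 'g) \<Rightarrow> (('o, 'm, 'h, 'u) gspec, 'o \<Rightarrow> 'u \<Rightarrow> 'u,
      ('o, 'm, 'g, 'u) gspec, 'o \<Rightarrow> 'u \<Rightarrow> 'u) ftor" where
  "ind J H G \<iota> =
     (\<lambda>X. (ind_spec H G \<iota> X,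
           \<lambda>\<gamma>. \<lambda>V \<in> tObj J. qmap (ind_prod G (sp (fst X) V)) (ind_rel H G \<iota> X V) (ind_rel H G \<iota> X V)
                            (\<lambda>(g, x). (\<gamma> \<otimes>\<^bsub>G\<^esub> g, x))),
      \<lambda>X Y \<phi>. \<lambda>V \<in> tObj J. qmap (ind_prod G (sp (fst X) V)) (ind_rel H G \<iota> X V) (ind_rel H G \<iota> Y V)
                            (\<lambda>(g, x). (g, \<phi> V x)))"

text \<open>Pullback along the enriched functor out of \<open>J\<close> given by \<open>ro\<close> on objects and \<open>rm\<close> on morphisms.\<close>

definition pullback :: "('o, 'm) tcat \<Rightarrow> ('o \<Rightarrow> 'p) \<Rightarrow> ('o \<Rightarrow> 'o \<Rightarrow> 'm \<Rightarrow> 'n) \<Rightarrow>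
    (('p, 'n, 'g, 'u) gspec, 'p \<Rightarrow> 'u \<Rightarrow> 'u, ('o, 'm, 'g, 'u) gspec, 'o \<Rightarrow> 'u \<Rightarrow> 'u) ftor" where
  "pullback J ro rm =
     (\<lambda>X. (\<lparr>sp = (\<lambda>V. sp (fst X) (ro V)),
            str = (\<lambda>U V j. str (fst X) (ro U) (ro V) (rm U V j))\<rparr>,
           \<lambda>k. \<lambda>V \<in> tObj J. snd X k (ro V)),
      \<lambda>X Y \<phi>. \<lambda>V \<in> tObj J. \<phi> (ro V))"

section \<open>The categories of isometries and realification\<close>

text \<open>
  \<open>F\<^sup>\<infinity>\<close> consists of the finitely supported sequences. The argument \<open>cj\<close> is the conjugation of the
  scalars: the identity over the reals, \<open>cnj\<close> over the complex numbers.
\<close>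

type_synonym 'f vect = "nat \<Rightarrow> 'f"

definition ip :: "('f::real_normed_field \<Rightarrow> 'f) \<Rightarrow> 'f vect \<Rightarrow> 'f vect \<Rightarrow> 'f" where
  "ip cj u v = (\<Sum>i | u i \<noteq> 0. u i * cj (v i))"

definition fd_subspaces :: "('f::real_normed_field) vect set set" where
  "fd_subspaces = {{\<lambda>i. \<Sum>b \<in> B. a b * b i | a. True} | B.
     finite B \<and> (\<forall>b \<in> B. finite {i. b i \<noteq> 0})}"

definition isometries :: "('f::real_normed_field \<Rightarrow> 'f) \<Rightarrow> 'f vect set \<Rightarrow> 'f vect set \<Rightarrow>
    ('f vect \<Rightarrow> 'f vect) set" where
  "isometries cj U V = {f \<in> U \<rightarrow>\<^sub>E V.
     (\<forall>u \<in> U. \<forall>w \<in> U. f (\<lambda>i. u i + w i) = (\<lambda>i. f u i + f w i)) \<and>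
     (\<forall>c. \<forall>u \<in> U. f (\<lambda>i. c * u i) = (\<lambda>i. c * f u i)) \<and>
     (\<forall>u \<in> U. \<forall>w \<in> U. ip cj (f u) (f w) = ip cj u w)}"

text \<open>
  The product topologies on \<open>nat \<Rightarrow> 'f\<close> and on the functions between such spaces induce the standard
  topologies on finite-dimensional subspaces and on the linear maps between them.
\<close>

definition isometry_bundle :: "('f::real_normed_field \<Rightarrow> 'f) \<Rightarrow> 'f vect set \<Rightarrow> 'f vect set \<Rightarrow>
    (('f vect \<Rightarrow> 'f vect) \<times> 'f vect) topology" where
  "isometry_bundle cj U V = top_of_set
     {(f, x). f \<in> isometries cj U V \<and> x \<in> V \<and> (\<forall>u \<in> U. ip cj x (f u) = 0)}"

type_synonym 'f jmor = "(('f vect \<Rightarrow> 'f vect) \<times> 'f vect) option"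

text \<open>
  The base of the bundle is compact, so its Thom space is the one-point compactification of the
  total space; this also covers the empty base, where the Thom space is a point.
\<close>

definition J1 :: "('f::real_normed_field \<Rightarrow> 'f) \<Rightarrow> ('f vect set, 'f jmor) tcat" where
  "J1 cj =
     \<lparr>tObj = fd_subspaces,
      tHom = (\<lambda>U V. Alexandroff_compactification (isometry_bundle cj U V)),
      tBase = (\<lambda>U V. None),
      tId = (\<lambda>V. Some (\<lambda>v \<in> V. v, \<lambda>i. 0)),
      tCmp = (\<lambda>U V W b a. case (b, a) of
                (Some (g, y), Some (f, x)) \<Rightarrow> Some (compose U g f, \<lambda>i. y i + g x i)
              | _ \<Rightarrow> None)\<rparr>"

abbreviation JO :: "(real vect set, real jmor) tcat" where
  "JO \<equiv> J1 (\<lambda>c. c)"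

abbreviation JU :: "(complex vect set, complex jmor) tcat" where
  "JU \<equiv> J1 cnj"

text \<open>
  The underlying real inner product space of the complex \<open>F\<^sup>\<infinity>\<close> is identified with the real one by
  interleaving real and imaginary parts; the standard real inner product becomes the real part of
  the Hermitian one.
\<close>

definition c2r :: "complex vect \<Rightarrow> real vect" where
  "c2r z = (\<lambda>k. if even k then Re (z (k div 2)) else Im (z (k div 2)))"

definition r2c :: "real vect \<Rightarrow> complex vect" where
  "r2c x = (\<lambda>k. Complex (x (2 * k)) (x (2 * k + 1)))"

definition real_mor :: "complex vect set \<Rightarrow> complex vect set \<Rightarrow> complex jmor \<Rightarrow> real jmor" where
  "real_mor U V = map_option (\<lambda>(f, x). (\<lambda>u \<in> c2r ` U. c2r (f (r2c u)), c2r x))"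

abbreviation rpull :: "((real vect set, real jmor, 'g, 'u) gspec, real vect set \<Rightarrow> 'u \<Rightarrow> 'u,
    (complex vect set, complex jmor, 'g, 'u) gspec, complex vect set \<Rightarrow> 'u \<Rightarrow> 'u) ftor" where
  "rpull \<equiv> pullback JU (image c2r) real_mor"

section \<open>The groups\<close>

definition Ogrp :: "(real^'n^'n) monoid" where
  "Ogrp = \<lparr>carrier = {A. orthogonal_matrix A}, mult = (**), one = mat 1\<rparr>"

definition Ugrp :: "(complex^'n^'n) monoid" where
  "Ugrp = \<lparr>carrier = {A. (\<chi> i j. cnj (A $ j $ i)) ** A = mat 1 \<and> A ** (\<chi> i j. cnj (A $ j $ i)) = mat 1},
           mult = (**), one = mat 1\<rparr>"

definition complexify :: "real^'n^'n \<Rightarrow> complex^'n^'n" where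
  "complexify A = (\<chi> i j. complex_of_real (A $ i $ j))"

text \<open>\<open>O(2n)\<close> is \<open>Ogrp\<close> on the index type \<open>'n + 'n\<close>, and \<open>A + iB\<close> becomes the block matrix with rows
  \<open>(A, -B)\<close> and \<open>(B, A)\<close>.\<close>

definition realify :: "complex^'n^'n \<Rightarrow> real^('n + 'n)^('n + 'n)" where
  "realify A = (\<chi> i j. case (i, j) of
       (Inl a, Inl b) \<Rightarrow> Re (A $ a $ b)
     | (Inl a, Inr b) \<Rightarrow> - Im (A $ a $ b)
     | (Inr a, Inl b) \<Rightarrow> Im (A $ a $ b)
     | (Inr a, Inr b) \<Rightarrow> Re (A $ a $ b))"

section \<open>Commutation of the square of adjunctions\<close>

text \<open>
  The functors \<open>r\<^sub>!\<close>, being determined by \<open>r\<^sup>*\<close> only up to unique isomorphism, are arbitrary left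
  adjoints \<open>rH\<close> and \<open>rG\<close> of \<open>r\<^sup>*\<close> on objects with an action of \<open>H\<close> and of \<open>G\<close>.
\<close>

definition adjoint_square_commutes :: "'u itself \<Rightarrow> ('h::topological_space) monoid \<Rightarrow>
    ('g::topological_space) monoid \<Rightarrow> ('h \<Rightarrow> 'g) \<Rightarrow> bool" where
  "adjoint_square_commutes (_ :: 'u itself) H G \<iota> \<longleftrightarrow>
     (let SpOH = SpG JO H :: ((_, _, 'h, 'u) gspec, _) cat; SpOG = SpG JO G;
          SpUH = SpG JU H; SpUG = SpG JU G
      in left_adjoint SpOH SpOG (ind JO H G \<iota>) (res \<iota>) \<and>
         left_adjoint SpUH SpUG (ind JU H G \<iota>) (res \<iota>) \<and>
         nat_isomorphic SpOG SpUH (res \<iota> \<circ>\<^sub>F rpull) (rpull \<circ>\<^sub>F res \<iota>) \<and>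
         (\<forall>rH rG. left_adjoint SpUH SpOH rH rpull \<and> left_adjoint SpUG SpOG rG rpull \<longrightarrow>
            nat_isomorphic SpUH SpOG (rG \<circ>\<^sub>F ind JU H G \<iota>) (ind JO H G \<iota> \<circ>\<^sub>F rH)))"

end

theory Submission
  imports Defs "HOL-Library.Function_Algebras"
begin

text \<open>
  On objects and morphisms \<open>\<iota>\<^sup>* r\<^sup>*\<close> and \<open>r\<^sup>* \<iota>\<^sup>*\<close> agree on the nose. Both \<open>r\<^sub>! (G\<^sub>+ \<and>\<^sub>H -)\<close> and
  \<open>G\<^sub>+ \<and>\<^sub>H r\<^sub>! -\<close> are left adjoint to this functor, so they are isomorphic by uniqueness of adjoints. The
  substance is therefore that \<open>G\<^sub>+ \<and>\<^sub>H -\<close> is well defined and left adjoint to restriction. Since \<open>G\<close>,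
  \<open>H\<close> and the morphism spaces \<open>T\<close> of the indexing category are compact Hausdorff, the topology is
  manageable: maps from \<open>T\<close> into a mapping space are the continuous maps out of the plain product with
  \<open>T\<close>, products with \<open>T\<close> preserve quotient maps, and \<open>G \<times> X(V) \<rightarrow> G\<^sub>+ \<and>\<^sub>H X(V)\<close> is proper. Pulling back a
  test map along this proper map gives a compact space, which is Hausdorff because \<open>H\<close> acts freely on
  \<open>G\<close>; hence the quotient is weak Hausdorff.
\<close>

section \<open>Compactly generated spaces\<close>

text \<open>The obstacle beneath the topology is size. Test spaces have their points in a fixed
  iterated powerset, and a quotient must again be a space on \<open>'u\<close>. So k-ifications and
  mapping spaces can be probed only by compact Hausdorff spaces that embed in the right powerset,
  which has to be checked at each use. An injection of \<open>real\<close> into \<open>'u\<close> is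
  enough: the type of \<open>G\<close> is second countable, so \<open>'g \<times> 'u\<close> embeds
  in \<open>'u\<close> and pairs can be coded there, while a morphism of the indexing category costs
  two powersets, which is what a test space affords. A test map into the quotient need not lift to
  \<open>G \<times> X(V)\<close>; this is why its pullback along the projection takes the place of a
  lift. The comparison between the two composites with \<open>r_!\<close> is never written down. It
  is a transposed identity, so no formula for the Kan extension enters.\<close>

lemma openin_kify:
  "openin (kify X) U \<longleftrightarrow> U \<subseteq> topspace X \<and>
     (\<forall>K u. test_map X K u \<longrightarrow> openin K {p \<in> topspace K. u p \<in> U})"
proof -
  have "istopology (\<lambda>U. U \<subseteq> topspace X \<and>
      (\<forall>K u. test_map X K u \<longrightarrow> openin K {p \<in> topspace K. u p \<in> U}))" (is "istopology ?P")
    unfolding istopology_def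
  proof (intro conjI allI impI)
    fix S T K u
    assume ST: "?P S" "?P T" and t: "test_map X K u"
    have "{p \<in> topspace K. u p \<in> S \<inter> T} = {p \<in> topspace K. u p \<in> S} \<inter> {p \<in> topspace K. u p \<in> T}"
      by auto
    then show "openin K {p \<in> topspace K. u p \<in> S \<inter> T}"
      using ST t by (simp add: openin_Int)
  next
    fix \<K> K u
    assume H: "\<forall>S\<in>\<K>. ?P S" and t: "test_map X K u"
    have "{p \<in> topspace K. u p \<in> \<Union>\<K>} = (\<Union>S\<in>\<K>. {p \<in> topspace K. u p \<in> S})"
      by auto
    moreover have "openin K (\<Union>S\<in>\<K>. {p \<in> topspace K. u p \<in> S})"
      using H t by (intro openin_Union) auto
    ultimately show "openin K {p \<in> topspace K. u p \<in> \<Union>\<K>}"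
      by simp
  qed auto
  then show ?thesis
    by (simp add: kify_def)
qed

lemma openin_imp_openin_kify: "openin X U \<Longrightarrow> openin (kify X) U"
  by (auto simp: openin_kify test_map_def openin_subset openin_continuous_map_preimage)

lemma topspace_kify [simp]: "topspace (kify X) = topspace X"
proof
  show "topspace (kify X) \<subseteq> topspace X"
    by (metis openin_kify openin_topspace)
  show "topspace X \<subseteq> topspace (kify X)"
    by (simp add: openin_imp_openin_kify openin_subset)
qed

lemma kify_eqI: "(\<And>U. openin (kify X) U \<Longrightarrow> openin X U) \<Longrightarrow> kify X = X"
  by (metis openin_imp_openin_kify topology_eq)

lemma continuous_map_from_kify: "continuous_map (kify X) X (\<lambda>x. x)"
  unfolding continuous_map_def
proof (intro conjI allI impI)
  fix U assume U: "openin X U"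
  then have "{x \<in> topspace (kify X). x \<in> U} = U" by (auto dest: openin_subset)
  then show "openin (kify X) {x \<in> topspace (kify X). x \<in> U}"
    using U by (simp add: openin_imp_openin_kify)
qed auto

text \<open>
  Test spaces have their points in a fixed type. This lemma removes the restriction, up to cardinality.
\<close>

lemma test_map_transfer:
  fixes K :: "'k topology" and X :: "'a topology"
  assumes K: "compact_space K" "Hausdorff_space K" and u: "continuous_map K X u"
    and small: "(UNIV :: 'k set) \<lesssim> (UNIV :: 'a set set set)"
  shows "\<exists>K' e u'. test_map X K' u' \<and> homeomorphic_map K K' e \<and> (\<forall>p \<in> topspace K. u' (e p) = u p)"
proof -
  obtain e :: "'k \<Rightarrow> 'a set set" where e: "inj e"
    using small by (auto simp: lepoll_def)
  \<comment> \<open>The topology of \<open>K\<close> is carried over to the image of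
    \<open>e\<close>, which makes \<open>e\<close> a homeomorphism onto \<open>K'\<close>.\<close>
  define K' where "K' = pullback_topology (e ` topspace K) (inv_into UNIV e) K"
  have top: "topspace K' = e ` topspace K"
    using e by (auto simp: K'_def topspace_pullback_topology)
  have 1: "continuous_map K K' e"
    unfolding K'_def by (rule continuous_map_pullback') (use e in \<open>auto simp: o_def\<close>)
  have 2: "continuous_map K' K (inv_into UNIV e)"
    unfolding K'_def using continuous_map_pullback[OF continuous_map_id] by (simp add: o_def)
  have hom: "homeomorphic_maps K K' e (inv_into UNIV e)"
    using 1 2 e top by (auto simp: homeomorphic_maps_def)
  then have h: "homeomorphic_map K K' e"
    by (auto simp: homeomorphic_map_maps)
  then have hs: "K homeomorphic_space K'"
    using homeomorphic_map_imp_homeomorphic_space by blast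
  have "test_map X K' (u \<circ> inv_into UNIV e)"
    unfolding test_map_def
    using K hs 2 u by (metis continuous_map_compose homeomorphic_compact_space homeomorphic_Hausdorff_space)
  moreover have "\<forall>p \<in> topspace K. (u \<circ> inv_into UNIV e) (e p) = u p" using e by simp
  ultimately show ?thesis
    using h by blast
qed

text \<open>k-openness is a condition on test maps only. Up to a homeomorphism \<open>u\<close> is
  itself a test map, so k-open sets have open preimages under it by definition.\<close>

lemma continuous_map_into_kify:
  fixes K :: "'k topology" and X :: "'a topology"
  assumes K: "compact_space K" "Hausdorff_space K" and u: "continuous_map K X u"
    and small: "(UNIV :: 'k set) \<lesssim> (UNIV :: 'a set set set)"
  shows "continuous_map K (kify X) u"
  unfolding continuous_map_def
proof (intro conjI allI impI)
  show "u \<in> topspace K \<rightarrow> topspace (kify X)"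
    using u by (simp add: continuous_map_def)
next
  fix U
  assume U: "openin (kify X) U"
  obtain K' e u' where *: "test_map X K' u'" "homeomorphic_map K K' e" "\<And>p. p \<in> topspace K \<Longrightarrow> u' (e p) = u p"
    using test_map_transfer[OF assms] by blast
  then have "openin K' {p \<in> topspace K'. u' p \<in> U}"
    using U by (auto simp: openin_kify)
  then have "openin K {p \<in> topspace K. e p \<in> {p \<in> topspace K'. u' p \<in> U}}"
    using *(2) homeomorphic_imp_continuous_map openin_continuous_map_preimage by blast
  also have "{p \<in> topspace K. e p \<in> {p \<in> topspace K'. u' p \<in> U}} = {p \<in> topspace K. u p \<in> U}"
    using * homeomorphic_imp_surjective_map by fastforce
  finally show "openin K {p \<in> topspace K. u p \<in> U}" .
qed

lemma weak_Hausdorff_closedin_image: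
  fixes K :: "'k topology" and X :: "'a topology"
  assumes K: "compact_space K" "Hausdorff_space K" and u: "continuous_map K X u"
    and small: "(UNIV :: 'k set) \<lesssim> (UNIV :: 'a set set set)" and X: "weak_Hausdorff X"
  shows "closedin X (u ` topspace K)"
proof -
  obtain K' e u' where *: "test_map X K' u'" "homeomorphic_map K K' e" "\<And>p. p \<in> topspace K \<Longrightarrow> u' (e p) = u p"
    using test_map_transfer[OF K u small] by blast
  have "u ` topspace K = u' ` topspace K'"
    using * by (force simp: image_image simp flip: homeomorphic_imp_surjective_map[OF *(2)])
  then show ?thesis
    using X * by (simp add: weak_Hausdorff_def)
qed

text \<open>A one-point test space: it lets statements about all test maps be specialised to single
  points.\<close>

lemma test_map_const: "a \<in> topspace X \<Longrightarrow> test_map X (discrete_topology {{}}) (\<lambda>_. a)"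
  by (auto simp: test_map_def Hausdorff_space_discrete_topology compact_space_discrete_topology)

lemma weak_Hausdorff_imp_t1: 
  assumes "weak_Hausdorff X" "a \<in> topspace X" 
  shows "closedin X {a}"
  using assms(1) test_map_const[OF assms(2)] by (force simp: weak_Hausdorff_def)

text \<open>A tube argument. A closed neighbourhood \<open>N\<close> of \<open>t0\<close> inside the
  slice of \<open>W\<close> over \<open>a0\<close> is compact, so on each test space the points
  \<open>l\<close> with \<open>N \<times> {u l}\<close> inside \<open>W\<close> form an open set.
  Hence the set \<open>V\<close> of all \<open>a\<close> with \<open>N \<times> {a}\<close> inside
  \<open>W\<close> is k-open, and open because \<open>A\<close> is compactly generated.\<close>

lemma openin_prod_kI:
  assumes T: "compact_space T" "Hausdorff_space T" and A: "kify A = A"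
    and W: "W \<subseteq> topspace T \<times> topspace A"
    and test: "\<And>L u. test_map A L u \<Longrightarrow>
        openin (prod_topology T L) {(t, l). t \<in> topspace T \<and> l \<in> topspace L \<and> (t, u l) \<in> W}"
  shows "openin (prod_topology T A) W"
  unfolding openin_prod_topology_alt
proof (intro allI impI)
  fix t0 a0
  assume in_W: "(t0, a0) \<in> W"
  define S where "S = {t \<in> topspace T. (t, a0) \<in> W}"
  have a0: "a0 \<in> topspace A" using W in_W by auto
  let ?L = "discrete_topology {{}} :: 'b set set topology"
  \<comment> \<open>The constant test map at \<open>a0\<close> turns the hypothesis into openness of
    the slice of \<open>W\<close> over \<open>a0\<close>.\<close>
  have "continuous_map T (prod_topology T ?L) (\<lambda>t. (t, {}))"
    by (simp add: continuous_map_paired)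
  from openin_continuous_map_preimage[OF this test[OF test_map_const[OF a0]]]
  have S: "openin T S"
    by (simp add: S_def cong: conj_cong)
  have t0: "t0 \<in> S" using in_W W by (auto simp: S_def)
  have "regular_space T" using T by (simp add: compact_Hausdorff_imp_regular_space)
  then obtain O' N where N: "openin T O'" "closedin T N" "t0 \<in> O'" "O' \<subseteq> N" "N \<subseteq> S"
    using S t0 unfolding neighbourhood_base_of_closedin[symmetric] neighbourhood_base_of by metis
  have Nc: "compactin T N"
    using T N by (simp add: closedin_compact_space)
  define V where "V = {a \<in> topspace A. \<forall>t\<in>N. (t, a) \<in> W}"
  have "openin (kify A) V"
    unfolding openin_kify
  proof (intro conjI allI impI)
    show "V \<subseteq> topspace A" by (auto simp: V_def)
    fix L u assume L: "test_map A L u"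
    show "openin L {p \<in> topspace L. u p \<in> V}"
    proof (subst openin_subopen, clarify)
      fix l assume l: "l \<in> topspace L" "u l \<in> V"
      let ?W = "{(t, l). t \<in> topspace T \<and> l \<in> topspace L \<and> (t, u l) \<in> W}"
      have "N \<times> {l} \<subseteq> ?W"
        using l W by (auto simp: V_def)
      then obtain U' V' where UV: "openin T U'" "openin L V'" "N \<subseteq> U'" "l \<in> V'" "U' \<times> V' \<subseteq> ?W"
        using tube_lemma_left[OF test[OF L] Nc l(1)] by blast
      have "V' \<subseteq> {p \<in> topspace L. u p \<in> V}"
      proof
        fix p assume p: "p \<in> V'"
        then have pL: "p \<in> topspace L" using UV openin_subset by blast
        moreover have "u p \<in> topspace A" 
          using L pL by (auto simp: test_map_def continuous_map_def)
        moreover have "(t, u p) \<in> W" if "t \<in> N" for t using UV p that by blast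
        ultimately show "p \<in> {p \<in> topspace L. u p \<in> V}" by (simp add: V_def)
      qed
      then show "\<exists>T. openin L T \<and> l \<in> T \<and> T \<subseteq> {p \<in> topspace L. u p \<in> V}"
        using UV by blast
    qed
  qed
  then have "openin A V" by (simp add: A)
  moreover have "a0 \<in> V" using a0 N by (auto simp: V_def S_def)
  moreover have "O' \<times> V \<subseteq> W" using N by (auto simp: V_def)
  ultimately show "\<exists>U V. openin T U \<and> openin A V \<and> t0 \<in> U \<and> a0 \<in> V \<and> U \<times> V \<subseteq> W"
    using N by blast
qed

text \<open>Continuity is reduced to products \<open>T \<times> L\<close> with a test space. There
  points have compact neighbourhoods in both factors, which is what the compact-open topology
  needs.\<close>

lemma continuous_map_prod_kI:
  assumes T: "compact_space T" "Hausdorff_space T" and A: "kify A = A"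
    and test: "\<And>L u. test_map A L u \<Longrightarrow> continuous_map (prod_topology T L) B (\<lambda>(t, l). f (t, u l))"
  shows "continuous_map (prod_topology T A) B f"
  unfolding continuous_map_def
proof (intro conjI allI impI)
  show "f \<in> topspace (prod_topology T A) \<rightarrow> topspace B"
  proof clarsimp
    fix t a assume ta: "t \<in> topspace T" "a \<in> topspace A"
    have "(\<lambda>(t, l). f (t, a)) (t, {}) \<in> topspace B"
      using test[OF test_map_const[OF ta(2)]] ta by (force simp: continuous_map_def)
    then show "f (t, a) \<in> topspace B" by simp
  qed
  fix U assume U: "openin B U"
  show "openin (prod_topology T A) {x \<in> topspace (prod_topology T A). f x \<in> U}"
  proof (rule openin_prod_kI[OF T A])
    fix L u assume L: "test_map A L u"
    have "{(t, l). t \<in> topspace T \<and> l \<in> topspace L \<and> (t, u l) \<in> {x \<in> topspace (prod_topology T A). f x \<in> U}}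
      = {x \<in> topspace (prod_topology T L). (\<lambda>(t, l). f (t, u l)) x \<in> U}"
      using L by (auto simp: test_map_def continuous_map_def)
    then show "openin (prod_topology T L) {(t, l). t \<in> topspace T \<and> l \<in> topspace L \<and> (t, u l) \<in> {x \<in> topspace (prod_topology T A). f x \<in> U}}"
      using openin_continuous_map_preimage[OF test[OF L] U] by simp
  qed auto
qed

text \<open>For a test map \<open>u\<close> on \<open>L\<close>, the map
  \<open>(t, l) \<mapsto> (t, u l)\<close> starts at the compact Hausdorff space
  \<open>T \<times> L\<close>, and \<open>small\<close> makes this space admissible for the
  k-ification of the product. So a k-open set is open on each \<open>T \<times> L\<close>, which
  suffices by \<open>openin_prod_kI\<close>.\<close>

lemma kify_prod:
  fixes T :: "'t topology" and A :: "'a topology"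
  assumes T: "compact_space T" "Hausdorff_space T" and A: "kify A = A"
    and small: "(UNIV :: ('t \<times> 'a set set) set) \<lesssim> (UNIV :: ('t \<times> 'a) set set set)"
  shows "kify (prod_topology T A) = prod_topology T A"
proof (rule kify_eqI)
  fix U assume U: "openin (kify (prod_topology T A)) U"
  show "openin (prod_topology T A) U"
  proof (rule openin_prod_kI[OF T A])
    show "U \<subseteq> topspace T \<times> topspace A"
      using U openin_subset by fastforce
    fix L u assume L: "test_map A L u"
    have "continuous_map (prod_topology T L) (prod_topology T A) (\<lambda>(t, l). (t, u l))"
      using L unfolding test_map_def case_prod_beta
      by (intro continuous_map_pairedI continuous_map_fst continuous_map_compose[OF continuous_map_snd, unfolded o_def]) simp
    then have "continuous_map (prod_topology T L) (kify (prod_topology T A)) (\<lambda>(t, l). (t, u l))"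
      using L T by (intro continuous_map_into_kify small)
         (auto simp: test_map_def compact_space_prod_topology Hausdorff_space_prod_topology)
    from openin_continuous_map_preimage[OF this U]
    show "openin (prod_topology T L) {(t, l). t \<in> topspace T \<and> l \<in> topspace L \<and> (t, u l) \<in> U}"
      by (simp add: case_prod_beta' mem_Times_iff)
  qed
qed

text \<open>Closed subspaces of a test space are test spaces, so weak Hausdorffness makes
  \<open>u\<close> a closed map onto its image; closed continuous images of normal Hausdorff spaces
  are Hausdorff.\<close>

lemma Hausdorff_test_map_image:
  assumes L: "test_map X L u" and X: "weak_Hausdorff X"
  shows "Hausdorff_space (subtopology X (u ` topspace L))"
proof -
  let ?Y = "subtopology X (u ` topspace L)"
  have uX: "u ` topspace L \<subseteq> topspace X" using L by (auto simp: test_map_def continuous_map_def)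
  have cont: "continuous_map L ?Y u"
    using L by (auto simp: test_map_def continuous_map_in_subtopology)
  have clo: "closed_map L ?Y u"
    unfolding closed_map_def
  proof (intro allI impI)
    fix C assume C: "closedin L C"
    have "test_map X (subtopology L C) u"
      using L C by (auto simp: test_map_def compact_space_subtopology closedin_compact_space
          Hausdorff_space_subtopology continuous_map_from_subtopology)
    then have "closedin X (u ` (topspace (subtopology L C)))"
      using X unfolding weak_Hausdorff_def by blast
    then have "closedin X (u ` C)"
      using closedin_subset[OF C] by (simp add: Int_absorb1)
    then show "closedin ?Y (u ` C)"
      using closedin_subset[OF C] by (metis closedin_subset_topspace image_mono)
  qed
  have "normal_space L" "Hausdorff_space L"
    using L by (auto simp: test_map_def compact_Hausdorff_or_regular_imp_normal_space)
  from normal_Hausdorff_space_closed_continuous_map_image[OF this clo cont]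
  show "Hausdorff_space ?Y" using uX by (simp add: Int_absorb1)
qed

text \<open>The image of a test map lies in \<open>T \<times> ?A\<close>, where \<open>?A\<close> is
  the image of its second component. This strip is closed, and it is Hausdorff by the previous
  lemma, so the compact image is closed in the strip and hence in the product.\<close>

lemma weak_Hausdorff_prod:
  fixes T :: "'t topology" and A :: "'a topology"
  assumes T: "compact_space T" "Hausdorff_space T" and A: "weak_Hausdorff A"
    and small: "(UNIV :: ('t \<times> 'a) set set set) \<lesssim> (UNIV :: 'a set set set)"
  shows "weak_Hausdorff (prod_topology T A)"
  unfolding weak_Hausdorff_def
proof (intro allI impI)
  fix K :: "('t \<times> 'a) set set topology" and u assume K: "test_map (prod_topology T A) K u"
  have cu: "compact_space K" "Hausdorff_space K" "continuous_map K A (snd \<circ> u)"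
    using K by (auto simp: test_map_def continuous_map_componentwise continuous_map_prod_top o_def
       continuous_map_pairwise)
  obtain K' e u' where *: "test_map A K' u'" "homeomorphic_map K K' e"
      "\<And>p. p \<in> topspace K \<Longrightarrow> u' (e p) = (snd \<circ> u) p"
    using test_map_transfer[OF cu small] by blast
  let ?A = "u' ` topspace K'"
  have img: "?A = (snd \<circ> u) ` topspace K"
    using * by (force simp: image_image simp flip: homeomorphic_imp_surjective_map[OF *(2)])
  have cl: "closedin A ?A" using * A by (simp add: weak_Hausdorff_def)
  have haus: "Hausdorff_space (subtopology A ?A)"
    by (rule Hausdorff_test_map_image[OF *(1) A])
  have clo: "closedin (prod_topology T A) (topspace T \<times> ?A)"
    using cl by (simp add: closedin_prod_Times_iff)
  have H: "Hausdorff_space (subtopology (prod_topology T A) (topspace T \<times> ?A))"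
    using haus T by (simp add: subtopology_Times Hausdorff_space_prod_topology)
  have sub: "u ` topspace K \<subseteq> topspace T \<times> ?A"
  proof clarify
    fix k t a assume "k \<in> topspace K" "(t, a) = u k"
    moreover have "u k \<in> topspace (prod_topology T A)"
      using K calculation by (auto simp: test_map_def continuous_map_def Pi_iff simp del: topspace_prod_topology)
    ultimately show "t \<in> topspace T \<and> a \<in> ?A"
      unfolding img by (metis (no_types, lifting) SigmaE comp_apply image_eqI prod.sel(1,2) topspace_prod_topology)
  qed
  have "compactin (prod_topology T A) (u ` topspace K)"
    using K by (auto simp: test_map_def compact_space_def intro: image_compactin)
  then have "compactin (subtopology (prod_topology T A) (topspace T \<times> ?A)) (u ` topspace K)"
    using sub by (simp add: compactin_subtopology)
  then have "closedin (subtopology (prod_topology T A) (topspace T \<times> ?A)) (u ` topspace K)"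
    using H compactin_imp_closedin by blast
  then show "closedin (prod_topology T A) (u ` topspace K)"
    using clo closedin_trans_full by blast
qed

section \<open>Mapping spaces and the exponential law for compact parameter spaces\<close>

lemma topspace_compact_open:
  "topspace (compact_open X Y) = {f \<in> extensional (topspace X). continuous_map X Y f}" (is "_ = ?R")
proof
  show "topspace (compact_open X Y) \<subseteq> ?R"
    by (auto simp: compact_open_def)
  \<comment> \<open>The empty test space imposes no condition, so its subbasic set already contains
    every continuous map.\<close>
  have "?R = {f \<in> extensional (topspace X). continuous_map X Y f \<and>
      f ` (\<lambda>_. undefined) ` topspace (discrete_topology {}) \<subseteq> topspace Y}"
    by auto
  moreover have "test_map X (discrete_topology {}) (\<lambda>_. undefined)"
    by (auto simp: test_map_def)
  ultimately show "?R \<subseteq> topspace (compact_open X Y)"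
    unfolding compact_open_def by (subst topology_generated_by_topspace) blast
qed

lemma topspace_based_maps:
  "topspace (based_maps X Y) =
     {f \<in> extensional (pts X). continuous_map (fst X) (fst Y) f \<and> f (snd X) = snd Y}"
  by (auto simp: based_maps_def topspace_compact_open)

lemma continuous_map_based_maps_eval:
  assumes T: "compact_space T" "Hausdorff_space T" and A: "kify (fst A) = fst A"
    and f: "continuous_map T (based_maps A B) f"
  shows "continuous_map (prod_topology T (fst A)) (fst B) (\<lambda>(t, a). f t a)"
proof (rule continuous_map_prod_kI[OF T A])
  fix L :: "'b set set topology" and u
  assume L: "test_map (fst A) L u"
  have fA: "f t \<in> extensional (pts A)" "continuous_map (fst A) (fst B) (f t)" if "t \<in> topspace T" for t
    using that f by (auto simp: continuous_map_def topspace_based_maps Pi_iff)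
  have f': "continuous_map T (compact_open (fst A) (fst B)) f"
  proof -
    have "continuous_map T (subtopology (compact_open (fst A) (fst B)) {f. f (snd A) = snd B}) ((\<lambda>x. x) \<circ> f)"
      using f continuous_map_from_kify unfolding based_maps_def by (rule continuous_map_compose)
    then show ?thesis by (simp add: continuous_map_in_subtopology o_def)
  qed
  have uA: "u l \<in> pts A" if "l \<in> topspace L" for l
    using L that by (auto simp: test_map_def continuous_map_def)
  have "continuous_map (prod_topology T L) (fst B) (\<lambda>(t, l). f t (u l))"
    unfolding continuous_map_def
  proof (intro conjI allI impI)
    show "(\<lambda>(t, l). f t (u l)) \<in> topspace (prod_topology T L) \<rightarrow> pts B"
      using fA uA by (auto simp: continuous_map_def Pi_iff)
    fix U assume U: "openin (fst B) U"
    show "openin (prod_topology T L) {x \<in> topspace (prod_topology T L). (case x of (t, l) \<Rightarrow> f t (u l)) \<in> U}" (is "openin _ ?W")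
      unfolding openin_prod_topology_alt
    proof (intro allI impI)
      fix t0 l0 assume "(t0, l0) \<in> ?W"
      then have tl: "t0 \<in> topspace T" "l0 \<in> topspace L" "f t0 (u l0) \<in> U" by auto
      have "continuous_map L (fst B) (f t0 \<circ> u)"
        using L fA(2)[OF tl(1)] by (auto simp: test_map_def intro: continuous_map_compose)
      then have S: "openin L {l \<in> topspace L. f t0 (u l) \<in> U}"
        using openin_continuous_map_preimage U by fastforce
      have "regular_space L" using L by (simp add: test_map_def compact_Hausdorff_imp_regular_space)
      then obtain V N where N: "openin L V" "closedin L N" "l0 \<in> V" "V \<subseteq> N" "N \<subseteq> {l \<in> topspace L. f t0 (u l) \<in> U}"
        using S tl unfolding neighbourhood_base_of_closedin[symmetric] neighbourhood_base_of
        by (metis (mono_tags, lifting) mem_Collect_eq)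
      have top: "topspace (subtopology L N) = N" using N by auto
      have test: "test_map (fst A) (subtopology L N) u"
        using L N by (auto simp: test_map_def compact_space_subtopology closedin_compact_space
            Hausdorff_space_subtopology continuous_map_from_subtopology)
      define O' where "O' = {g \<in> extensional (pts A). continuous_map (fst A) (fst B) g \<and> g ` u ` topspace (subtopology L N) \<subseteq> U}"
      have "openin (compact_open (fst A) (fst B)) O'"
        unfolding compact_open_def O'_def
        using test U by (intro topology_generated_by_Basis) blast
      then have op: "openin T {t \<in> topspace T. f t \<in> O'}"
        using f' openin_continuous_map_preimage by blast
      have "t0 \<in> {t \<in> topspace T. f t \<in> O'}"
        using tl fA N unfolding O'_def top by auto
      moreover have "{t \<in> topspace T. f t \<in> O'} \<times> V \<subseteq> ?W"
        using N unfolding O'_def top image_subset_iff by auto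
      ultimately show "\<exists>U V. openin T U \<and> openin L V \<and> t0 \<in> U \<and> l0 \<in> V \<and> U \<times> V \<subseteq> ?W"
        using op N by blast
    qed
  qed
  then show "continuous_map (prod_topology T L) (fst B) (\<lambda>(t, l). case (t, u l) of (t, a) \<Rightarrow> f t a)"
    by simp
qed

text \<open>Currying. A subbasic set asks for \<open>f t (u k)\<close> in \<open>U\<close> for all
  \<open>k\<close> of a compact space, so its preimage is open by the tube lemma. Passing to the
  k-ification costs nothing because \<open>T\<close> is compact Hausdorff and, by
  \<open>small\<close>, no larger than a test space.\<close>

lemma continuous_map_into_based_maps:
  fixes T :: "'t topology" and A :: "'a based" and B :: "'b based"
  assumes T: "compact_space T" "Hausdorff_space T" 
    and small: "(UNIV :: 't set) \<lesssim> (UNIV :: ('a \<Rightarrow> 'b) set set set)"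
    and f: "continuous_map (prod_topology T (fst A)) (fst B) (\<lambda>(t, a). f t a)"
    and base: "\<And>t. t \<in> topspace T \<Longrightarrow> f t (snd A) = snd B"
    and ext: "\<And>t. t \<in> topspace T \<Longrightarrow> f t \<in> extensional (pts A)"
  shows "continuous_map T (based_maps A B) f"
  unfolding based_maps_def
proof (intro continuous_map_into_kify[OF T _ small])
  have ft: "continuous_map (fst A) (fst B) (f t)" if "t \<in> topspace T" for t
  proof -
    have "continuous_map (fst A) (prod_topology T (fst A)) (\<lambda>a. (t, a))"
      using that by (simp add: continuous_map_paired)
    from continuous_map_compose[OF this f] show ?thesis by (simp add: o_def)
  qed
  have "continuous_map T (compact_open (fst A) (fst B)) f"
    unfolding compact_open_def
  proof (rule continuous_on_generated_topo)
    fix S assume "S \<in> {{f \<in> extensional (pts A). continuous_map (fst A) (fst B) f \<and> f ` u ` topspace K \<subseteq> U} | K u U.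
        test_map (fst A) K u \<and> openin (fst B) U}"
    then obtain K u U where S: "S = {f \<in> extensional (pts A). continuous_map (fst A) (fst B) f \<and> f ` u ` topspace K \<subseteq> U}"
       and K: "test_map (fst A) K u" and U: "openin (fst B) U" by blast
    have pre: "f -` S \<inter> topspace T = {t \<in> topspace T. \<forall>k \<in> topspace K. f t (u k) \<in> U}"
      using ft ext by (auto simp: S)
    have "continuous_map (prod_topology T K) (prod_topology T (fst A)) (\<lambda>(t, k). (t, u k))"
      using K unfolding test_map_def case_prod_beta
      by (intro continuous_map_pairedI continuous_map_fst continuous_map_compose[OF continuous_map_snd, unfolded o_def]) simp
    from continuous_map_compose[OF this f]
    have c: "continuous_map (prod_topology T K) (fst B) (\<lambda>(t, k). f t (u k))"
      by (simp add: o_def case_prod_beta')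
    let ?W = "{x \<in> topspace (prod_topology T K). (case x of (t, k) \<Rightarrow> f t (u k)) \<in> U}"
    have W: "openin (prod_topology T K) ?W"
      using openin_continuous_map_preimage[OF c U] .
    show "openin T (f -` S \<inter> topspace T)"
      unfolding pre
    proof (subst openin_subopen, clarify)
      fix t assume t: "t \<in> topspace T" "\<forall>k\<in>topspace K. f t (u k) \<in> U"
      have sub: "{t} \<times> topspace K \<subseteq> ?W" using t by auto
      have "compactin K (topspace K)" using K by (simp add: test_map_def compact_space_def)
      from tube_lemma_right[OF W this t(1) sub] obtain P Q where "openin T P" "openin K Q" "t \<in> P" "topspace K \<subseteq> Q" "P \<times> Q \<subseteq> ?W"
        by blast
      moreover from this have "(x, k) \<in> ?W" if "x \<in> P" "k \<in> topspace K" for x k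
        using that by blast
      ultimately show "\<exists>P. openin T P \<and> t \<in> P \<and> P \<subseteq> {t \<in> topspace T. \<forall>k \<in> topspace K. f t (u k) \<in> U}"
        by (intro exI[of _ P]) (auto dest: openin_subset)
    qed
  next
    show "f ` topspace T \<subseteq> \<Union> {{f \<in> extensional (pts A). continuous_map (fst A) (fst B) f \<and> f ` u ` topspace K \<subseteq> U} | K u U.
        test_map (fst A) K u \<and> openin (fst B) U}"
      unfolding topspace_compact_open[of "fst A" "fst B", unfolded compact_open_def topology_generated_by_topspace]
      using ft ext by auto
  qed
  then show "continuous_map T (subtopology (compact_open (fst A) (fst B)) {f. f (snd A) = snd B}) f"
    using base by (simp add: continuous_map_in_subtopology image_subset_iff)
qed

section \<open>Adjunctions\<close>

text \<open>The record \<open>cat\<close> carries no laws. Transposing identities across an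
  adjunction needs them, in particular that identities and composites stay in the hom-sets.\<close>

definition is_cat :: "('o, 'm) cat \<Rightarrow> bool" where
  "is_cat C \<longleftrightarrow>
     (\<forall>X \<in> Obj C. Id C X \<in> Hom C X X) \<and>
     (\<forall>X \<in> Obj C. \<forall>Y \<in> Obj C. \<forall>Z \<in> Obj C. \<forall>f \<in> Hom C X Y. \<forall>g \<in> Hom C Y Z. Cmp C X Y Z g f \<in> Hom C X Z) \<and>
     (\<forall>X \<in> Obj C. \<forall>Y \<in> Obj C. \<forall>f \<in> Hom C X Y. Cmp C X X Y f (Id C X) = f \<and> Cmp C X Y Y (Id C Y) f = f) \<and>
     (\<forall>W \<in> Obj C. \<forall>X \<in> Obj C. \<forall>Y \<in> Obj C. \<forall>Z \<in> Obj C.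
        \<forall>f \<in> Hom C W X. \<forall>g \<in> Hom C X Y. \<forall>h \<in> Hom C Y Z.
          Cmp C W Y Z h (Cmp C W X Y g f) = Cmp C W X Z (Cmp C X Y Z h g) f)"

lemma is_catD:
  assumes "is_cat C"
  shows "X \<in> Obj C \<Longrightarrow> Id C X \<in> Hom C X X"
    and "\<lbrakk>X \<in> Obj C; Y \<in> Obj C; Z \<in> Obj C; f \<in> Hom C X Y; g \<in> Hom C Y Z\<rbrakk> \<Longrightarrow> Cmp C X Y Z g f \<in> Hom C X Z"
    and "\<lbrakk>X \<in> Obj C; Y \<in> Obj C; f \<in> Hom C X Y\<rbrakk> \<Longrightarrow> Cmp C X X Y f (Id C X) = f"
    and "\<lbrakk>X \<in> Obj C; Y \<in> Obj C; f \<in> Hom C X Y\<rbrakk> \<Longrightarrow> Cmp C X Y Y (Id C Y) f = f"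
    and "\<lbrakk>W \<in> Obj C; X \<in> Obj C; Y \<in> Obj C; Z \<in> Obj C; f \<in> Hom C W X; g \<in> Hom C X Y; h \<in> Hom C Y Z\<rbrakk> \<Longrightarrow>
      Cmp C W Y Z h (Cmp C W X Y g f) = Cmp C W X Z (Cmp C X Y Z h g) f"
  using assms by (simp_all add: is_cat_def)

lemma is_functorD:
  assumes "is_functor C D F"
  shows "X \<in> Obj C \<Longrightarrow> fst F X \<in> Obj D"
    and "X \<in> Obj C \<Longrightarrow> snd F X X (Id C X) = Id D (fst F X)"
    and "\<lbrakk>X \<in> Obj C; Y \<in> Obj C; f \<in> Hom C X Y\<rbrakk> \<Longrightarrow> snd F X Y f \<in> Hom D (fst F X) (fst F Y)"
    and "\<lbrakk>X \<in> Obj C; Y \<in> Obj C; Z \<in> Obj C; f \<in> Hom C X Y; g \<in> Hom C Y Z\<rbrakk> \<Longrightarrow>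
        snd F X Z (Cmp C X Y Z g f) = Cmp D (fst F X) (fst F Y) (fst F Z) (snd F Y Z g) (snd F X Y f)"
  using assms by (simp_all add: is_functor_def)

lemma is_functor_fcomp:
  assumes F: "is_functor C D F" and G: "is_functor D E G"
  shows "is_functor C E (G \<circ>\<^sub>F F)"
  unfolding is_functor_def fcomp_def
  by (auto simp: is_functorD[OF F] is_functorD[OF G])

lemma nat_isomorphic_refl:
  assumes "is_cat D" "is_functor C D F"
  shows "nat_isomorphic C D F F"
  unfolding nat_isomorphic_def
proof (intro conjI exI[of _ "\<lambda>X. Id D (fst F X)"] ballI)
  fix X assume "X \<in> Obj C"
  then show "iso_in D (fst F X) (fst F X) (Id D (fst F X))"
    unfolding iso_in_def using is_catD[OF assms(1)] is_functorD[OF assms(2)] by auto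
next
  fix X Y f assume "X \<in> Obj C" "Y \<in> Obj C" "f \<in> Hom C X Y"
  then show "Cmp D (fst F X) (fst F Y) (fst F Y) (Id D (fst F Y)) (snd F X Y f) =
       Cmp D (fst F X) (fst F X) (fst F Y) (snd F X Y f) (Id D (fst F X))"
    using is_catD[OF assms(1)] is_functorD[OF assms(2)] by simp
qed (use assms in auto)

lemma left_adjoint_fcomp:
  assumes A: "left_adjoint C D L R" and B: "left_adjoint D E L' R'"
  shows "left_adjoint C E (L' \<circ>\<^sub>F L) (R \<circ>\<^sub>F R')"
proof -
  have F: "is_functor C D L" "is_functor D C R" "is_functor D E L'" "is_functor E D R'"
    using A B by (auto simp: left_adjoint_def)
  obtain \<Phi> where \<Phi>: "\<And>X Y. X \<in> Obj C \<Longrightarrow> Y \<in> Obj D \<Longrightarrow> bij_betw (\<Phi> X Y) (Hom D (fst L X) Y) (Hom C X (fst R Y))"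
    and \<Phi>n: "\<And>X X' Y Y' f g \<psi>. X \<in> Obj C \<Longrightarrow> X' \<in> Obj C \<Longrightarrow> Y \<in> Obj D \<Longrightarrow> Y' \<in> Obj D \<Longrightarrow>
         f \<in> Hom C X' X \<Longrightarrow> g \<in> Hom D Y Y' \<Longrightarrow> \<psi> \<in> Hom D (fst L X) Y \<Longrightarrow>
               \<Phi> X' Y' (Cmp D (fst L X') Y Y' g (Cmp D (fst L X') (fst L X) Y \<psi> (snd L X' X f))) =
               Cmp C X' (fst R Y) (fst R Y') (snd R Y Y' g) (Cmp C X' X (fst R Y) (\<Phi> X Y \<psi>) f)"
    using A unfolding left_adjoint_def by metis
  obtain \<Psi> where \<Psi>: "\<And>X Y. X \<in> Obj D \<Longrightarrow> Y \<in> Obj E \<Longrightarrow> bij_betw (\<Psi> X Y) (Hom E (fst L' X) Y) (Hom D X (fst R' Y))"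
    and \<Psi>n: "\<And>X X' Y Y' f g \<psi>. X \<in> Obj D \<Longrightarrow> X' \<in> Obj D \<Longrightarrow> Y \<in> Obj E \<Longrightarrow> Y' \<in> Obj E \<Longrightarrow>
         f \<in> Hom D X' X \<Longrightarrow> g \<in> Hom E Y Y' \<Longrightarrow> \<psi> \<in> Hom E (fst L' X) Y \<Longrightarrow>
               \<Psi> X' Y' (Cmp E (fst L' X') Y Y' g (Cmp E (fst L' X') (fst L' X) Y \<psi> (snd L' X' X f))) =
               Cmp D X' (fst R' Y) (fst R' Y') (snd R' Y Y' g) (Cmp D X' X (fst R' Y) (\<Psi> X Y \<psi>) f)"
    using B unfolding left_adjoint_def by metis
  note mem = is_functorD[OF F(1)] is_functorD[OF F(2)] is_functorD[OF F(3)] is_functorD[OF F(4)]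
  have \<Psi>m: "\<Psi> X Y \<psi> \<in> Hom D X (fst R' Y)" if "X \<in> Obj D" "Y \<in> Obj E" "\<psi> \<in> Hom E (fst L' X) Y" for X Y \<psi>
    using bij_betwE[OF \<Psi>] that by blast
  show ?thesis
    unfolding left_adjoint_def
  proof (intro conjI exI[of _ "\<lambda>X Y \<psi>. \<Phi> X (fst R' Y) (\<Psi> (fst L X) Y \<psi>)"] ballI)
    fix X Y assume XY: "X \<in> Obj C" "Y \<in> Obj E"
    have "bij_betw (\<Phi> X (fst R' Y) \<circ> \<Psi> (fst L X) Y) (Hom E (fst L' (fst L X)) Y) (Hom C X (fst R (fst R' Y)))"
      by (rule bij_betw_trans[OF \<Psi> \<Phi>]) (use XY mem in auto)
    then show "bij_betw (\<lambda>\<psi>. \<Phi> X (fst R' Y) (\<Psi> (fst L X) Y \<psi>)) (Hom E (fst (L' \<circ>\<^sub>F L) X) Y) (Hom C X (fst (R \<circ>\<^sub>F R') Y))"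
      by (simp add: fcomp_def o_def)
  next
    fix X X' Y Y' f g \<psi>
    assume "X \<in> Obj C" "X' \<in> Obj C" "Y \<in> Obj E" "Y' \<in> Obj E" "f \<in> Hom C X' X" "g \<in> Hom E Y Y'"
      "\<psi> \<in> Hom E (fst (L' \<circ>\<^sub>F L) X) Y"
    then show "\<Phi> X' (fst R' Y') (\<Psi> (fst L X') Y' (Cmp E (fst (L' \<circ>\<^sub>F L) X') Y Y' g
        (Cmp E (fst (L' \<circ>\<^sub>F L) X') (fst (L' \<circ>\<^sub>F L) X) Y \<psi> (snd (L' \<circ>\<^sub>F L) X' X f)))) =
      Cmp C X' (fst (R \<circ>\<^sub>F R') Y) (fst (R \<circ>\<^sub>F R') Y') (snd (R \<circ>\<^sub>F R') Y Y' g)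
        (Cmp C X' X (fst (R \<circ>\<^sub>F R') Y) (\<Phi> X (fst R' Y) (\<Psi> (fst L X) Y \<psi>)) f)"
      by (simp add: fcomp_def \<Psi>n \<Phi>n mem \<Psi>m)
  qed (auto intro: is_functor_fcomp F)
qed

text \<open>Naturality in both variables at once is split into one rule per variable by putting an
  identity in the other slot.\<close>

lemma left_adjoint_transpose:
  assumes C: "is_cat C" and D: "is_cat D" and A: "left_adjoint C D L R"
  obtains \<Phi> where "\<And>X Y. X \<in> Obj C \<Longrightarrow> Y \<in> Obj D \<Longrightarrow> bij_betw (\<Phi> X Y) (Hom D (fst L X) Y) (Hom C X (fst R Y))"
    and "\<And>X X' Y f \<psi>. X \<in> Obj C \<Longrightarrow> X' \<in> Obj C \<Longrightarrow> Y \<in> Obj D \<Longrightarrow>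
         f \<in> Hom C X' X \<Longrightarrow> \<psi> \<in> Hom D (fst L X) Y \<Longrightarrow>
               \<Phi> X' Y (Cmp D (fst L X') (fst L X) Y \<psi> (snd L X' X f)) = Cmp C X' X (fst R Y) (\<Phi> X Y \<psi>) f"
    and "\<And>X Y Y' g \<psi>. X \<in> Obj C \<Longrightarrow> Y \<in> Obj D \<Longrightarrow> Y' \<in> Obj D \<Longrightarrow>
         g \<in> Hom D Y Y' \<Longrightarrow> \<psi> \<in> Hom D (fst L X) Y \<Longrightarrow>
               \<Phi> X Y' (Cmp D (fst L X) Y Y' g \<psi>) = Cmp C X (fst R Y) (fst R Y') (snd R Y Y' g) (\<Phi> X Y \<psi>)"
proof -
  have F: "is_functor C D L" "is_functor D C R" 
    using A by (auto simp: left_adjoint_def)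
  obtain \<Phi> where \<Phi>: "\<And>X Y. X \<in> Obj C \<Longrightarrow> Y \<in> Obj D \<Longrightarrow> bij_betw (\<Phi> X Y) (Hom D (fst L X) Y) (Hom C X (fst R Y))"
    and \<Phi>n: "\<And>X X' Y Y' f g \<psi>. X \<in> Obj C \<Longrightarrow> X' \<in> Obj C \<Longrightarrow> Y \<in> Obj D \<Longrightarrow> Y' \<in> Obj D \<Longrightarrow>
         f \<in> Hom C X' X \<Longrightarrow> g \<in> Hom D Y Y' \<Longrightarrow> \<psi> \<in> Hom D (fst L X) Y \<Longrightarrow>
               \<Phi> X' Y' (Cmp D (fst L X') Y Y' g (Cmp D (fst L X') (fst L X) Y \<psi> (snd L X' X f))) =
               Cmp C X' (fst R Y) (fst R Y') (snd R Y Y' g) (Cmp C X' X (fst R Y) (\<Phi> X Y \<psi>) f)"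
    using A unfolding left_adjoint_def by metis
  note mem = is_functorD[OF F(1)] is_functorD[OF F(2)] is_catD[OF C] is_catD[OF D]
  have \<Phi>m: "\<Phi> X Y \<psi> \<in> Hom C X (fst R Y)" if "X \<in> Obj C" "Y \<in> Obj D" "\<psi> \<in> Hom D (fst L X) Y" for X Y \<psi>
    using bij_betwE[OF \<Phi>] that by blast
  show thesis
  proof (rule that[OF \<Phi>])
    fix X X' Y f \<psi> assume h: "X \<in> Obj C" "X' \<in> Obj C" "Y \<in> Obj D" "f \<in> Hom C X' X" "\<psi> \<in> Hom D (fst L X) Y"
    have "Cmp D (fst L X') (fst L X) Y \<psi> (snd L X' X f) \<in> Hom D (fst L X') Y"
      using h by (simp add: mem)
    then show "\<Phi> X' Y (Cmp D (fst L X') (fst L X) Y \<psi> (snd L X' X f)) = Cmp C X' X (fst R Y) (\<Phi> X Y \<psi>) f"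
      using \<Phi>n[of X X' Y Y f "Id D Y" \<psi>] h \<Phi>m by (simp add: mem)
  next
    fix X Y Y' g \<psi> assume h: "X \<in> Obj C" "Y \<in> Obj D" "Y' \<in> Obj D" "g \<in> Hom D Y Y'" "\<psi> \<in> Hom D (fst L X) Y"
    then show "\<Phi> X Y' (Cmp D (fst L X) Y Y' g \<psi>) = Cmp C X (fst R Y) (fst R Y') (snd R Y Y' g) (\<Phi> X Y \<psi>)"
      using \<Phi>n[of X X Y Y' "Id C X" g \<psi>] h \<Phi>m by (simp add: mem)
  qed
qed

text \<open>The Yoneda argument: \<open>L\<close> and \<open>L'\<close> represent the same hom-sets
  \<open>Hom C X (fst R Y)\<close>. Every equation is checked after applying an injective
  transposition, where the naturality rules turn both sides into the same transpose.\<close>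

lemma left_adjoint_unique:
  assumes C: "is_cat C" and D: "is_cat D" and A: "left_adjoint C D L R" and B: "left_adjoint C D L' R"
  shows "nat_isomorphic C D L L'"
proof -
  have F: "is_functor C D L" "is_functor C D L'" "is_functor D C R" 
    using A B by (auto simp: left_adjoint_def)
  note mem = is_functorD[OF F(1)] is_functorD[OF F(2)] is_functorD[OF F(3)] is_catD[OF C] is_catD[OF D]
  obtain \<Phi> where \<Phi>: "\<And>X Y. X \<in> Obj C \<Longrightarrow> Y \<in> Obj D \<Longrightarrow> bij_betw (\<Phi> X Y) (Hom D (fst L X) Y) (Hom C X (fst R Y))"
    and \<Phi>1: "\<And>X X' Y f \<psi>. X \<in> Obj C \<Longrightarrow> X' \<in> Obj C \<Longrightarrow> Y \<in> Obj D \<Longrightarrow>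
         f \<in> Hom C X' X \<Longrightarrow> \<psi> \<in> Hom D (fst L X) Y \<Longrightarrow>
               \<Phi> X' Y (Cmp D (fst L X') (fst L X) Y \<psi> (snd L X' X f)) = Cmp C X' X (fst R Y) (\<Phi> X Y \<psi>) f"
    and \<Phi>2: "\<And>X Y Y' g \<psi>. X \<in> Obj C \<Longrightarrow> Y \<in> Obj D \<Longrightarrow> Y' \<in> Obj D \<Longrightarrow>
         g \<in> Hom D Y Y' \<Longrightarrow> \<psi> \<in> Hom D (fst L X) Y \<Longrightarrow>
               \<Phi> X Y' (Cmp D (fst L X) Y Y' g \<psi>) = Cmp C X (fst R Y) (fst R Y') (snd R Y Y' g) (\<Phi> X Y \<psi>)"
    by (rule left_adjoint_transpose[OF C D A]) blast
  obtain \<Psi> where \<Psi>: "\<And>X Y. X \<in> Obj C \<Longrightarrow> Y \<in> Obj D \<Longrightarrow> bij_betw (\<Psi> X Y) (Hom D (fst L' X) Y) (Hom C X (fst R Y))"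
    and \<Psi>1: "\<And>X X' Y f \<psi>. X \<in> Obj C \<Longrightarrow> X' \<in> Obj C \<Longrightarrow> Y \<in> Obj D \<Longrightarrow>
         f \<in> Hom C X' X \<Longrightarrow> \<psi> \<in> Hom D (fst L' X) Y \<Longrightarrow>
               \<Psi> X' Y (Cmp D (fst L' X') (fst L' X) Y \<psi> (snd L' X' X f)) = Cmp C X' X (fst R Y) (\<Psi> X Y \<psi>) f"
    and \<Psi>2: "\<And>X Y Y' g \<psi>. X \<in> Obj C \<Longrightarrow> Y \<in> Obj D \<Longrightarrow> Y' \<in> Obj D \<Longrightarrow>
         g \<in> Hom D Y Y' \<Longrightarrow> \<psi> \<in> Hom D (fst L' X) Y \<Longrightarrow>
               \<Psi> X Y' (Cmp D (fst L' X) Y Y' g \<psi>) = Cmp C X (fst R Y) (fst R Y') (snd R Y Y' g) (\<Psi> X Y \<psi>)"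
    by (rule left_adjoint_transpose[OF C D B]) blast
  \<comment> \<open>\<open>\<tau> X\<close> is the map whose transpose under \<open>\<Phi>\<close>
    is the unit of the other adjunction, that is, the transpose of an identity under
    \<open>\<Psi>\<close>; \<open>\<sigma> X\<close> exchanges the roles.\<close>
  define \<tau> where "\<tau> X = inv_into (Hom D (fst L X) (fst L' X)) (\<Phi> X (fst L' X)) (\<Psi> X (fst L' X) (Id D (fst L' X)))" for X
  define \<sigma> where "\<sigma> X = inv_into (Hom D (fst L' X) (fst L X)) (\<Psi> X (fst L X)) (\<Phi> X (fst L X) (Id D (fst L X)))" for X
  have \<tau>: "\<tau> X \<in> Hom D (fst L X) (fst L' X)" "\<Phi> X (fst L' X) (\<tau> X) = \<Psi> X (fst L' X) (Id D (fst L' X))"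
    and \<sigma>: "\<sigma> X \<in> Hom D (fst L' X) (fst L X)" "\<Psi> X (fst L X) (\<sigma> X) = \<Phi> X (fst L X) (Id D (fst L X))"
    if X: "X \<in> Obj C" for X
  proof -
    have "\<Psi> X (fst L' X) (Id D (fst L' X)) \<in> \<Phi> X (fst L' X) ` Hom D (fst L X) (fst L' X)"
      using bij_betw_imp_surj_on[OF \<Phi>[of X "fst L' X"]] bij_betwE[OF \<Psi>[of X "fst L' X"]] X by (simp add: mem)
    then show "\<tau> X \<in> Hom D (fst L X) (fst L' X)" "\<Phi> X (fst L' X) (\<tau> X) = \<Psi> X (fst L' X) (Id D (fst L' X))"
      unfolding \<tau>_def by (auto intro: inv_into_into f_inv_into_f)
    have "\<Phi> X (fst L X) (Id D (fst L X)) \<in> \<Psi> X (fst L X) ` Hom D (fst L' X) (fst L X)"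
      using bij_betw_imp_surj_on[OF \<Psi>[of X "fst L X"]] bij_betwE[OF \<Phi>[of X "fst L X"]] X by (simp add: mem)
    then show "\<sigma> X \<in> Hom D (fst L' X) (fst L X)" "\<Psi> X (fst L X) (\<sigma> X) = \<Phi> X (fst L X) (Id D (fst L X))"
      unfolding \<sigma>_def by (auto intro: inv_into_into f_inv_into_f)
  qed
  have \<Phi>inj: "f = g" if "\<Phi> X Y f = \<Phi> X Y g" "X \<in> Obj C" "Y \<in> Obj D" "f \<in> Hom D (fst L X) Y" "g \<in> Hom D (fst L X) Y" for X Y f g
    using bij_betw_imp_inj_on[OF \<Phi>] that by (meson inj_onD)
  have \<Psi>inj: "f = g" if "\<Psi> X Y f = \<Psi> X Y g" "X \<in> Obj C" "Y \<in> Obj D" "f \<in> Hom D (fst L' X) Y" "g \<in> Hom D (fst L' X) Y" for X Y f g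
    using bij_betw_imp_inj_on[OF \<Psi>] that by (meson inj_onD)
  show ?thesis
    unfolding nat_isomorphic_def
  proof (intro conjI exI[of _ \<tau>] ballI)
    fix X assume X: "X \<in> Obj C"
    have "Cmp D (fst L X) (fst L' X) (fst L X) (\<sigma> X) (\<tau> X) = Id D (fst L X)"
    proof (rule \<Phi>inj)
      show "\<Phi> X (fst L X) (Cmp D (fst L X) (fst L' X) (fst L X) (\<sigma> X) (\<tau> X)) = \<Phi> X (fst L X) (Id D (fst L X))"
        using X \<tau> \<sigma> \<Psi>2[of X "fst L' X" "fst L X" "\<sigma> X" "Id D (fst L' X)"]
        by (simp add: \<Phi>2 mem)
    qed (use X \<tau> \<sigma> mem in auto)
    moreover have "Cmp D (fst L' X) (fst L X) (fst L' X) (\<tau> X) (\<sigma> X) = Id D (fst L' X)"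
    proof (rule \<Psi>inj)
      show "\<Psi> X (fst L' X) (Cmp D (fst L' X) (fst L X) (fst L' X) (\<tau> X) (\<sigma> X)) = \<Psi> X (fst L' X) (Id D (fst L' X))"
        using X \<tau> \<sigma> \<Phi>2[of X "fst L X" "fst L' X" "\<tau> X" "Id D (fst L X)"]
        by (simp add: \<Psi>2 mem)
    qed (use X \<tau> \<sigma> mem in auto)
    ultimately show "iso_in D (fst L X) (fst L' X) (\<tau> X)"
      using \<tau> \<sigma> X by (auto simp: iso_in_def)
  next
    fix X Y f assume h: "X \<in> Obj C" "Y \<in> Obj C" "f \<in> Hom C X Y"
    show "Cmp D (fst L X) (fst L Y) (fst L' Y) (\<tau> Y) (snd L X Y f) =
       Cmp D (fst L X) (fst L' X) (fst L' Y) (snd L' X Y f) (\<tau> X)"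
    proof (rule \<Phi>inj)
      have "\<Phi> X (fst L' Y) (Cmp D (fst L X) (fst L Y) (fst L' Y) (\<tau> Y) (snd L X Y f)) = \<Psi> X (fst L' Y) (snd L' X Y f)"
        using h \<tau> \<Psi>1[of Y X "fst L' Y" f "Id D (fst L' Y)"] by (simp add: \<Phi>1 mem)
      also have "\<dots> = \<Phi> X (fst L' Y) (Cmp D (fst L X) (fst L' X) (fst L' Y) (snd L' X Y f) (\<tau> X))"
        using h \<tau> \<Psi>2[of X "fst L' X" "fst L' Y" "snd L' X Y f" "Id D (fst L' X)"] by (simp add: \<Phi>2 mem)
      finally show "\<Phi> X (fst L' Y) (Cmp D (fst L X) (fst L Y) (fst L' Y) (\<tau> Y) (snd L X Y f)) =
        \<Phi> X (fst L' Y) (Cmp D (fst L X) (fst L' X) (fst L' Y) (snd L' X Y f) (\<tau> X))" .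
    qed (use h \<tau> mem in auto)
  qed (use F in auto)
qed

section \<open>Categories of spectra\<close>

lemma Sp_simps [simp]:
  "Obj (Sp J) = {X. is_spec J X}" "Hom (Sp J) = spec_maps J"
  "Id (Sp J) X = (\<lambda>V \<in> tObj J. \<lambda>x \<in> pts (sp X V). x)"
  "Cmp (Sp J) X Y Z \<psi> \<phi> = (\<lambda>V \<in> tObj J. compose (pts (sp X V)) (\<psi> V) (\<phi> V))"
  by (simp_all add: Sp_def)

lemma SpG_simps [simp]:
  "Obj (SpG J K) = {X. is_gspec J K X}" "Hom (SpG J K) = gspec_maps J K"
  "Id (SpG J K) X = Id (Sp J) (fst X)"
  "Cmp (SpG J K) X Y Z = Cmp (Sp J) (fst X) (fst Y) (fst Z)"
  by (simp_all add: SpG_def)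

lemma aut_group_simps [simp]:
  "carrier (aut_group C X) = {f. iso_in C X X f}" "mult (aut_group C X) = Cmp C X X X"
  "one (aut_group C X) = Id C X"
  by (simp_all add: aut_group_def)

lemma spec_maps_iff:
  "\<phi> \<in> spec_maps J X Y \<longleftrightarrow> \<phi> \<in> extensional (tObj J) \<and>
     (\<forall>V \<in> tObj J. \<phi> V \<in> extensional (pts (sp X V)) \<and>
        continuous_map (fst (sp X V)) (fst (sp Y V)) (\<phi> V) \<and> \<phi> V (snd (sp X V)) = snd (sp Y V)) \<and>
     (\<forall>U \<in> tObj J. \<forall>V \<in> tObj J. \<forall>j \<in> topspace (tHom J U V). \<forall>x \<in> pts (sp X U).
       \<phi> V (str X U V j x) = str Y U V j (\<phi> U x))"
  by (auto simp: spec_maps_def topspace_based_maps PiE_iff)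

lemma spec_mapsD:
  assumes "\<phi> \<in> spec_maps J X Y"
  shows "\<phi> \<in> extensional (tObj J)"
    and "V \<in> tObj J \<Longrightarrow> \<phi> V \<in> extensional (pts (sp X V))"
    and "V \<in> tObj J \<Longrightarrow> continuous_map (fst (sp X V)) (fst (sp Y V)) (\<phi> V)"
    and "V \<in> tObj J \<Longrightarrow> x \<in> pts (sp X V) \<Longrightarrow> \<phi> V x \<in> pts (sp Y V)"
    and "V \<in> tObj J \<Longrightarrow> \<phi> V (snd (sp X V)) = snd (sp Y V)"
    and "\<lbrakk>U \<in> tObj J; V \<in> tObj J; j \<in> topspace (tHom J U V); x \<in> pts (sp X U)\<rbrakk> \<Longrightarrow>
       \<phi> V (str X U V j x) = str Y U V j (\<phi> U x)"
  using assms by (auto simp: spec_maps_iff continuous_map_def)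

lemma is_specD:
  assumes "is_spec J X"
  shows "V \<in> tObj J \<Longrightarrow> CGWH (fst (sp X V))"
    and "V \<in> tObj J \<Longrightarrow> kify (fst (sp X V)) = fst (sp X V)"
    and "V \<in> tObj J \<Longrightarrow> weak_Hausdorff (fst (sp X V))"
    and "V \<in> tObj J \<Longrightarrow> snd (sp X V) \<in> pts (sp X V)"
    and "V \<in> tObj J \<Longrightarrow> str X V V (tId J V) = (\<lambda>x \<in> pts (sp X V). x)"
    and "\<lbrakk>U \<in> tObj J; V \<in> tObj J\<rbrakk> \<Longrightarrow>
           continuous_map (tHom J U V) (based_maps (sp X U) (sp X V)) (str X U V)"
    and "\<lbrakk>U \<in> tObj J; V \<in> tObj J; j \<in> topspace (tHom J U V)\<rbrakk> \<Longrightarrow>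
           str X U V j \<in> extensional (pts (sp X U)) \<and>
           continuous_map (fst (sp X U)) (fst (sp X V)) (str X U V j) \<and>
           str X U V j (snd (sp X U)) = snd (sp X V)"
    and "\<lbrakk>U \<in> tObj J; V \<in> tObj J; j \<in> topspace (tHom J U V); x \<in> pts (sp X U)\<rbrakk> \<Longrightarrow>
           str X U V j x \<in> pts (sp X V)"
    and "\<lbrakk>U \<in> tObj J; V \<in> tObj J\<rbrakk> \<Longrightarrow>
           str X U V (tBase J U V) = (\<lambda>x \<in> pts (sp X U). snd (sp X V))"
    and "\<lbrakk>U \<in> tObj J; V \<in> tObj J; W \<in> tObj J; i \<in> topspace (tHom J U V); j \<in> topspace (tHom J V W)\<rbrakk> \<Longrightarrow>
           str X U W (tCmp J U V W j i) = compose (pts (sp X U)) (str X V W j) (str X U V i)"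
proof -
  show *: "continuous_map (tHom J U V) (based_maps (sp X U) (sp X V)) (str X U V)" if "U \<in> tObj J" "V \<in> tObj J" for U V
    using assms that by (simp add: is_spec_def)
  show **: "str X U V j \<in> extensional (pts (sp X U)) \<and>
           continuous_map (fst (sp X U)) (fst (sp X V)) (str X U V j) \<and>
           str X U V j (snd (sp X U)) = snd (sp X V)" if "U \<in> tObj J" "V \<in> tObj J" "j \<in> topspace (tHom J U V)" for U V j
    using *[OF that(1,2)] that(3) by (auto simp: continuous_map_def topspace_based_maps)
  show "str X U V j x \<in> pts (sp X V)" if "U \<in> tObj J" "V \<in> tObj J" "j \<in> topspace (tHom J U V)" "x \<in> pts (sp X U)" for U V j x
    using **[OF that(1-3)] that(4) by (auto simp: continuous_map_def)
qed (use assms in \<open>auto simp: is_spec_def based_CGWH_def CGWH_def\<close>)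

lemma spec_maps_Id: "is_spec J X \<Longrightarrow> Id (Sp J) X \<in> spec_maps J X X"
  by (auto simp: spec_maps_iff is_specD intro: continuous_map_eq[OF continuous_map_id])

lemma spec_maps_Cmp:
  assumes \<phi>: "\<phi> \<in> spec_maps J X Y" and \<psi>: "\<psi> \<in> spec_maps J Y Z" and X: "is_spec J X"
  shows "Cmp (Sp J) X Y Z \<psi> \<phi> \<in> spec_maps J X Z"
proof -
  have "continuous_map (fst (sp X V)) (fst (sp Z V)) (compose (pts (sp X V)) (\<psi> V) (\<phi> V))" if "V \<in> tObj J" for V
    by (rule continuous_map_eq[OF continuous_map_compose[OF spec_mapsD(3)[OF \<phi> that] spec_mapsD(3)[OF \<psi> that]]])
      (simp add: compose_def)
  then show ?thesis
    by (auto simp: spec_maps_iff compose_def spec_mapsD[OF \<phi>] spec_mapsD[OF \<psi>] is_specD[OF X])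
qed

lemma compose_Id1: "f \<in> extensional A \<Longrightarrow> compose A f (\<lambda>x\<in>A. x) = f"
  by (auto simp: compose_def extensional_def)

lemma is_cat_Sp: "is_cat (Sp J)"
proof -
  have L: "Cmp (Sp J) X X Y \<phi> (Id (Sp J) X) = \<phi>" if "\<phi> \<in> spec_maps J X Y" for X Y \<phi>
    by (rule extensionalityI[of _ "tObj J"])
       (auto simp: that spec_mapsD[OF that] compose_Id1)
  have R: "Cmp (Sp J) X Y Y (Id (Sp J) Y) \<phi> = \<phi>" if "\<phi> \<in> spec_maps J X Y" for X Y \<phi>
  proof (rule extensionalityI[of _ "tObj J"])
    fix V assume V: "V \<in> tObj J"
    show "Cmp (Sp J) X Y Y (Id (Sp J) Y) \<phi> V = \<phi> V"
      by (rule extensionalityI[of _ "pts (sp X V)"])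
         (auto simp: compose_def V spec_mapsD[OF that])
  qed (auto simp: spec_mapsD[OF that])
  have A: "Cmp (Sp J) W Y Z h (Cmp (Sp J) W X Y g f) = Cmp (Sp J) W X Z (Cmp (Sp J) X Y Z h g) f"
    if "f \<in> spec_maps J W X" "g \<in> spec_maps J X Y" "h \<in> spec_maps J Y Z" for W X Y Z f g h
    by (auto simp: compose_def fun_eq_iff spec_mapsD[OF that(1)])
  show ?thesis
    unfolding is_cat_def using L R A spec_maps_Id spec_maps_Cmp by (auto simp del: Sp_simps(3,4))
qed

lemma gspec_mapsD:
  assumes "\<phi> \<in> gspec_maps J K X Y"
  shows "\<phi> \<in> spec_maps J (fst X) (fst Y)"
    and "\<lbrakk>k \<in> carrier K; V \<in> tObj J; x \<in> pts (sp (fst X) V)\<rbrakk> \<Longrightarrow> \<phi> V (snd X k V x) = snd Y k V (\<phi> V x)"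
  using assms by (auto simp: gspec_maps_def)

lemma is_gspecD:
  assumes "is_gspec J K X"
  shows "is_spec J (fst X)"
    and "k \<in> carrier K \<Longrightarrow> iso_in (Sp J) (fst X) (fst X) (snd X k)"
    and "k \<in> carrier K \<Longrightarrow> snd X k \<in> spec_maps J (fst X) (fst X)"
    and "\<lbrakk>k \<in> carrier K; l \<in> carrier K; V \<in> tObj J; x \<in> pts (sp (fst X) V)\<rbrakk> \<Longrightarrow>
          snd X (k \<otimes>\<^bsub>K\<^esub> l) V x = snd X k V (snd X l V x)"
    and "V \<in> tObj J \<Longrightarrow>
          continuous_map (top_of_set (carrier K)) (based_maps (sp (fst X) V) (sp (fst X) V)) (\<lambda>k. snd X k V)"
    and "\<lbrakk>k \<in> carrier K; V \<in> tObj J; x \<in> pts (sp (fst X) V)\<rbrakk> \<Longrightarrow> snd X k V x \<in> pts (sp (fst X) V)"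
    and "\<lbrakk>k \<in> carrier K; V \<in> tObj J\<rbrakk> \<Longrightarrow> snd X k V (snd (sp (fst X) V)) = snd (sp (fst X) V)"
proof -
  show "is_spec J (fst X)"
    using assms by (auto simp: is_gspec_def)
  show 2: "iso_in (Sp J) (fst X) (fst X) (snd X k)" if "k \<in> carrier K" for k
    using assms that by (auto simp: is_gspec_def hom_def Pi_iff)
  show 3: "snd X k \<in> spec_maps J (fst X) (fst X)" if "k \<in> carrier K" for k
    using 2 that by (auto simp: iso_in_def)
  show "snd X (k \<otimes>\<^bsub>K\<^esub> l) V x = snd X k V (snd X l V x)"
    if "k \<in> carrier K" "l \<in> carrier K" "V \<in> tObj J" "x \<in> pts (sp (fst X) V)" for k l V x
    using assms that by (auto simp: is_gspec_def hom_def compose_def)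
  show "continuous_map (top_of_set (carrier K)) (based_maps (sp (fst X) V) (sp (fst X) V)) (\<lambda>k. snd X k V)"
    if "V \<in> tObj J" for V
    using assms that by (auto simp: is_gspec_def aut_top_def continuous_map_in_subtopology continuous_map_componentwise)
  show "snd X k V x \<in> pts (sp (fst X) V)" if "k \<in> carrier K" "V \<in> tObj J" "x \<in> pts (sp (fst X) V)" for k V x
    using spec_mapsD[OF 3] that by blast
  show "snd X k V (snd (sp (fst X) V)) = snd (sp (fst X) V)" if "k \<in> carrier K" "V \<in> tObj J" for k V
    using spec_mapsD[OF 3] that by blast
qed

text \<open>Membership in \<open>hom\<close> says nothing about units. Multiplicativity makes the
  action of the unit idempotent, and since it is an isomorphism its left inverse cancels one
  factor.\<close>

lemma gspec_one:
  assumes X: "is_gspec J K X" and K: "group K" and V: "V \<in> tObj J" and x: "x \<in> pts (sp (fst X) V)"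
  shows "snd X \<one>\<^bsub>K\<^esub> V x = x"
proof -
  interpret K: group K by fact
  let ?e = "snd X \<one>\<^bsub>K\<^esub>"
  obtain g where g: "g \<in> spec_maps J (fst X) (fst X)" "Cmp (Sp J) (fst X) (fst X) (fst X) g ?e = Id (Sp J) (fst X)"
    using is_gspecD(2)[OF X K.one_closed] by (auto simp: iso_in_def)
  have ge: "g V (?e V y) = y" if "y \<in> pts (sp (fst X) V)" for y
    using fun_cong[OF fun_cong[OF g(2)], of V y] V that by (simp add: compose_def)
  have y: "?e V x \<in> pts (sp (fst X) V)" using is_gspecD(6)[OF X] V x by simp
  have "?e V (?e V x) = ?e V x"
    using is_gspecD(4)[OF X K.one_closed K.one_closed V x] by simp
  then show ?thesis
    using ge[OF y] ge[OF x] by simp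
qed

text \<open>Invertibility of the action of \<open>k\<close> comes from that of the inverse of
  \<open>k\<close>, so levelwise laws are enough. Continuity is levelwise too, since
  \<open>aut_top\<close> is a subspace of a product.\<close>

lemma is_gspecI:
  fixes X :: "('o, 'm, 'g::topological_space, 'u) gspec"
  assumes X: "is_spec J (fst X)" and K: "group K"
    and map: "\<And>k. k \<in> carrier K \<Longrightarrow> snd X k \<in> spec_maps J (fst X) (fst X)"
    and mult: "\<And>k l V x. \<lbrakk>k \<in> carrier K; l \<in> carrier K; V \<in> tObj J; x \<in> pts (sp (fst X) V)\<rbrakk> \<Longrightarrow>
          snd X (k \<otimes>\<^bsub>K\<^esub> l) V x = snd X k V (snd X l V x)"
    and one: "\<And>V x. \<lbrakk>V \<in> tObj J; x \<in> pts (sp (fst X) V)\<rbrakk> \<Longrightarrow> snd X \<one>\<^bsub>K\<^esub> V x = x"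
    and cont: "\<And>V. V \<in> tObj J \<Longrightarrow>
          continuous_map (top_of_set (carrier K)) (based_maps (sp (fst X) V) (sp (fst X) V)) (\<lambda>k. snd X k V)"
  shows "is_gspec J K X"
proof -
  interpret K: group K by fact
  have mult': "snd X (k \<otimes>\<^bsub>K\<^esub> l) = Cmp (Sp J) (fst X) (fst X) (fst X) (snd X k) (snd X l)"
    if k: "k \<in> carrier K" "l \<in> carrier K" for k l
  proof (rule extensionalityI[of _ "tObj J"])
    fix V assume V: "V \<in> tObj J"
    show "snd X (k \<otimes>\<^bsub>K\<^esub> l) V = Cmp (Sp J) (fst X) (fst X) (fst X) (snd X k) (snd X l) V"
      by (rule extensionalityI[of _ "pts (sp (fst X) V)"])
         (use V k mult spec_mapsD[OF map] in \<open>auto simp: compose_def\<close>)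
  qed (use k spec_mapsD[OF map] in auto)
  have one': "snd X \<one>\<^bsub>K\<^esub> = Id (Sp J) (fst X)"
  proof (rule extensionalityI[of _ "tObj J"])
    fix V assume V: "V \<in> tObj J"
    show "snd X \<one>\<^bsub>K\<^esub> V = Id (Sp J) (fst X) V"
      by (rule extensionalityI[of _ "pts (sp (fst X) V)"])
         (use V one spec_mapsD[OF map] in auto)
  qed (use spec_mapsD[OF map] in auto)
  have iso: "iso_in (Sp J) (fst X) (fst X) (snd X k)" if k: "k \<in> carrier K" for k
    unfolding iso_in_def using k map mult'[of k "inv\<^bsub>K\<^esub> k"] mult'[of "inv\<^bsub>K\<^esub> k" k] one'
    by (auto simp del: Sp_simps(3,4) intro!: bexI[of _ "snd X (inv\<^bsub>K\<^esub> k)"])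
  have "continuous_map (top_of_set (carrier K)) (aut_top J (fst X)) (snd X)"
    unfolding aut_top_def continuous_map_in_subtopology continuous_map_componentwise
    using iso cont spec_mapsD[OF map] by (auto simp del: Sp_simps(3,4))
  then show ?thesis
    unfolding is_gspec_def using X iso mult' by (auto simp: hom_def simp del: Sp_simps(3,4))
qed

lemma is_cat_SpG: "is_cat (SpG J K)"
proof -
  have I: "Id (Sp J) (fst X) \<in> gspec_maps J K X X" if "is_gspec J K X" for X
    using spec_maps_Id[OF is_gspecD(1)[OF that]] by (auto simp: gspec_maps_def is_gspecD[OF that])
  have C: "Cmp (Sp J) (fst X) (fst Y) (fst Z) g f \<in> gspec_maps J K X Z"
    if "is_gspec J K X" "f \<in> gspec_maps J K X Y" "g \<in> gspec_maps J K Y Z" for X Y Z f g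
    using that spec_maps_Cmp[OF gspec_mapsD(1)[OF that(2)] gspec_mapsD(1)[OF that(3)] is_gspecD(1)[OF that(1)]]
    by (auto simp: gspec_maps_def compose_def is_gspecD spec_mapsD)
  have S: "is_spec J (fst X)" if "X \<in> {X. is_gspec J K X}" for X
    using that is_gspecD(1) by blast
  note Sp = is_catD[OF is_cat_Sp[of J], unfolded Sp_simps(1,2) mem_Collect_eq]
  show ?thesis
    unfolding is_cat_def SpG_simps
  proof (intro conjI ballI)
    show "Id (Sp J) (fst X) \<in> gspec_maps J K X X" if "X \<in> {X. is_gspec J K X}" for X
      using that by (intro I) simp
    show "Cmp (Sp J) (fst X) (fst Y) (fst Z) g f \<in> gspec_maps J K X Z"
      if "X \<in> {X. is_gspec J K X}" "f \<in> gspec_maps J K X Y" "g \<in> gspec_maps J K Y Z" for X Y Z f g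
      using that by (intro C[of X f Y]) simp_all
  qed (rule Sp(3-5); use S gspec_mapsD(1) in blast)+
qed

lemma is_functor_res:
  assumes K: "group H" and \<iota>: "\<iota> \<in> hom H G" "continuous_on (carrier H) \<iota>"
  shows "is_functor (SpG J G) (SpG J H) (res \<iota>)"
proof -
  have \<iota>c: "\<iota> h \<in> carrier G" if "h \<in> carrier H" for h using \<iota> that by (auto simp: hom_def)
  have "is_gspec J H (fst X, \<lambda>h. snd X (\<iota> h))" if X: "is_gspec J G X" for X
  proof -
    have "snd X \<circ> \<iota> \<in> hom H (aut_group (Sp J) (fst X))"
      using X \<iota>(1) by (auto simp: is_gspec_def hom_def Pi_iff)
    moreover have "continuous_map (top_of_set (carrier H)) (aut_top J (fst X)) (snd X \<circ> \<iota>)"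
      using X \<iota> \<iota>c by (intro continuous_map_compose[of _ "top_of_set (carrier G)"]) (auto simp: is_gspec_def)
    ultimately show ?thesis
      using X by (simp add: is_gspec_def o_def)
  qed
  then show ?thesis
    using \<iota>c by (auto simp: is_functor_def res_def gspec_maps_def)
qed

section \<open>Quotients inside the universe\<close>

text \<open>An infinite cardinal equals its own square.\<close>

lemma Times_UNIV_lepoll_infinite:
  assumes "infinite (UNIV :: 'u set)" "(UNIV :: 'a set) \<lesssim> (UNIV :: 'u set)" "(UNIV :: 'b set) \<lesssim> (UNIV :: 'u set)"
  shows "(UNIV :: ('a \<times> 'b) set) \<lesssim> (UNIV :: 'u set)"
proof -
  have "(UNIV :: 'u set) \<times> (UNIV :: 'u set) \<approx> (UNIV :: 'u set)"
    using card_of_Times_same_infinite[OF assms(1)] by (simp add: eqpoll_iff_card_of_ordIso)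
  moreover have "(UNIV :: 'a set) \<times> (UNIV :: 'b set) \<lesssim> (UNIV :: 'u set) \<times> (UNIV :: 'u set)"
    using assms by (intro times_lepoll_mono)
  ultimately show ?thesis
    by (metis UNIV_Times_UNIV eqpoll_imp_lepoll lepoll_trans)
qed

lemma UNIV_set_lepoll_mono:
  assumes "(UNIV :: 'a set) \<lesssim> (UNIV :: 'b set)"
  shows "(UNIV :: 'a set set) \<lesssim> (UNIV :: 'b set set)"
  using assms inj_on_image_Pow[of _ "UNIV :: 'a set"] by (auto simp: lepoll_def)

lemma UNIV_lepoll_UNIV_set: "(UNIV :: 'a set) \<lesssim> (UNIV :: 'a set set)"
  using lepoll_Pow_self[of "UNIV :: 'a set"] by simp

lemma UNIV_lepoll_UNIV_fun: "(UNIV :: 'b set) \<lesssim> (UNIV :: ('a \<Rightarrow> 'b) set)"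
  unfolding lepoll_def by (rule exI[of _ "\<lambda>b _. b"]) (auto simp: inj_on_def fun_eq_iff)

lemma inj_code_in: "(UNIV :: 'p set) \<lesssim> (UNIV :: 'u set) \<Longrightarrow> inj (code_in :: 'p \<Rightarrow> 'u)"
  unfolding code_in_def by (rule someI_ex[where P = inj]) (auto simp: lepoll_def)

lemma openin_qtop:
  fixes U :: "'u set"
  shows "openin (qtop P R) U \<longleftrightarrow> U \<subseteq> qproj R ` topspace P \<and> openin P {p \<in> topspace P. qproj R p \<in> U}"
proof -
  have "istopology (\<lambda>U :: 'u set. U \<subseteq> qproj R ` topspace P \<and> openin P {p \<in> topspace P. qproj R p \<in> U})" (is "istopology ?P")
    unfolding istopology_def
  proof (intro conjI allI impI)
    fix S T assume ST: "?P S" "?P T"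
    have "{p \<in> topspace P. qproj R p \<in> S \<inter> T} = {p \<in> topspace P. qproj R p \<in> S} \<inter> {p \<in> topspace P. qproj R p \<in> T}"
      by auto
    then show "openin P {p \<in> topspace P. qproj R p \<in> S \<inter> T}"
      using ST by (simp add: openin_Int)
  next
    fix \<K> assume H: "\<forall>S\<in>\<K>. ?P S"
    have "{p \<in> topspace P. qproj R p \<in> \<Union>\<K>} = (\<Union>S\<in>\<K>. {p \<in> topspace P. qproj R p \<in> S})"
      by auto
    moreover have "openin P (\<Union>S\<in>\<K>. {p \<in> topspace P. qproj R p \<in> S})"
      using H by (intro openin_Union) auto
    ultimately show "openin P {p \<in> topspace P. qproj R p \<in> \<Union>\<K>}"
      by simp
  qed auto
  then show ?thesis
    by (simp add: qtop_def)
qed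

lemma topspace_qtop: "topspace (qtop P R) = qproj R ` topspace P"
proof
  show "topspace (qtop P R) \<subseteq> qproj R ` topspace P"
    by (metis openin_qtop openin_topspace)
  have "openin (qtop P R) (qproj R ` topspace P)"
    by (auto simp: openin_qtop cong: conj_cong)
  then show "qproj R ` topspace P \<subseteq> topspace (qtop P R)"
    by (rule openin_subset)
qed

lemma quotient_map_qproj: "quotient_map P (qtop P R) (qproj R)"
  unfolding quotient_map_def by (auto simp: topspace_qtop openin_qtop)

text \<open>Related points have the same class, hence the same predicate under \<open>SOME\<close>
  and the same chosen element. Conversely the injective code determines that element, which is
  related to both points.\<close>

lemma qproj_eq_iff:
  fixes P :: "'p topology"
  assumes inj: "inj (code_in :: 'p \<Rightarrow> 'u)" and R: "equiv (topspace P) R"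
    and p: "p \<in> topspace P" "p' \<in> topspace P"
  shows "(qproj R p :: 'u) = qproj R p' \<longleftrightarrow> (p, p') \<in> R"
proof
  have S: "(x, SOME y. (x, y) \<in> R) \<in> R" if "x \<in> topspace P" for x
    by (rule someI[of "\<lambda>y. (x, y) \<in> R" x]) (use R that in \<open>auto simp: equiv_def refl_on_def\<close>)
  assume "(qproj R p :: 'u) = qproj R p'"
  then have "(SOME y. (p, y) \<in> R) = (SOME y. (p', y) \<in> R)"
    using inj by (simp add: qproj_def inj_eq)
  then have "(p, SOME y. (p, y) \<in> R) \<in> R" "(SOME y. (p, y) \<in> R, p') \<in> R"
    using S[OF p(1)] S[OF p(2)] R by (auto simp: equiv_def dest: symD)
  then show "(p, p') \<in> R"
    using R by (meson equiv_def transD)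
next
  assume "(p, p') \<in> R"
  then have "(p, y) \<in> R \<longleftrightarrow> (p', y) \<in> R" for y
    using R unfolding equiv_def by (meson symD transD)
  then show "(qproj R p :: 'u) = qproj R p'" by (simp add: qproj_def)
qed

lemma inv_into_qproj:
  fixes P :: "'p topology"
  assumes inj: "inj (code_in :: 'p \<Rightarrow> 'u)" and R: "equiv (topspace P) R" and p: "p \<in> topspace P"
  shows "inv_into (topspace P) (qproj R) (qproj R p :: 'u) \<in> topspace P"
    and "(p, inv_into (topspace P) (qproj R) (qproj R p :: 'u)) \<in> R"
proof -
  show 1: "inv_into (topspace P) (qproj R) (qproj R p :: 'u) \<in> topspace P"
    using p by (intro inv_into_into) auto
  have "qproj R p = (qproj R (inv_into (topspace P) (qproj R) (qproj R p :: 'u)) :: 'u)"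
    by (rule f_inv_into_f[symmetric]) (use p in simp)
  then show "(p, inv_into (topspace P) (qproj R) (qproj R p :: 'u)) \<in> R"
    by (rule iffD1[OF qproj_eq_iff[OF inj R p 1]])
qed

lemma qmap_qproj:
  fixes P :: "'p topology"
  assumes inj: "inj (code_in :: 'p \<Rightarrow> 'u)" and R: "equiv (topspace P) R" and p: "p \<in> topspace P"
    and f: "\<And>p'. (p, p') \<in> R \<Longrightarrow> (qproj R' (f p) :: 'u) = qproj R' (f p')"
  shows "(qmap P R R' f (qproj R p :: 'u) :: 'u) = qproj R' (f p)"
  using inv_into_qproj[OF inj R p] f p by (simp add: qmap_def topspace_qtop)

lemma qmap_extensional: "qmap P R R' f \<in> extensional (topspace (qtop P R))"
  by (simp add: qmap_def)

text \<open>A compact Hausdorff space is locally compact, so multiplying a quotient map by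
  \<open>T\<close> gives a quotient map again. This is what carries joint continuity in a morphism
  and a point over to classes.\<close>

lemma continuous_map_prod_qtop:
  assumes T: "compact_space T" "Hausdorff_space T"
    and f: "continuous_map (prod_topology T P) B (\<lambda>(t, p). f t (qproj R p))"
  shows "continuous_map (prod_topology T (qtop P R)) B (\<lambda>(t, z). f t z)"
proof -
  have q: "quotient_map (prod_topology T P) (prod_topology T (qtop P R)) (\<lambda>(t, p). (t, qproj R p))"
    using T by (intro quotient_map_prod_right quotient_map_qproj) (auto simp: compact_imp_locally_compact_space)
  have "continuous_map (prod_topology T P) B ((\<lambda>(t, z). f t z) \<circ> (\<lambda>(t, p). (t, qproj R p)))"
    using f by (simp add: o_def case_prod_beta')
  with q show ?thesis by (rule continuous_compose_quotient_map)
qed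

text \<open>Test maps into \<open>P\<close> become maps into the quotient after composition with
  \<open>qproj\<close>. So the preimage of a k-open set is k-open in \<open>P\<close>, hence open,
  and this is openness in the quotient topology.\<close>

lemma kify_qtop:
  fixes P :: "'p topology"
  assumes P: "kify P = P" and small: "(UNIV :: 'p set set set) \<lesssim> (UNIV :: 'u set set set)"
  shows "kify (qtop P R :: 'u topology) = qtop P R"
proof (rule kify_eqI)
  fix U assume U: "openin (kify (qtop P R :: 'u topology)) U"
  have "openin (kify P) {p \<in> topspace P. qproj R p \<in> U}"
    unfolding openin_kify
  proof (intro conjI allI impI)
    fix L u assume L: "test_map P L u"
    then have "continuous_map L (qtop P R :: 'u topology) (qproj R \<circ> u)"
      unfolding test_map_def using quotient_imp_continuous_map[OF quotient_map_qproj] continuous_map_compose by blast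
    then have "continuous_map L (kify (qtop P R :: 'u topology)) (qproj R \<circ> u)"
      using L by (intro continuous_map_into_kify small) (auto simp: test_map_def)
    from openin_continuous_map_preimage[OF this U]
    have "openin L {l \<in> topspace L. qproj R (u l) \<in> U}" by simp
    moreover have "{l \<in> topspace L. qproj R (u l) \<in> U} = {l \<in> topspace L. u l \<in> {p \<in> topspace P. qproj R p \<in> U}}"
      using L by (auto simp: test_map_def continuous_map_def)
    ultimately show "openin L {l \<in> topspace L. u l \<in> {p \<in> topspace P. qproj R p \<in> U}}" by simp
  qed auto
  moreover have "U \<subseteq> topspace (qtop P R)"
    using openin_subset[OF U] by simp
  ultimately show "openin (qtop P R) U"
    by (simp add: P openin_qtop topspace_qtop)
qed

text \<open>
  The pullback of a test map along a proper quotient map is compact. It is Hausdorff as soon as the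
  fibres of the quotient map embed into a Hausdorff space, and then it is a test space for \<open>P\<close>.
\<close>

lemma weak_Hausdorff_qtop:
  fixes P :: "'p topology" and Y :: "'y topology"
  assumes P: "weak_Hausdorff P" and q: "proper_map P (qtop P R :: 'u topology) (qproj R)"
    and Y: "Hausdorff_space Y" and s: "continuous_map P Y s"
    and inj: "\<And>p p'. \<lbrakk>p \<in> topspace P; p' \<in> topspace P; (qproj R p :: 'u) = qproj R p'; s p = s p'\<rbrakk> \<Longrightarrow> p = p'"
    and small: "(UNIV :: ('u set set \<times> 'p) set) \<lesssim> (UNIV :: 'p set set set)"
  shows "weak_Hausdorff (qtop P R :: 'u topology)"
  unfolding weak_Hausdorff_def
proof (intro allI impI)
  let ?Q = "qtop P R :: 'u topology" and ?q = "qproj R :: 'p \<Rightarrow> 'u"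
  fix K v assume K: "test_map ?Q K v"
  \<comment> \<open>The fibre product of \<open>K\<close> and \<open>P\<close> over the quotient,
    written as the preimage of the compact graph of \<open>v\<close> so that properness of the
    product of the identity with \<open>?q\<close> gives its compactness.\<close>
  define E where "E = {x \<in> topspace (prod_topology K P). (fst x, ?q (snd x)) \<in> (\<lambda>k. (k, v k)) ` topspace K}"
  have E: "E = {(k, p). k \<in> topspace K \<and> p \<in> topspace P \<and> v k = ?q p}"
    by (force simp: E_def)
  have "compactin (prod_topology K ?Q) ((\<lambda>k. (k, v k)) ` topspace K)"
  proof (rule image_compactin)
    show "compactin K (topspace K)" using K by (simp add: test_map_def compact_space_def)
    show "continuous_map K (prod_topology K ?Q) (\<lambda>k. (k, v k))"
      using K by (auto simp: test_map_def continuous_map_paired)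
  qed
  moreover have "proper_map (prod_topology K P) (prod_topology K ?Q) (\<lambda>(k, p). (k, ?q p))"
    unfolding proper_map_prod using q proper_map_id[of K, unfolded id_def] by blast
  ultimately have "compactin (prod_topology K P) {x \<in> topspace (prod_topology K P).
      (\<lambda>(k, p). (k, ?q p)) x \<in> (\<lambda>k. (k, v k)) ` topspace K}"
    by (intro compactin_proper_map_preimage)
  then have "compactin (prod_topology K P) E"
    by (simp add: E_def case_prod_beta)
  then have cE: "compact_space (subtopology (prod_topology K P) E)"
    by (simp add: compact_space_subtopology)
  have sndE: "continuous_map (subtopology (prod_topology K P) E) P snd"
    by (simp add: continuous_map_from_subtopology continuous_map_snd)
  \<comment> \<open>Two points of \<open>E\<close> over the same \<open>k\<close> lie in one class,
    where \<open>s\<close> is injective; so \<open>E\<close> injects continuously into the Hausdorff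
    space \<open>K \<times> Y\<close>.\<close>
  have "continuous_map (subtopology (prod_topology K P) E) (prod_topology K Y) (\<lambda>x. (fst x, (s \<circ> snd) x))"
    by (intro continuous_map_pairedI continuous_map_compose[OF sndE s])
       (simp add: continuous_map_from_subtopology continuous_map_fst)
  moreover have "Hausdorff_space (prod_topology K Y)"
    using K Y by (simp add: test_map_def Hausdorff_space_prod_topology)
  moreover have "inj_on (\<lambda>x. (fst x, (s \<circ> snd) x)) (topspace (subtopology (prod_topology K P) E))"
    using inj by (auto simp: inj_on_def E)
  ultimately have hE: "Hausdorff_space (subtopology (prod_topology K P) E)"
    using Hausdorff_space_injective_preimage by blast
  \<comment> \<open>The projection of \<open>E\<close> to \<open>P\<close> is the full preimage of
    the image of \<open>v\<close>, and a set with closed preimage under a quotient map is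
    closed.\<close>
  have "closedin P (snd ` topspace (subtopology (prod_topology K P) E))"
    using weak_Hausdorff_closedin_image[OF cE hE sndE small P] .
  also have "snd ` topspace (subtopology (prod_topology K P) E) = {p \<in> topspace P. ?q p \<in> v ` topspace K}"
    by (force simp: E)
  finally have "closedin P {p \<in> topspace P. ?q p \<in> v ` topspace K}" .
  moreover have "v ` topspace K \<subseteq> topspace ?Q"
    using K by (auto simp: test_map_def continuous_map_def)
  ultimately show "closedin ?Q (v ` topspace K)"
    using quotient_map_closedin[THEN iffD1, OF quotient_map_qproj[of P R], THEN conjunct2, rule_format, of "v ` topspace K"]
    by blast
qed

section \<open>The induced spectrum\<close>

lemma Hausdorff_space_euclidean_t2: "Hausdorff_space (euclidean :: 'a::t2_space topology)"
  unfolding Hausdorff_space_def disjnt_def using hausdorff by auto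

text \<open>Continuity of inversion is asked of \<open>H\<close> because the identifications will be
  parametrised by the right action sending \<open>(b, y)\<close> to
  \<open>(b \<otimes> \<iota> h, h\<inverse> y)\<close>.\<close>

locale compact_inclusion =
  fixes H :: "('h::t2_space) monoid" and G :: "('g::t2_space) monoid" and \<iota> :: "'h \<Rightarrow> 'g"
  assumes group_H: "group H" and group_G: "group G"
    and compact_H: "compact (carrier H)" and compact_G: "compact (carrier G)"
    and hom_\<iota>: "\<iota> \<in> hom H G" and inj_\<iota>: "inj_on \<iota> (carrier H)" and cont_\<iota>: "continuous_on (carrier H) \<iota>"
    and cont_mult: "continuous_on (carrier G \<times> carrier G) (\<lambda>(a, b). a \<otimes>\<^bsub>G\<^esub> b)"
    and cont_inv: "continuous_on (carrier H) (\<lambda>h. inv\<^bsub>H\<^esub> h)"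

text \<open>Real and complex isometries enter only through compact Hausdorff morphism spaces and
  size bounds, so the adjunction is established once for both indexing categories.\<close>

locale induction_setting = compact_inclusion H G \<iota>
  for H :: "('h::t2_space) monoid" and G :: "('g::t2_space) monoid" and \<iota> :: "'h \<Rightarrow> 'g" +
  fixes J :: "('o, 'm) tcat" and universe :: "'u itself"
  assumes compact_tHom: "\<And>U V. \<lbrakk>U \<in> tObj J; V \<in> tObj J\<rbrakk> \<Longrightarrow> compact_space (tHom J U V)"
    and Hausdorff_tHom: "\<And>U V. \<lbrakk>U \<in> tObj J; V \<in> tObj J\<rbrakk> \<Longrightarrow> Hausdorff_space (tHom J U V)"
    and small_tHom: "(UNIV :: 'm set) \<lesssim> (UNIV :: 'u set set set)"
    and small_G: "(UNIV :: 'g set) \<lesssim> (UNIV :: 'u set)"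
    and infinite_u: "infinite (UNIV :: 'u set)"
begin

sublocale H: group H by (rule group_H)
sublocale G: group G by (rule group_G)

text \<open>In order: pairs can be coded in \<open>'u\<close>; test spaces of
  \<open>G \<times> X(V)\<close> serve as test spaces of \<open>X(V)\<close> and of the quotient;
  products \<open>G \<times> L\<close> are small enough for \<open>kify_prod\<close>; fibre products
  are small enough for \<open>weak_Hausdorff_qtop\<close>; morphism spaces and \<open>G\<close> may
  be parameter spaces of maps into mapping spaces.\<close>

lemma small:
  shows "(UNIV :: ('g \<times> 'u) set) \<lesssim> (UNIV :: 'u set)"
    and "(UNIV :: ('g \<times> 'u) set set set) \<lesssim> (UNIV :: 'u set set set)"
    and "(UNIV :: ('g \<times> 'u set set) set) \<lesssim> (UNIV :: ('g \<times> 'u) set set set)"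
    and "(UNIV :: ('u set set \<times> ('g \<times> 'u)) set) \<lesssim> (UNIV :: ('g \<times> 'u) set set set)"
    and "(UNIV :: 'm set) \<lesssim> (UNIV :: ('u \<Rightarrow> 'u) set set set)"
    and "(UNIV :: 'g set) \<lesssim> (UNIV :: ('u \<Rightarrow> 'u) set set set)"
proof -
  have u: "(UNIV :: 'u set) \<lesssim> (UNIV :: 'u set set set)"
    by (rule lepoll_trans[OF UNIV_lepoll_UNIV_set UNIV_lepoll_UNIV_set])
  show gu: "(UNIV :: ('g \<times> 'u) set) \<lesssim> (UNIV :: 'u set)"
    by (rule Times_UNIV_lepoll_infinite[OF infinite_u small_G lepoll_refl])
  then show "(UNIV :: ('g \<times> 'u) set set set) \<lesssim> (UNIV :: 'u set set set)"
    by (intro UNIV_set_lepoll_mono)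
  have inf: "infinite (UNIV :: 'u set set set)"
    using infinite_u Finite_Set.finite_set by (metis (mono_tags, lifting))
  have "(UNIV :: 'u set) \<lesssim> (UNIV :: ('g \<times> 'u) set)"
    unfolding lepoll_def by (rule exI[of _ "Pair undefined"]) (auto simp: inj_on_def)
  then have ss: "(UNIV :: 'u set set set) \<lesssim> (UNIV :: ('g \<times> 'u) set set set)"
    by (intro UNIV_set_lepoll_mono)
  show "(UNIV :: ('g \<times> 'u set set) set) \<lesssim> (UNIV :: ('g \<times> 'u) set set set)"
    by (rule lepoll_trans[OF Times_UNIV_lepoll_infinite[OF inf lepoll_trans[OF small_G u] lepoll_refl] ss])
  show "(UNIV :: ('u set set \<times> ('g \<times> 'u)) set) \<lesssim> (UNIV :: ('g \<times> 'u) set set set)"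
    by (rule lepoll_trans[OF Times_UNIV_lepoll_infinite[OF inf lepoll_refl lepoll_trans[OF gu u]] ss])
  have uu: "(UNIV :: 'u set set set) \<lesssim> (UNIV :: ('u \<Rightarrow> 'u) set set set)"
    by (intro UNIV_set_lepoll_mono UNIV_lepoll_UNIV_fun)
  show "(UNIV :: 'm set) \<lesssim> (UNIV :: ('u \<Rightarrow> 'u) set set set)"
    by (rule lepoll_trans[OF small_tHom uu])
  show "(UNIV :: 'g set) \<lesssim> (UNIV :: ('u \<Rightarrow> 'u) set set set)"
    by (rule lepoll_trans[OF lepoll_trans[OF small_G u] uu])
qed

lemmas inj_code = inj_code_in[OF small(1)]

lemma \<iota>_carrier: "h \<in> carrier H \<Longrightarrow> \<iota> h \<in> carrier G"
  using hom_\<iota> by (auto simp: hom_def)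

lemma \<iota>_mult: "h \<in> carrier H \<Longrightarrow> h' \<in> carrier H \<Longrightarrow> \<iota> (h \<otimes>\<^bsub>H\<^esub> h') = \<iota> h \<otimes>\<^bsub>G\<^esub> \<iota> h'"
  using hom_\<iota> by (auto simp: hom_def)

lemma \<iota>_one: "\<iota> \<one>\<^bsub>H\<^esub> = \<one>\<^bsub>G\<^esub>"
  using hom_\<iota> group_G group_H by (simp add: hom_one)

lemma top_G: "compact_space (top_of_set (carrier G))" "Hausdorff_space (top_of_set (carrier G))"
  using compact_G by (auto simp: compact_space_subtopology Hausdorff_space_subtopology Hausdorff_space_euclidean_t2)

lemma top_H: "compact_space (top_of_set (carrier H))" "Hausdorff_space (top_of_set (carrier H))"
  using compact_H by (auto simp: compact_space_subtopology Hausdorff_space_subtopology Hausdorff_space_euclidean_t2)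

lemma ind_prod_eq:
  fixes A :: "'u based"
  assumes "kify (fst A) = fst A"
  shows "ind_prod G A = prod_topology (top_of_set (carrier G)) (fst A)"
  unfolding ind_prod_def using kify_prod[OF top_G assms small(3)] .


section \<open>The equivalence relation on \<open>G \<times> X(V)\<close>\<close>

lemma mem_ind_rel:
  assumes X: "is_gspec J H (X :: ('o, 'm, 'h, 'u) gspec)" and V: "V \<in> tObj J"
  shows "((a, x), (b, y)) \<in> ind_rel H G \<iota> X V \<longleftrightarrow>
     a \<in> carrier G \<and> b \<in> carrier G \<and> x \<in> pts (sp (fst X) V) \<and> y \<in> pts (sp (fst X) V) \<and>
     ((\<exists>h \<in> carrier H. a = b \<otimes>\<^bsub>G\<^esub> \<iota> h \<and> y = snd X h V x) \<or>
      x = snd (sp (fst X) V) \<and> y = snd (sp (fst X) V))"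
  using is_specD(4)[OF is_gspecD(1)[OF X] V] is_gspecD(6)[OF X _ V]
  by (auto simp: ind_rel_def \<iota>_carrier)

lemma topspace_ind_prod: 
  assumes X: "is_gspec J H (X :: ('o, 'm, 'h, 'u) gspec)" and V: "V \<in> tObj J"
  shows "topspace (ind_prod G (sp (fst X) V)) = carrier G \<times> pts (sp (fst X) V)"
  unfolding ind_prod_def by simp

lemma gspec_inv:
  assumes X: "is_gspec J H (X :: ('o, 'm, 'h, 'u) gspec)" and V: "V \<in> tObj J" and x: "x \<in> pts (sp (fst X) V)" and h: "h \<in> carrier H"
  shows "snd X (inv\<^bsub>H\<^esub> h) V (snd X h V x) = x" "snd X h V (snd X (inv\<^bsub>H\<^esub> h) V x) = x"
  using is_gspecD(4)[OF X, of "inv\<^bsub>H\<^esub> h" h V x] is_gspecD(4)[OF X, of h "inv\<^bsub>H\<^esub> h" V x]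
    gspec_one[OF X group_H V x] V x h by simp_all

lemma \<iota>_inv: "h \<in> carrier H \<Longrightarrow> \<iota> (inv\<^bsub>H\<^esub> h) = inv\<^bsub>G\<^esub> (\<iota> h)"
  using group_hom.hom_inv[of H G \<iota> h] group_G group_H hom_\<iota>
  by (simp add: group_hom_def group_hom_axioms_def)

text \<open>The union of the two kinds of identification is already transitive because
  \<open>H\<close> fixes the basepoint: a chain that starts at the basepoint stays there, and a
  chain that starts elsewhere never reaches it and consists of orbit relations, which
  compose.\<close>

lemma equiv_ind_rel:
  assumes X: "is_gspec J H (X :: ('o, 'm, 'h, 'u) gspec)" and V: "V \<in> tObj J"
  shows "equiv (topspace (ind_prod G (sp (fst X) V))) (ind_rel H G \<iota> X V)"
proof -
  note mem = mem_ind_rel[OF X V]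
  note act = is_gspecD(6)[OF X _ V] is_gspecD(7)[OF X _ V]
  have r: "((a, x), (a, x)) \<in> ind_rel H G \<iota> X V" if "a \<in> carrier G" "x \<in> pts (sp (fst X) V)" for a x
    unfolding mem using that gspec_one[OF X group_H V] \<iota>_one
    by (auto intro!: bexI[of _ "\<one>\<^bsub>H\<^esub>"])
  have s: "((b, y), (a, x)) \<in> ind_rel H G \<iota> X V" if h: "((a, x), (b, y)) \<in> ind_rel H G \<iota> X V" for a b x y
  proof (cases "x = snd (sp (fst X) V) \<and> y = snd (sp (fst X) V)")
    case False
    then obtain h where h: "h \<in> carrier H" "a = b \<otimes>\<^bsub>G\<^esub> \<iota> h" "y = snd X h V x"
      "a \<in> carrier G" "b \<in> carrier G" "x \<in> pts (sp (fst X) V)" "y \<in> pts (sp (fst X) V)"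
      using h unfolding mem by auto
    then have "b = a \<otimes>\<^bsub>G\<^esub> \<iota> (inv\<^bsub>H\<^esub> h)"
      by (simp add: \<iota>_inv \<iota>_carrier G.m_assoc)
    moreover have "x = snd X (inv\<^bsub>H\<^esub> h) V y" using h gspec_inv[OF X V] by simp
    ultimately show ?thesis unfolding mem using h by auto
  qed (use h in \<open>auto simp: mem\<close>)
  have t: "((a, x), (c, z)) \<in> ind_rel H G \<iota> X V"
    if h: "((a, x), (b, y)) \<in> ind_rel H G \<iota> X V" "((b, y), (c, z)) \<in> ind_rel H G \<iota> X V" for a b c x y z
  proof (cases "x = snd (sp (fst X) V)")
    case True
    then show ?thesis using h act unfolding mem by auto
  next
    case False
    then obtain k where k: "k \<in> carrier H" "a = b \<otimes>\<^bsub>G\<^esub> \<iota> k" "y = snd X k V x"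
      using h unfolding mem by auto
    \<comment> \<open>Otherwise \<open>x\<close>, which is \<open>y\<close> moved by the inverse of
      \<open>k\<close>, would be the basepoint as well. So the second link is an orbit relation
      too.\<close>
    have "y \<noteq> snd (sp (fst X) V)"
      using False k gspec_inv(1)[OF X V, of x k] act(2)[of "inv\<^bsub>H\<^esub> k"] h unfolding mem by auto
    then obtain l where l: "l \<in> carrier H" "b = c \<otimes>\<^bsub>G\<^esub> \<iota> l" "z = snd X l V y"
      using h unfolding mem by auto
    have "a = c \<otimes>\<^bsub>G\<^esub> \<iota> (l \<otimes>\<^bsub>H\<^esub> k)" "z = snd X (l \<otimes>\<^bsub>H\<^esub> k) V x"
      using k l h \<iota>_carrier unfolding mem by (auto simp: \<iota>_mult G.m_assoc is_gspecD(4)[OF X _ _ V])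
    then show ?thesis using k l h unfolding mem by auto
  qed
  show ?thesis
    unfolding topspace_ind_prod[OF X V]
  proof (rule equivI)
    show "ind_rel H G \<iota> X V \<subseteq> (carrier G \<times> pts (sp (fst X) V)) \<times> (carrier G \<times> pts (sp (fst X) V))"
      using mem by auto
    show "refl_on (carrier G \<times> pts (sp (fst X) V)) (ind_rel H G \<iota> X V)"
    proof (rule refl_onI)
      fix p assume "p \<in> carrier G \<times> pts (sp (fst X) V)"
      then show "(p, p) \<in> ind_rel H G \<iota> X V" using r[of "fst p" "snd p"] by auto
    qed
    show "sym (ind_rel H G \<iota> X V)"
    proof (rule symI)
      fix p q assume "(p, q) \<in> ind_rel H G \<iota> X V"
      then show "(q, p) \<in> ind_rel H G \<iota> X V" using s[of "fst p" "snd p" "fst q" "snd q"] by simp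
    qed
    show "trans (ind_rel H G \<iota> X V)"
    proof (rule transI)
      fix p q z assume "(p, q) \<in> ind_rel H G \<iota> X V" "(q, z) \<in> ind_rel H G \<iota> X V"
      then show "(p, z) \<in> ind_rel H G \<iota> X V"
        using t[of "fst p" "snd p" "fst q" "snd q" "fst z" "snd z"] by simp
    qed
  qed
qed

section \<open>The projection to classes is proper\<close>

lemma continuous_action:
  fixes K :: "('k::t2_space) monoid"
  assumes K: "compact (carrier K)" and X: "is_gspec J K X" and V: "V \<in> tObj J"
  shows "continuous_map (prod_topology (top_of_set (carrier K)) (fst (sp (fst X) V))) (fst (sp (fst X) V))
           (\<lambda>(k, x). snd X k V x)"
  using continuous_map_based_maps_eval[OF _ _ is_specD(2)[OF is_gspecD(1)[OF X] V] is_gspecD(5)[OF X V]] K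
  by (simp add: compact_space_subtopology Hausdorff_space_subtopology Hausdorff_space_euclidean_t2)

text \<open>This is the right action of \<open>H\<close> on \<open>G \<times> X(V)\<close> whose
  orbits are the classes away from the basepoint. Its continuity makes saturations and fibres
  computable as images under maps involving the compact group \<open>H\<close>.\<close>

lemma continuous_shift:
  assumes X: "is_gspec J H (X :: ('o, 'm, 'h, 'u) gspec)" and V: "V \<in> tObj J"
  defines "P \<equiv> ind_prod G (sp (fst X) V)"
  shows "continuous_map (prod_topology (top_of_set (carrier H)) P) P
      (\<lambda>(h, b, y). (b \<otimes>\<^bsub>G\<^esub> \<iota> h, snd X (inv\<^bsub>H\<^esub> h) V y))"
proof -
  let ?A = "fst (sp (fst X) V)" and ?H = "top_of_set (carrier H)" and ?G = "top_of_set (carrier G)"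
  have P: "P = prod_topology ?G ?A"
    unfolding P_def by (rule ind_prod_eq[OF is_specD(2)[OF is_gspecD(1)[OF X] V]])
  let ?S = "prod_topology ?H (prod_topology ?G ?A)"
  have p1: "continuous_map ?S ?H fst" by (rule continuous_map_fst)
  have p2: "continuous_map ?S ?G (\<lambda>z. fst (snd z))"
    using continuous_map_compose[OF continuous_map_snd continuous_map_fst] by (auto simp: o_def)
  have p3: "continuous_map ?S ?A (\<lambda>z. snd (snd z))"
    using continuous_map_compose[OF continuous_map_snd continuous_map_snd] by (auto simp: o_def)
  have i: "continuous_map ?H ?G \<iota>" using cont_\<iota> \<iota>_carrier by auto
  have v: "continuous_map ?H ?H (\<lambda>h. inv\<^bsub>H\<^esub> h)" using cont_inv by auto
  have m: "continuous_map (prod_topology ?G ?G) ?G (\<lambda>(a, b). a \<otimes>\<^bsub>G\<^esub> b)"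
    using cont_mult by (auto simp: subtopology_Times[symmetric])
  have 1: "continuous_map ?S ?G (\<lambda>z. fst (snd z) \<otimes>\<^bsub>G\<^esub> \<iota> (fst z))"
    using continuous_map_compose[OF continuous_map_pairedI[OF p2 continuous_map_compose[OF p1 i]] m]
    by (simp add: o_def)
  have 2: "continuous_map ?S ?A (\<lambda>z. snd X (inv\<^bsub>H\<^esub> (fst z)) V (snd (snd z)))"
    using continuous_map_compose[OF continuous_map_pairedI[OF continuous_map_compose[OF p1 v] p3] continuous_action[OF compact_H X V]]
    by (simp add: o_def)
  show ?thesis
    unfolding P using continuous_map_pairedI[OF 1 2] by (simp add: case_prod_beta')
qed

lemma ind_rel_iff_shift:
  assumes X: "is_gspec J H (X :: ('o, 'm, 'h, 'u) gspec)" and V: "V \<in> tObj J"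
    and p: "p \<in> topspace (ind_prod G (sp (fst X) V))" and c: "c \<in> topspace (ind_prod G (sp (fst X) V))"
  shows "(c, p) \<in> ind_rel H G \<iota> X V \<longleftrightarrow>
    (\<exists>h \<in> carrier H. c = (fst p \<otimes>\<^bsub>G\<^esub> \<iota> h, snd X (inv\<^bsub>H\<^esub> h) V (snd p))) \<or>
    (snd c = snd (sp (fst X) V) \<and> snd p = snd (sp (fst X) V))"
proof -
  have *: "(y = snd X h V x) \<longleftrightarrow> (x = snd X (inv\<^bsub>H\<^esub> h) V y)"
    if "h \<in> carrier H" "x \<in> pts (sp (fst X) V)" "y \<in> pts (sp (fst X) V)" for h x y
    using gspec_inv[OF X V] that by auto
  obtain a x b y where [simp]: "c = (a, x)" "p = (b, y)" by (metis surj_pair)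
  have m: "a \<in> carrier G" "b \<in> carrier G" "x \<in> pts (sp (fst X) V)" "y \<in> pts (sp (fst X) V)"
    using p c unfolding topspace_ind_prod[OF X V] by auto
  have "(\<exists>h \<in> carrier H. a = b \<otimes>\<^bsub>G\<^esub> \<iota> h \<and> y = snd X h V x) \<longleftrightarrow>
      (\<exists>h \<in> carrier H. a = b \<otimes>\<^bsub>G\<^esub> \<iota> h \<and> x = snd X (inv\<^bsub>H\<^esub> h) V y)"
    by (rule bex_cong[OF refl], rule conj_cong[OF refl], rule *) (use m in auto)
  then show ?thesis
    using m unfolding mem_ind_rel[OF X V] \<open>c = (a, x)\<close> \<open>p = (b, y)\<close> fst_conv snd_conv prod.inject by blast
qed

text \<open>The saturation of a closed \<open>C\<close> consists of the points moved into
  \<open>C\<close> by some \<open>h\<close>, a projection along compact \<open>H\<close>, together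
  with all of \<open>G \<times> {?b}\<close> if \<open>C\<close> meets it. A fibre is an orbit of
  \<open>H\<close>, possibly together with \<open>G \<times> {?b}\<close>, and both are
  compact.\<close>

lemma proper_map_ind:
  assumes X: "is_gspec J H (X :: ('o, 'm, 'h, 'u) gspec)" and V: "V \<in> tObj J"
  defines "P \<equiv> ind_prod G (sp (fst X) V)" and "R \<equiv> ind_rel H G \<iota> X V"
  shows "proper_map P (qtop P R :: 'u topology) (qproj R)"
proof -
  let ?A = "fst (sp (fst X) V)" and ?H = "top_of_set (carrier H)" and ?G = "top_of_set (carrier G)"
  let ?b = "snd (sp (fst X) V)"
  let ?\<sigma> = "\<lambda>(h, b, y). (b \<otimes>\<^bsub>G\<^esub> \<iota> h, snd X (inv\<^bsub>H\<^esub> h) V y)"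
  have P: "P = prod_topology ?G ?A"
    unfolding P_def by (rule ind_prod_eq[OF is_specD(2)[OF is_gspecD(1)[OF X] V]])
  have R: "equiv (topspace P) R" unfolding P_def R_def by (rule equiv_ind_rel[OF X V])
  have b: "?b \<in> topspace ?A" by (rule is_specD(4)[OF is_gspecD(1)[OF X] V])
  have qR: "(qproj R c :: 'u) = qproj R p \<longleftrightarrow> (c, p) \<in> R" if "c \<in> topspace P" "p \<in> topspace P" for c p
    by (rule qproj_eq_iff[OF inj_code R that])
  have Rs: "(c, p) \<in> R \<longleftrightarrow> (\<exists>h \<in> carrier H. c = ?\<sigma> (h, p)) \<or> (snd c = ?b \<and> snd p = ?b)" if "c \<in> topspace P" "p \<in> topspace P" for c p
    using ind_rel_iff_shift[OF X V that(2,1)[unfolded P_def]] by (simp add: R_def case_prod_beta)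
  have \<sigma>: "continuous_map (prod_topology ?H P) P ?\<sigma>"
    unfolding P_def by (rule continuous_shift[OF X V])
  have closed: "closed_map P (qtop P R) (qproj R :: _ \<Rightarrow> 'u)"
    unfolding closed_map_def
  proof (intro allI impI)
    fix C assume C: "closedin P C"
    have CP: "C \<subseteq> topspace P" by (rule closedin_subset[OF C])
    have "closedin (prod_topology ?H P) {z \<in> topspace (prod_topology ?H P). ?\<sigma> z \<in> C}"
      by (rule closedin_continuous_map_preimage[OF \<sigma> C])
    \<comment> \<open>Projection along a compact factor is a closed map.\<close>
    then have 1: "closedin P (snd ` {z \<in> topspace (prod_topology ?H P). ?\<sigma> z \<in> C})"
      using Abstract_Topological_Spaces.closed_map_snd[OF top_H(1)] unfolding closed_map_def by blast
    let ?B = "if \<exists>c\<in>C. snd c = ?b then carrier G \<times> {?b} else {}"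
    \<comment> \<open>Closedness of the collapsed part rests on points being closed, which already
      follows from weak Hausdorffness.\<close>
    have "closedin ?A {?b}"
      by (rule weak_Hausdorff_imp_t1[OF is_specD(3)[OF is_gspecD(1)[OF X] V] b])
    then have 2: "closedin P ?B"
      unfolding P by (auto simp: closedin_prod_Times_iff)
    have "{p \<in> topspace P. qproj R p \<in> (qproj R ` C :: 'u set)} = {p \<in> topspace P. \<exists>c \<in> C. (c, p) \<in> R}"
    proof (intro Collect_cong conj_cong refl)
      fix p assume p: "p \<in> topspace P"
      have "qproj R p = (qproj R c :: 'u) \<longleftrightarrow> (c, p) \<in> R" if "c \<in> C" for c
        unfolding qR[OF subsetD[OF CP that] p, symmetric] by (rule eq_commute)
      then show "qproj R p \<in> (qproj R ` C :: 'u set) \<longleftrightarrow> (\<exists>c \<in> C. (c, p) \<in> R)"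
        by (simp add: image_iff cong: bex_cong)
    qed
    also have "\<dots> = snd ` {z \<in> topspace (prod_topology ?H P). ?\<sigma> z \<in> C} \<union> ?B"
    proof (intro equalityI subsetI)
      fix p assume "p \<in> {p \<in> topspace P. \<exists>c \<in> C. (c, p) \<in> R}"
      then obtain c where p: "p \<in> topspace P" and c: "c \<in> C" "(c, p) \<in> R" by blast
      then consider h where "h \<in> carrier H" "c = ?\<sigma> (h, p)" | "snd c = ?b" "snd p = ?b"
        using iffD1[OF Rs[OF subsetD[OF CP c(1)] p] c(2)] by auto
      then show "p \<in> snd ` {z \<in> topspace (prod_topology ?H P). ?\<sigma> z \<in> C} \<union> ?B"
      proof cases
        case 1
        then have "(h, p) \<in> {z \<in> topspace (prod_topology ?H P). ?\<sigma> z \<in> C}" using p c by simp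
        then show ?thesis by force
      next
        case 2
        then show ?thesis using p c unfolding P by (cases p) auto
      qed
    next
      fix p assume "p \<in> snd ` {z \<in> topspace (prod_topology ?H P). ?\<sigma> z \<in> C} \<union> ?B"
      then show "p \<in> {p \<in> topspace P. \<exists>c \<in> C. (c, p) \<in> R}"
      proof
        assume "p \<in> snd ` {z \<in> topspace (prod_topology ?H P). ?\<sigma> z \<in> C}"
        then obtain h where h: "h \<in> carrier H" "p \<in> topspace P" "?\<sigma> (h, p) \<in> C" by auto
        then have "(?\<sigma> (h, p), p) \<in> R"
          by (intro iffD2[OF Rs[OF subsetD[OF CP h(3)] h(2)]] disjI1 bexI[of _ h] refl)
        then show ?thesis using h by blast
      next
        assume B: "p \<in> ?B"
        then obtain c where c: "c \<in> C" "snd c = ?b" by (auto split: if_splits)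
        have p: "p \<in> topspace P" "snd p = ?b" using B b unfolding P by (auto split: if_splits)
        then have "(c, p) \<in> R"
          using c by (intro iffD2[OF Rs[OF subsetD[OF CP c(1)] p(1)]] disjI2) simp
        then show ?thesis using p c by blast
      qed
    qed
    finally have "closedin P {p \<in> topspace P. qproj R p \<in> (qproj R ` C :: 'u set)}"
      using closedin_Un[OF 1 2] by simp
    then show "closedin (qtop P R) (qproj R ` C :: 'u set)"
      using quotient_map_closedin[THEN iffD1, OF quotient_map_qproj[of P R], THEN conjunct2, rule_format, of "qproj R ` C"] image_mono[OF CP, of "qproj R :: _ \<Rightarrow> 'u"]
      unfolding topspace_qtop by blast
  qed
  have "compactin P {c \<in> topspace P. qproj R c = z}" if z: "z \<in> topspace (qtop P R :: 'u topology)" for z :: 'u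
  proof -
    obtain p where p: "p \<in> topspace P" "z = qproj R p" using z unfolding topspace_qtop by blast
    have "continuous_map ?H (prod_topology ?H P) (\<lambda>h. (h, p))"
      using p by (simp add: continuous_map_paired)
    from continuous_map_compose[OF this \<sigma>]
    have c: "continuous_map ?H P (\<lambda>h. ?\<sigma> (h, p))" by (simp add: o_def)
    have 1: "compactin P ((\<lambda>h. ?\<sigma> (h, p)) ` carrier H)"
      by (rule image_compactin[OF _ c]) (use top_H in \<open>simp add: compact_space_def\<close>)
    have 2: "compactin P (if snd p = ?b then carrier G \<times> {?b} else {})"
      unfolding P using top_G b by (auto simp: compactin_Times compact_space_def)
    have "{c \<in> topspace P. qproj R c = z} = {c \<in> topspace P. (c, p) \<in> R}"
      unfolding p(2) by (intro Collect_cong conj_cong refl qR p(1))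
    also have "\<dots> = (\<lambda>h. ?\<sigma> (h, p)) ` carrier H \<union> (if snd p = ?b then carrier G \<times> {?b} else {})"
    proof (intro equalityI subsetI)
      fix c assume "c \<in> {c \<in> topspace P. (c, p) \<in> R}"
      then have c: "c \<in> topspace P" "(c, p) \<in> R" by auto
      then consider h where "h \<in> carrier H" "c = ?\<sigma> (h, p)" | "snd c = ?b" "snd p = ?b"
        using iffD1[OF Rs[OF c(1) p(1)] c(2)] by auto
      then show "c \<in> (\<lambda>h. ?\<sigma> (h, p)) ` carrier H \<union> (if snd p = ?b then carrier G \<times> {?b} else {})"
        by cases (use c in \<open>auto simp: P\<close>)
    next
      fix c assume "c \<in> (\<lambda>h. ?\<sigma> (h, p)) ` carrier H \<union> (if snd p = ?b then carrier G \<times> {?b} else {})"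
      then show "c \<in> {c \<in> topspace P. (c, p) \<in> R}"
      proof
        assume "c \<in> (\<lambda>h. ?\<sigma> (h, p)) ` carrier H"
        then obtain h where h: "h \<in> carrier H" "c = ?\<sigma> (h, p)" by blast
        moreover have "c \<in> topspace P" using c h by (auto simp: continuous_map_def)
        moreover from this have "(c, p) \<in> R"
          using h by (intro iffD2[OF Rs[OF _ p(1)]] disjI1 bexI[of _ h])
        ultimately show ?thesis by simp
      next
        assume c: "c \<in> (if snd p = ?b then carrier G \<times> {?b} else {})"
        have "c \<in> topspace P" "snd c = ?b" "snd p = ?b" using b c by (auto simp: P split: if_splits)
        moreover from this have "(c, p) \<in> R"
          by (intro iffD2[OF Rs[OF _ p(1)]] disjI2 conjI)
        ultimately show ?thesis by simp
      qed
    qed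
    finally show ?thesis using compactin_Un[OF 1 2] by simp
  qed
  then show ?thesis using closed by (simp add: proper_map_def)
qed

text \<open>
  As \<open>H\<close> acts freely on \<open>G\<close>, a class contains at most one pair with a given first entry.
\<close>

lemma CGWH_ind:
  assumes X: "is_gspec J H (X :: ('o, 'm, 'h, 'u) gspec)" and V: "V \<in> tObj J"
  defines "P \<equiv> ind_prod G (sp (fst X) V)" and "R \<equiv> ind_rel H G \<iota> X V"
  shows "CGWH (qtop P R :: 'u topology)"
proof -
  let ?A = "fst (sp (fst X) V)" and ?G = "top_of_set (carrier G)"
  note A = is_specD(2,3)[OF is_gspecD(1)[OF X] V]
  have P: "P = prod_topology ?G ?A" unfolding P_def by (rule ind_prod_eq[OF A(1)])
  have R: "equiv (topspace P) R" unfolding P_def R_def by (rule equiv_ind_rel[OF X V])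
  have kP: "kify P = P" unfolding P by (rule kify_prod[OF top_G A(1) small(3)])
  have "p = p'" if p: "p \<in> topspace P" "p' \<in> topspace P" "(qproj R p :: 'u) = qproj R p'" "fst p = fst p'" for p p'
  proof -
    obtain a x y where [simp]: "p = (a, x)" "p' = (a, y)" using p(4) by (metis prod.collapse)
    have "((a, x), (a, y)) \<in> R" using qproj_eq_iff[OF inj_code R p(1,2)] p(3) by simp
    then have m: "a \<in> carrier G" "x \<in> topspace ?A"
       "(\<exists>h \<in> carrier H. a = a \<otimes>\<^bsub>G\<^esub> \<iota> h \<and> y = snd X h V x) \<or> x = y"
      unfolding R_def mem_ind_rel[OF X V] by auto
    have "x = y" if h: "h \<in> carrier H" "a = a \<otimes>\<^bsub>G\<^esub> \<iota> h" "y = snd X h V x" for h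
    proof -
      have "\<iota> h = \<iota> \<one>\<^bsub>H\<^esub>" using h m(1) \<iota>_carrier \<iota>_one by (metis G.l_cancel_one' G.r_cancel_one')
      then have "h = \<one>\<^bsub>H\<^esub>" using inj_\<iota> h by (auto dest: inj_onD)
      then show ?thesis using h gspec_one[OF X group_H V m(2)] by simp
    qed
    with m(3) have "x = y" by (elim disjE bexE conjE)
    then show ?thesis by simp
  qed
  then have "weak_Hausdorff (qtop P R :: 'u topology)"
    by (intro weak_Hausdorff_qtop[where Y = ?G and s = fst])
       (auto simp: P top_G A small continuous_map_fst intro: weak_Hausdorff_prod proper_map_ind[OF X V, folded P_def R_def, unfolded P])
  moreover have "kify (qtop P R :: 'u topology) = qtop P R"
    by (rule kify_qtop[OF kP small(2)])
  ultimately show ?thesis by (simp add: CGWH_def)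
qed


section \<open>Classes \<open>[g, x]\<close> and continuous maps between spaces of classes\<close>

abbreviation qp :: "('o, 'm, 'h, 'u) gspec \<Rightarrow> 'o \<Rightarrow> 'g \<Rightarrow> 'u \<Rightarrow> 'u" where
  "qp X V g x \<equiv> qproj (ind_rel H G \<iota> X V) (g, x)"

abbreviation iX :: "('o, 'm, 'h, 'u) gspec \<Rightarrow> ('o, 'm, 'u) spec" where
  "iX \<equiv> ind_spec H G \<iota>"

lemma pts_ind_spec:
  assumes X: "is_gspec J H (X :: ('o, 'm, 'h, 'u) gspec)" and V: "V \<in> tObj J"
  shows "pts (sp (iX X) V) = {qp X V g x | g x. g \<in> carrier G \<and> x \<in> pts (sp (fst X) V)}"
  by (auto simp: ind_spec_def topspace_qtop topspace_ind_prod[OF X V] image_iff)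

lemma ind_specE:
  assumes X: "is_gspec J H (X :: ('o, 'm, 'h, 'u) gspec)" and V: "V \<in> tObj J"
    and z: "z \<in> pts (sp (iX X) V)"
  obtains g x where "g \<in> carrier G" "x \<in> pts (sp (fst X) V)" "z = qp X V g x"
  using z unfolding pts_ind_spec[OF X V] by blast

lemma qp_in_pts:
  assumes X: "is_gspec J H (X :: ('o, 'm, 'h, 'u) gspec)" and V: "V \<in> tObj J"
    and "g \<in> carrier G" "x \<in> pts (sp (fst X) V)"
  shows "qp X V g x \<in> pts (sp (iX X) V)"
  unfolding pts_ind_spec[OF X V] using assms by blast

lemma snd_ind_spec: "snd (sp (iX X) V) = qp X V \<one>\<^bsub>G\<^esub> (snd (sp (fst X) V))"
  by (simp add: ind_spec_def)

lemma qp_eq_iff: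
  assumes X: "is_gspec J H (X :: ('o, 'm, 'h, 'u) gspec)" and V: "V \<in> tObj J"
    and a: "a \<in> carrier G" "x \<in> pts (sp (fst X) V)" "b \<in> carrier G" "y \<in> pts (sp (fst X) V)"
  shows "qp X V a x = qp X V b y \<longleftrightarrow> ((a, x), (b, y)) \<in> ind_rel H G \<iota> X V"
  by (rule qproj_eq_iff[OF inj_code equiv_ind_rel[OF X V]])
     (use a in \<open>auto simp: topspace_ind_prod[OF X V]\<close>)

lemma qp_base:
  assumes X: "is_gspec J H (X :: ('o, 'm, 'h, 'u) gspec)" and V: "V \<in> tObj J" and "g \<in> carrier G"
  shows "qp X V g (snd (sp (fst X) V)) = snd (sp (iX X) V)"
  unfolding snd_ind_spec using assms is_specD(4)[OF is_gspecD(1)[OF X] V]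
  by (auto simp: qp_eq_iff[OF X V] mem_ind_rel[OF X V])

lemma qp_mult:
  assumes X: "is_gspec J H (X :: ('o, 'm, 'h, 'u) gspec)" and V: "V \<in> tObj J" and "g \<in> carrier G"
    "h \<in> carrier H" "x \<in> pts (sp (fst X) V)"
  shows "qp X V (g \<otimes>\<^bsub>G\<^esub> \<iota> h) x = qp X V g (snd X h V x)"
  using assms is_gspecD(6)[OF X _ V] \<iota>_carrier
  by (auto simp: qp_eq_iff[OF X V] mem_ind_rel[OF X V])

lemma qmap_ind:
  assumes X: "is_gspec J H (X :: ('o, 'm, 'h, 'u) gspec)" and V: "V \<in> tObj J"
    and g: "g \<in> carrier G" "x \<in> pts (sp (fst X) V)"
    and f: "\<And>b y. b \<in> carrier G \<Longrightarrow> y \<in> pts (sp (fst X) V) \<Longrightarrow> ((g, x), (b, y)) \<in> ind_rel H G \<iota> X V \<Longrightarrow>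
         (qproj R' (f (g, x)) :: 'u) = qproj R' (f (b, y))"
  shows "(qmap (ind_prod G (sp (fst X) V)) (ind_rel H G \<iota> X V) R' f (qp X V g x) :: 'u) = qproj R' (f (g, x))"
proof (rule qmap_qproj[OF inj_code equiv_ind_rel[OF X V]])
  show "(g, x) \<in> topspace (ind_prod G (sp (fst X) V))"
    using g by (simp add: topspace_ind_prod[OF X V])
  fix p' assume p': "((g, x), p') \<in> ind_rel H G \<iota> X V"
  obtain b y where "p' = (b, y)" by (cases p')
  then show "(qproj R' (f (g, x)) :: 'u) = qproj R' (f p')"
    using f[of b y] p' by (auto simp: mem_ind_rel[OF X V])
qed

text \<open>All the induced maps are of the form \<open>[g, x] \<mapsto> [m g, f x]\<close> with \<open>f\<close> equivariant.\<close>

lemma qmap_ind_mult: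
  assumes X: "is_gspec J H (X :: ('o, 'm, 'h, 'u) gspec)" and V: "V \<in> tObj J"
    and Y: "is_gspec J H (Y :: ('o, 'm, 'h, 'u) gspec)" and W: "W \<in> tObj J"
    and m: "m \<in> carrier G"
    and f: "\<And>x. x \<in> pts (sp (fst X) V) \<Longrightarrow> f x \<in> pts (sp (fst Y) W)"
    and base: "f (snd (sp (fst X) V)) = snd (sp (fst Y) W)"
    and equi: "\<And>h x. h \<in> carrier H \<Longrightarrow> x \<in> pts (sp (fst X) V) \<Longrightarrow> f (snd X h V x) = snd Y h W (f x)"
    and g: "g \<in> carrier G" "x \<in> pts (sp (fst X) V)"
    and F: "\<And>g x. g \<in> carrier G \<Longrightarrow> F (g, x) = (m \<otimes>\<^bsub>G\<^esub> g, f x)"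
  shows "(qmap (ind_prod G (sp (fst X) V)) (ind_rel H G \<iota> X V) (ind_rel H G \<iota> Y W) F (qp X V g x) :: 'u) =
     qp Y W (m \<otimes>\<^bsub>G\<^esub> g) (f x)"
proof -
  have "(qproj (ind_rel H G \<iota> Y W) (F (g, x)) :: 'u) = qproj (ind_rel H G \<iota> Y W) (F (b, y))"
    if b: "b \<in> carrier G" "y \<in> pts (sp (fst X) V)" "((g, x), (b, y)) \<in> ind_rel H G \<iota> X V" for b y
  proof -
    consider h where "h \<in> carrier H" "g = b \<otimes>\<^bsub>G\<^esub> \<iota> h" "y = snd X h V x"
      | "x = snd (sp (fst X) V)" "y = snd (sp (fst X) V)"
      using b(3) unfolding mem_ind_rel[OF X V] by blast
    then show ?thesis
    proof cases
      case 1
      then have "m \<otimes>\<^bsub>G\<^esub> g = (m \<otimes>\<^bsub>G\<^esub> b) \<otimes>\<^bsub>G\<^esub> \<iota> h" using m b \<iota>_carrier by (simp add: G.m_assoc)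
      then show ?thesis
        using 1 m b g f by (simp add: F qp_mult[OF Y W] equi)
    next
      case 2
      then show ?thesis using m b g by (simp add: F base qp_base[OF Y W])
    qed
  qed
  then show ?thesis using qmap_ind[OF X V g] g by (simp add: F)
qed

text \<open>Continuity jointly with a compact parameter is tested on representatives. Every
  continuity claim about the induced spectrum passes through this criterion.\<close>

lemma continuous_map_ind:
  assumes X: "is_gspec J H (X :: ('o, 'm, 'h, 'u) gspec)" and V: "V \<in> tObj J"
    and T: "compact_space T" "Hausdorff_space T"
    and f: "continuous_map (prod_topology T (prod_topology (top_of_set (carrier G)) (fst (sp (fst X) V)))) B
       (\<lambda>(t, g, x). f t (qp X V g x))"
  shows "continuous_map (prod_topology T (fst (sp (iX X) V))) B (\<lambda>(t, z). f t z)"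
proof -
  have P: "ind_prod G (sp (fst X) V) = prod_topology (top_of_set (carrier G)) (fst (sp (fst X) V))"
    by (rule ind_prod_eq[OF is_specD(2)[OF is_gspecD(1)[OF X] V]])
  have "continuous_map (prod_topology T (qtop (ind_prod G (sp (fst X) V)) (ind_rel H G \<iota> X V))) B (\<lambda>(t, z). f t z)"
    by (rule continuous_map_prod_qtop[OF T]) (use f in \<open>simp add: P case_prod_beta'\<close>)
  then show ?thesis by (simp add: ind_spec_def)
qed

lemma continuous_map_qp:
  assumes X: "is_gspec J H (X :: ('o, 'm, 'h, 'u) gspec)" and V: "V \<in> tObj J"
    and a: "continuous_map S (top_of_set (carrier G)) a" and b: "continuous_map S (fst (sp (fst X) V)) b"
  shows "continuous_map S (fst (sp (iX X) V)) (\<lambda>s. qp X V (a s) (b s))"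
proof -
  have P: "ind_prod G (sp (fst X) V) = prod_topology (top_of_set (carrier G)) (fst (sp (fst X) V))"
    by (rule ind_prod_eq[OF is_specD(2)[OF is_gspecD(1)[OF X] V]])
  have "continuous_map (ind_prod G (sp (fst X) V)) (fst (sp (iX X) V)) (qproj (ind_rel H G \<iota> X V))"
    using quotient_imp_continuous_map[OF quotient_map_qproj] by (simp add: ind_spec_def)
  from continuous_map_compose[OF continuous_map_pairedI[OF a b, folded P] this]
  show ?thesis by (simp add: o_def)
qed

text \<open>A one-point parameter space makes the parametrised criterion available for a single
  map.\<close>

lemma continuous_map_single:
  assumes "continuous_map (prod_topology (discrete_topology {()}) A) B (\<lambda>(t, z). f z)"
  shows "continuous_map A B f"
proof -
  have "continuous_map A (prod_topology (discrete_topology {()}) A) (\<lambda>z. ((), z))"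
    by (simp add: continuous_map_paired)
  from continuous_map_compose[OF this assms] show ?thesis by (simp add: o_def)
qed

lemma continuous_map_ind_single:
  assumes X: "is_gspec J H (X :: ('o, 'm, 'h, 'u) gspec)" and V: "V \<in> tObj J"
    and f: "continuous_map (prod_topology (top_of_set (carrier G)) (fst (sp (fst X) V))) B
       (\<lambda>(g, x). f (qp X V g x))"
  shows "continuous_map (fst (sp (iX X) V)) B f"
proof (rule continuous_map_single, rule continuous_map_ind[OF X V])
  show "continuous_map (prod_topology (discrete_topology {()}) (prod_topology (top_of_set (carrier G)) (fst (sp (fst X) V)))) B
       (\<lambda>(t, g, x). f (qp X V g x))"
    using continuous_map_compose[OF continuous_map_snd f] by (simp add: o_def case_prod_beta')
qed (auto simp: compact_space_discrete_topology Hausdorff_space_discrete_topology)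

lemma str_equivariant:
  assumes X: "is_gspec J H (X :: ('o, 'm, 'h, 'u) gspec)"
    and U: "U \<in> tObj J" "V \<in> tObj J" "j \<in> topspace (tHom J U V)" and h: "h \<in> carrier H" "x \<in> pts (sp (fst X) U)"
  shows "str (fst X) U V j (snd X h U x) = snd X h V (str (fst X) U V j x)"
  using spec_mapsD(6)[OF is_gspecD(3)[OF X h(1)] U h(2)] by simp


text \<open>The structure map is described by its values \<open>f\<close>, with no membership of
  \<open>j\<close> in the morphism space. The record \<open>tcat\<close> does not guarantee that
  identities, basepoints and composites lie there, and the functor laws concern exactly
  these.\<close>

lemma str_ind_spec':
  assumes X: "is_gspec J H (X :: ('o, 'm, 'h, 'u) gspec)"
    and U: "U \<in> tObj J" "V \<in> tObj J" and g: "g \<in> carrier G" "x \<in> pts (sp (fst X) U)"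
    and f: "\<And>x. x \<in> pts (sp (fst X) U) \<Longrightarrow> str (fst X) U V j x = f x"
    and pts: "\<And>x. x \<in> pts (sp (fst X) U) \<Longrightarrow> f x \<in> pts (sp (fst X) V)"
    and base: "f (snd (sp (fst X) U)) = snd (sp (fst X) V)"
    and equi: "\<And>h x. h \<in> carrier H \<Longrightarrow> x \<in> pts (sp (fst X) U) \<Longrightarrow> f (snd X h U x) = snd X h V (f x)"
  shows "str (iX X) U V j (qp X U g x) = qp X V g (f x)"
proof -
  have "(qmap (ind_prod G (sp (fst X) U)) (ind_rel H G \<iota> X U) (ind_rel H G \<iota> X V)
     (\<lambda>(g, x). (g, str (fst X) U V j x)) (qp X U g x) :: 'u) = qp X V (\<one>\<^bsub>G\<^esub> \<otimes>\<^bsub>G\<^esub> g) (str (fst X) U V j x)"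
    by (rule qmap_ind_mult[OF X U(1) X U(2)])
       (use g f pts base equi is_gspecD(6)[OF X _ U(1)] is_specD(4)[OF is_gspecD(1)[OF X] U(1)] in auto)
  then show ?thesis using g f by (simp add: ind_spec_def)
qed

lemma str_ind_spec:
  assumes X: "is_gspec J H (X :: ('o, 'm, 'h, 'u) gspec)"
    and U: "U \<in> tObj J" "V \<in> tObj J" "j \<in> topspace (tHom J U V)" and g: "g \<in> carrier G" "x \<in> pts (sp (fst X) U)"
  shows "str (iX X) U V j (qp X U g x) = qp X V g (str (fst X) U V j x)"
  using is_specD(7,8)[OF is_gspecD(1)[OF X] U] str_equivariant[OF X U]
  by (intro str_ind_spec'[OF X U(1,2) g]) auto

lemma str_ind_spec_extensional: "str (iX X) U V j \<in> extensional (pts (sp (iX X) U))"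
  by (simp add: ind_spec_def qmap_extensional)

lemma ind_spec_extensionalityI:
  assumes X: "is_gspec J H (X :: ('o, 'm, 'h, 'u) gspec)" and V: "V \<in> tObj J"
    and "f \<in> extensional (pts (sp (iX X) V))" "f' \<in> extensional (pts (sp (iX X) V))"
    and "\<And>g x. g \<in> carrier G \<Longrightarrow> x \<in> pts (sp (fst X) V) \<Longrightarrow> f (qp X V g x) = f' (qp X V g x)"
  shows "f = f'"
  using assms by (intro extensionalityI[of f "pts (sp (iX X) V)" f']) (auto elim!: ind_specE[OF X V])

text \<open>A morphism acts on a class by \<open>[g, x] \<mapsto> [g, j x]\<close>, which is well
  defined since structure maps commute with \<open>H\<close> and preserve basepoints. The functor
  laws are thus those of \<open>X\<close>, read on representatives.\<close>

lemma is_spec_ind_spec: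
  assumes X: "is_gspec J H (X :: ('o, 'm, 'h, 'u) gspec)"
  shows "is_spec J (iX X)"
  unfolding is_spec_def
proof (intro conjI ballI)
  note Xs = is_gspecD(1)[OF X]
  {
    fix V assume V: "V \<in> tObj J"
    have "snd (sp (iX X) V) \<in> pts (sp (iX X) V)"
      unfolding snd_ind_spec by (rule qp_in_pts[OF X V]) (use is_specD(4)[OF Xs V] in auto)
    then show "based_CGWH (sp (iX X) V)"
      using CGWH_ind[OF X V] by (simp add: based_CGWH_def ind_spec_def)
    show "str (iX X) V V (tId J V) = (\<lambda>x\<in>pts (sp (iX X) V). x)"
    proof (rule ind_spec_extensionalityI[OF X V str_ind_spec_extensional])
      fix g x assume g: "g \<in> carrier G" "x \<in> pts (sp (fst X) V)"
      have "str (iX X) V V (tId J V) (qp X V g x) = qp X V g x"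
        by (rule str_ind_spec'[OF X V V g]) (auto simp: is_specD(5)[OF Xs V])
      then show "str (iX X) V V (tId J V) (qp X V g x) = (\<lambda>x\<in>pts (sp (iX X) V). x) (qp X V g x)"
        using qp_in_pts[OF X V g] by simp
    qed simp
  }
  {
    fix U V assume U: "U \<in> tObj J" "V \<in> tObj J"
    let ?T = "tHom J U V" and ?GA = "prod_topology (top_of_set (carrier G)) (fst (sp (fst X) U))"
    note T = compact_tHom[OF U] Hausdorff_tHom[OF U]
    show "continuous_map ?T (based_maps (sp (iX X) U) (sp (iX X) V)) (str (iX X) U V)"
    proof (rule continuous_map_into_based_maps[OF T small(5)])
      \<comment> \<open>The structure map of \<open>X\<close> is uncurried, followed by the
        projection to classes, and the result is curried again after descending to the
        quotient.\<close>
      have e: "continuous_map (prod_topology ?T (fst (sp (fst X) U))) (fst (sp (fst X) V)) (\<lambda>(t, x). str (fst X) U V t x)"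
        by (rule continuous_map_based_maps_eval[OF T is_specD(2)[OF Xs U(1)] is_specD(6)[OF Xs U]])
      have a: "continuous_map (prod_topology ?T ?GA) (top_of_set (carrier G)) (\<lambda>s. fst (snd s))"
        using continuous_map_compose[OF continuous_map_snd continuous_map_fst] by (simp add: o_def)
      have b: "continuous_map (prod_topology ?T ?GA) (fst (sp (fst X) U)) (\<lambda>s. snd (snd s))"
        using continuous_map_compose[OF continuous_map_snd continuous_map_snd] by (simp add: o_def)
      have c: "continuous_map (prod_topology ?T ?GA) (fst (sp (fst X) V)) (\<lambda>s. str (fst X) U V (fst s) (snd (snd s)))"
        using continuous_map_compose[OF continuous_map_pairedI[OF continuous_map_fst b] e] by (simp add: o_def)
      show "continuous_map (prod_topology ?T (fst (sp (iX X) U))) (fst (sp (iX X) V)) (\<lambda>(t, z). str (iX X) U V t z)"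
        by (rule continuous_map_ind[OF X U(1) T], rule continuous_map_eq[OF continuous_map_qp[OF X U(2) a c]])
           (auto simp: str_ind_spec[OF X U])
      show "str (iX X) U V t (snd (sp (iX X) U)) = snd (sp (iX X) V)" if "t \<in> topspace ?T" for t
        unfolding snd_ind_spec
        using that is_specD(4)[OF Xs U(1)] is_specD(7)[OF Xs U that] by (simp add: str_ind_spec[OF X U])
    qed (rule str_ind_spec_extensional)
    show "str (iX X) U V (tBase J U V) = (\<lambda>x\<in>pts (sp (iX X) U). snd (sp (iX X) V))"
    proof (rule ind_spec_extensionalityI[OF X U(1) str_ind_spec_extensional])
      fix g x assume g: "g \<in> carrier G" "x \<in> pts (sp (fst X) U)"
      have "str (iX X) U V (tBase J U V) (qp X U g x) = qp X V g (snd (sp (fst X) V))"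
        by (rule str_ind_spec'[OF X U g])
           (auto simp: is_specD(9)[OF Xs U] is_specD(4)[OF Xs] U is_gspecD(7)[OF X])
      then show "str (iX X) U V (tBase J U V) (qp X U g x) = (\<lambda>x\<in>pts (sp (iX X) U). snd (sp (iX X) V)) (qp X U g x)"
        using qp_in_pts[OF X U(1) g] qp_base[OF X U(2) g(1)] by simp
    qed simp
  }
  fix U V W i j
  assume U: "U \<in> tObj J" "V \<in> tObj J" "W \<in> tObj J" "i \<in> topspace (tHom J U V)" "j \<in> topspace (tHom J V W)"
  show "str (iX X) U W (tCmp J U V W j i) = compose (pts (sp (iX X) U)) (str (iX X) V W j) (str (iX X) U V i)"
  proof (rule ind_spec_extensionalityI[OF X U(1) str_ind_spec_extensional])
    fix g x assume g: "g \<in> carrier G" "x \<in> pts (sp (fst X) U)"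
    have "str (iX X) U W (tCmp J U V W j i) (qp X U g x) = qp X W g (str (fst X) V W j (str (fst X) U V i x))"
      using U by (intro str_ind_spec'[OF X U(1,3) g])
         (auto simp: is_specD(10)[OF Xs U] compose_def is_specD(7,8)[OF Xs] str_equivariant[OF X])
    then show "str (iX X) U W (tCmp J U V W j i) (qp X U g x) =
        compose (pts (sp (iX X) U)) (str (iX X) V W j) (str (iX X) U V i) (qp X U g x)"
      using qp_in_pts[OF X U(1) g] g U is_specD(8)[OF Xs U(1,2,4)] by (simp add: compose_def str_ind_spec[OF X])
  qed (simp add: compose_def)
qed

section \<open>Induction as a functor to spectra with an action of \<open>G\<close>\<close>

abbreviation iG :: "('o, 'm, 'h, 'u) gspec \<Rightarrow> ('o, 'm, 'g, 'u) gspec" where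
  "iG \<equiv> fst (ind J H G \<iota>)"

abbreviation iM :: "('o, 'm, 'h, 'u) gspec \<Rightarrow> ('o, 'm, 'h, 'u) gspec \<Rightarrow> ('o \<Rightarrow> 'u \<Rightarrow> 'u) \<Rightarrow> 'o \<Rightarrow> 'u \<Rightarrow> 'u" where
  "iM \<equiv> snd (ind J H G \<iota>)"

lemma fst_iG [simp]: "fst (iG X) = iX X"
  by (simp add: ind_def)

lemma ind_act:
  assumes X: "is_gspec J H (X :: ('o, 'm, 'h, 'u) gspec)" and V: "V \<in> tObj J"
    and g: "\<gamma> \<in> carrier G" "g \<in> carrier G" "x \<in> pts (sp (fst X) V)"
  shows "snd (iG X) \<gamma> V (qp X V g x) = qp X V (\<gamma> \<otimes>\<^bsub>G\<^esub> g) x"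
proof -
  have "(qmap (ind_prod G (sp (fst X) V)) (ind_rel H G \<iota> X V) (ind_rel H G \<iota> X V)
     (\<lambda>(g, x). (\<gamma> \<otimes>\<^bsub>G\<^esub> g, x)) (qp X V g x) :: 'u) = qp X V (\<gamma> \<otimes>\<^bsub>G\<^esub> g) x"
    by (rule qmap_ind_mult[OF X V X V]) (use g in auto)
  then show ?thesis by (simp add: ind_def V)
qed

lemma ind_act_extensional:
  "snd (iG X) \<gamma> \<in> extensional (tObj J)" "V \<in> tObj J \<Longrightarrow> snd (iG X) \<gamma> V \<in> extensional (pts (sp (iX X) V))"
  by (simp_all add: ind_def qmap_extensional ind_spec_def)

lemma ind_map:
  assumes X: "is_gspec J H (X :: ('o, 'm, 'h, 'u) gspec)" and Y: "is_gspec J H Y" and \<phi>: "\<phi> \<in> gspec_maps J H X Y"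
    and V: "V \<in> tObj J" and g: "g \<in> carrier G" "x \<in> pts (sp (fst X) V)"
  shows "iM X Y \<phi> V (qp X V g x) = qp Y V g (\<phi> V x)"
proof -
  note s = spec_mapsD[OF gspec_mapsD(1)[OF \<phi>]]
  have "(qmap (ind_prod G (sp (fst X) V)) (ind_rel H G \<iota> X V) (ind_rel H G \<iota> Y V)
     (\<lambda>(g, x). (g, \<phi> V x)) (qp X V g x) :: 'u) = qp Y V (\<one>\<^bsub>G\<^esub> \<otimes>\<^bsub>G\<^esub> g) (\<phi> V x)"
    by (rule qmap_ind_mult[OF X V Y V]) (use g V s gspec_mapsD(2)[OF \<phi>] in auto)
  then show ?thesis using g by (simp add: ind_def V)
qed

lemma ind_map_extensional:
  "iM X Y \<phi> \<in> extensional (tObj J)" "V \<in> tObj J \<Longrightarrow> iM X Y \<phi> V \<in> extensional (pts (sp (iX X) V))"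
  by (simp_all add: ind_def qmap_extensional ind_spec_def)

text \<open>\<open>G\<close> acts by left multiplication on the first entry. This commutes with the
  right multiplication by \<open>H\<close> used in the identifications and with the structure maps,
  which touch only the second entry.\<close>

lemma is_gspec_ind:
  assumes X: "is_gspec J H (X :: ('o, 'm, 'h, 'u) gspec)"
  shows "is_gspec J G (iG X)"
proof (rule is_gspecI[OF _ group_G])
  note Xs = is_gspecD(1)[OF X]
  show "is_spec J (fst (iG X))" using is_spec_ind_spec[OF X] by simp
  have cont: "continuous_map (top_of_set (carrier G)) (based_maps (sp (iX X) V) (sp (iX X) V)) (\<lambda>\<gamma>. snd (iG X) \<gamma> V)"
    if V: "V \<in> tObj J" for V
  proof (rule continuous_map_into_based_maps[OF top_G small(6)])
    let ?G = "top_of_set (carrier G)" 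
    let ?GA = "prod_topology ?G (fst (sp (fst X) V))"
    have m: "continuous_map (prod_topology ?G ?G) ?G (\<lambda>(a, b). a \<otimes>\<^bsub>G\<^esub> b)"
      using cont_mult by (auto simp: subtopology_Times[symmetric])
    have a: "continuous_map (prod_topology ?G ?GA) ?G (\<lambda>s. fst (snd s))"
      using continuous_map_compose[OF continuous_map_snd continuous_map_fst] by (auto simp: o_def)
    have b: "continuous_map (prod_topology ?G ?GA) (fst (sp (fst X) V)) (\<lambda>s. snd (snd s))"
      using continuous_map_compose[OF continuous_map_snd continuous_map_snd] by (simp add: o_def)
    have c: "continuous_map (prod_topology ?G ?GA) ?G (\<lambda>s. fst s \<otimes>\<^bsub>G\<^esub> fst (snd s))"
      using continuous_map_compose[OF continuous_map_pairedI[OF continuous_map_fst a] m] by (simp add: o_def)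
    show "continuous_map (prod_topology ?G (fst (sp (iX X) V))) (fst (sp (iX X) V)) (\<lambda>(\<gamma>, z). snd (iG X) \<gamma> V z)"
      by (rule continuous_map_ind[OF X V top_G], rule continuous_map_eq[OF continuous_map_qp[OF X V c b]])
         (auto simp: ind_act[OF X V])
    show "snd (iG X) \<gamma> V (snd (sp (iX X) V)) = snd (sp (iX X) V)" if "\<gamma> \<in> topspace ?G" for \<gamma>
    proof -
      have \<gamma>: "\<gamma> \<in> carrier G" using that by simp
      show ?thesis
        using ind_act[OF X V \<gamma> G.one_closed is_specD(4)[OF Xs V]] qp_base[OF X V \<gamma>] \<gamma>
        by (simp add: snd_ind_spec)
    qed
  qed (rule ind_act_extensional(2)[OF V])
  then show "continuous_map (top_of_set (carrier G)) (based_maps (sp (fst (iG X)) V) (sp (fst (iG X)) V)) (\<lambda>\<gamma>. snd (iG X) \<gamma> V)"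
    if "V \<in> tObj J" for V using that by simp
  show "snd (iG X) \<gamma> \<in> spec_maps J (fst (iG X)) (fst (iG X))" if \<gamma>: "\<gamma> \<in> carrier G" for \<gamma>
  proof -
    have "snd (iG X) \<gamma> V \<in> topspace (based_maps (sp (iX X) V) (sp (iX X) V))" if "V \<in> tObj J" for V
      using cont[OF that] \<gamma> by (auto simp: continuous_map_def)
    moreover have "snd (iG X) \<gamma> V (str (iX X) U V j z) = str (iX X) U V j (snd (iG X) \<gamma> U z)"
      if U: "U \<in> tObj J" "V \<in> tObj J" "j \<in> topspace (tHom J U V)" and z: "z \<in> pts (sp (iX X) U)" for U V j z
      using z U \<gamma> is_specD(8)[OF Xs U]
      by (elim ind_specE[OF X U(1)]) (simp add: str_ind_spec[OF X U] ind_act[OF X])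
    ultimately show ?thesis
      unfolding spec_maps_iff fst_iG using ind_act_extensional(1) by (simp add: topspace_based_maps)
  qed
  show "snd (iG X) (k \<otimes>\<^bsub>G\<^esub> l) V z = snd (iG X) k V (snd (iG X) l V z)"
    if "k \<in> carrier G" "l \<in> carrier G" "V \<in> tObj J" "z \<in> pts (sp (fst (iG X)) V)" for k l V z
    using that(4) unfolding fst_iG
    by (elim ind_specE[OF X that(3)]) (simp add: ind_act[OF X] that G.m_assoc)
  show "snd (iG X) \<one>\<^bsub>G\<^esub> V z = z" if "V \<in> tObj J" "z \<in> pts (sp (fst (iG X)) V)" for V z
    using that(2) unfolding fst_iG
    by (elim ind_specE[OF X that(1)]) (simp add: ind_act[OF X] that)
qed

lemma gspec_maps_ind:
  assumes X: "is_gspec J H (X :: ('o, 'm, 'h, 'u) gspec)" and Y: "is_gspec J H Y" and \<phi>: "\<phi> \<in> gspec_maps J H X Y"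
  shows "iM X Y \<phi> \<in> gspec_maps J G (iG X) (iG Y)"
proof -
  note Xs = is_gspecD(1)[OF X] and s = spec_mapsD[OF gspec_mapsD(1)[OF \<phi>]]
  have "continuous_map (fst (sp (iX X) V)) (fst (sp (iX Y) V)) (iM X Y \<phi> V)" if V: "V \<in> tObj J" for V
    by (rule continuous_map_ind_single[OF X V], 
        rule continuous_map_eq[OF continuous_map_qp[OF Y V continuous_map_fst continuous_map_compose[OF continuous_map_snd s(3)[OF V]]]])
       (auto simp: ind_map[OF X Y \<phi> V])
  moreover have "iM X Y \<phi> V (snd (sp (iX X) V)) = snd (sp (iX Y) V)" if V: "V \<in> tObj J" for V
    unfolding snd_ind_spec using V is_specD(4)[OF Xs V] s(5) by (simp add: ind_map[OF X Y \<phi>])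
  moreover have "iM X Y \<phi> V (str (iX X) U V j z) = str (iX Y) U V j (iM X Y \<phi> U z)"
    if U: "U \<in> tObj J" "V \<in> tObj J" "j \<in> topspace (tHom J U V)" and z: "z \<in> pts (sp (iX X) U)" for U V j z
    using z U is_specD(8)[OF Xs U] s(4,6)
    by (elim ind_specE[OF X U(1)]) (simp add: str_ind_spec[OF X U] str_ind_spec[OF Y U] ind_map[OF X Y \<phi>])
  moreover have "iM X Y \<phi> V (snd (iG X) \<gamma> V z) = snd (iG Y) \<gamma> V (iM X Y \<phi> V z)"
    if "\<gamma> \<in> carrier G" and V: "V \<in> tObj J" and z: "z \<in> pts (sp (iX X) V)" for \<gamma> V z
    using z that s(4)
    by (elim ind_specE[OF X V]) (simp add: ind_act[OF X] ind_act[OF Y] ind_map[OF X Y \<phi>])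
  ultimately show ?thesis
    unfolding gspec_maps_def spec_maps_iff fst_iG using ind_map_extensional by auto
qed

lemma ind_map_eqI:
  assumes X: "is_gspec J H (X :: ('o, 'm, 'h, 'u) gspec)"
    and f: "f \<in> extensional (tObj J)" "\<And>V. V \<in> tObj J \<Longrightarrow> f V \<in> extensional (pts (sp (iX X) V))"
    and g: "g \<in> extensional (tObj J)" "\<And>V. V \<in> tObj J \<Longrightarrow> g V \<in> extensional (pts (sp (iX X) V))"
    and eq: "\<And>V a x. \<lbrakk>V \<in> tObj J; a \<in> carrier G; x \<in> pts (sp (fst X) V)\<rbrakk> \<Longrightarrow> f V (qp X V a x) = g V (qp X V a x)"
  shows "f = g"
  by (rule extensionalityI[OF f(1) g(1)], rule ind_spec_extensionalityI[OF X]) (use assms in auto)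

lemma is_functor_ind:
  "is_functor (SpG J H) (SpG J G) (ind J H G \<iota> :: (('o, 'm, 'h, 'u) gspec, _, _, _) ftor)"
  unfolding is_functor_def SpG_simps
proof (intro conjI ballI)
  fix X :: "('o, 'm, 'h, 'u) gspec" assume "X \<in> {X. is_gspec J H X}"
  then have X: "is_gspec J H X" by simp
  show "iG X \<in> {X. is_gspec J G X}" using is_gspec_ind[OF X] by simp
  have I: "Id (Sp J) (fst X) \<in> gspec_maps J H X X"
    using is_catD(1)[OF is_cat_SpG[of J H]] X by (simp del: Sp_simps(3))
  show "iM X X (Id (Sp J) (fst X)) = Id (Sp J) (fst (iG X))"
    by (rule ind_map_eqI[OF X])
       (use ind_map_extensional ind_map[OF X X I] qp_in_pts[OF X] in auto)
next
  fix X Y :: "('o, 'm, 'h, 'u) gspec" and f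
  assume "X \<in> {X. is_gspec J H X}" "Y \<in> {X. is_gspec J H X}" "f \<in> gspec_maps J H X Y"
  then show "iM X Y f \<in> gspec_maps J G (iG X) (iG Y)"
    by (intro gspec_maps_ind) auto
next
  fix X Y Z :: "('o, 'm, 'h, 'u) gspec" and f g
  assume XYZ: "X \<in> {X. is_gspec J H X}" "Y \<in> {X. is_gspec J H X}" "Z \<in> {X. is_gspec J H X}"
   and f: "f \<in> gspec_maps J H X Y" and g: "g \<in> gspec_maps J H Y Z"
  have X: "is_gspec J H X" and Y: "is_gspec J H Y" and Z: "is_gspec J H Z" using XYZ by auto
  have gf: "Cmp (Sp J) (fst X) (fst Y) (fst Z) g f \<in> gspec_maps J H X Z"
    using is_catD(2)[OF is_cat_SpG[of J H], of X Y Z f g] X Y Z f g by (simp del: Sp_simps(4))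
  show "iM X Z (Cmp (Sp J) (fst X) (fst Y) (fst Z) g f) =
      Cmp (Sp J) (fst (iG X)) (fst (iG Y)) (fst (iG Z)) (iM Y Z g) (iM X Y f)"
    by (rule ind_map_eqI[OF X])
       (use ind_map_extensional ind_map[OF X Z gf] ind_map[OF X Y f] ind_map[OF Y Z g] qp_in_pts[OF X]
         spec_mapsD(4)[OF gspec_mapsD(1)[OF f]] in \<open>auto simp: compose_def\<close>)
qed

text \<open>Composition with the unit \<open>x \<mapsto> [1, x]\<close> of the adjunction.\<close>

definition adj :: "('o, 'm, 'h, 'u) gspec \<Rightarrow> ('o \<Rightarrow> 'u \<Rightarrow> 'u) \<Rightarrow> 'o \<Rightarrow> 'u \<Rightarrow> 'u" where
  "adj X \<psi> = (\<lambda>V \<in> tObj J. \<lambda>x \<in> pts (sp (fst X) V). \<psi> V (qp X V \<one>\<^bsub>G\<^esub> x))"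

text \<open>The extension \<open>[g, x] \<mapsto> g (\<phi> x)\<close>, evaluated at the
  representative that \<open>inv_into\<close> picks; its independence of this choice is the content
  of \<open>adj_inv_qp\<close>.\<close>

definition adj_inv :: "('o, 'm, 'h, 'u) gspec \<Rightarrow> ('o, 'm, 'g, 'u) gspec \<Rightarrow> ('o \<Rightarrow> 'u \<Rightarrow> 'u) \<Rightarrow> 'o \<Rightarrow> 'u \<Rightarrow> 'u" where
  "adj_inv X Y \<phi> = (\<lambda>V \<in> tObj J. \<lambda>z \<in> pts (sp (iX X) V).
     (case inv_into (topspace (ind_prod G (sp (fst X) V))) (qproj (ind_rel H G \<iota> X V)) z of
       (g, x) \<Rightarrow> snd Y g V (\<phi> V x)))"

lemma adj_in:
  assumes X: "is_gspec J H (X :: ('o, 'm, 'h, 'u) gspec)" and Y: "is_gspec J G Y"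
    and \<psi>: "\<psi> \<in> gspec_maps J G (iG X) Y"
  shows "adj X \<psi> \<in> gspec_maps J H X (fst (res \<iota>) Y)"
proof -
  note Xs = is_gspecD(1)[OF X] and s = spec_mapsD[OF gspec_mapsD(1)[OF \<psi>], unfolded fst_iG]
  have "continuous_map (fst (sp (fst X) V)) (fst (sp (fst Y) V)) (adj X \<psi> V)" if V: "V \<in> tObj J" for V
  proof (rule continuous_map_eq)
    show "continuous_map (fst (sp (fst X) V)) (fst (sp (fst Y) V)) (\<psi> V \<circ> (\<lambda>x. qp X V \<one>\<^bsub>G\<^esub> x))"
      by (rule continuous_map_compose[OF continuous_map_qp[OF X V] s(3)[OF V]]) auto
  qed (simp add: adj_def V)
  moreover have "adj X \<psi> V (snd (sp (fst X) V)) = snd (sp (fst Y) V)" if V: "V \<in> tObj J" for V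
    using s(5)[OF V] V is_specD(4)[OF Xs V] by (simp add: adj_def snd_ind_spec)
  moreover have "adj X \<psi> V (str (fst X) U V j x) = str (fst Y) U V j (adj X \<psi> U x)"
    if U: "U \<in> tObj J" "V \<in> tObj J" "j \<in> topspace (tHom J U V)" and x: "x \<in> pts (sp (fst X) U)" for U V j x
    using U x s(6)[OF U qp_in_pts[OF X U(1) G.one_closed x]] is_specD(8)[OF Xs U x]
    by (simp add: adj_def str_ind_spec[OF X U])
  \<comment> \<open>Equivariance under \<open>H\<close> comes from
    \<open>[1, h x] = [\<iota> h, x] = \<iota> h [1, x]\<close>.\<close>
  moreover have "adj X \<psi> V (snd X h V x) = snd Y (\<iota> h) V (adj X \<psi> V x)"
    if h: "h \<in> carrier H" and V: "V \<in> tObj J" and x: "x \<in> pts (sp (fst X) V)" for h V x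
    using h V x gspec_mapsD(2)[OF \<psi> \<iota>_carrier[OF h] V, unfolded fst_iG, OF qp_in_pts[OF X V G.one_closed x]]
      is_gspecD(6)[OF X h V x] qp_mult[OF X V G.one_closed h x] \<iota>_carrier[OF h]
    by (simp add: adj_def ind_act[OF X V])
  ultimately show ?thesis
    unfolding gspec_maps_def spec_maps_iff by (auto simp: res_def adj_def)
qed

text \<open>Both identifications are respected: \<open>\<phi>\<close> is
  \<open>H\<close>-equivariant, so \<open>(b \<iota>(h)) \<phi>(x)\<close> equals
  \<open>b \<phi>(h x)\<close>, and \<open>G\<close> fixes the basepoint of
  \<open>Y\<close>.\<close>

lemma adj_inv_qp:
  assumes X: "is_gspec J H (X :: ('o, 'm, 'h, 'u) gspec)" and Y: "is_gspec J G Y"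
    and \<phi>: "\<phi> \<in> gspec_maps J H X (fst (res \<iota>) Y)" and V: "V \<in> tObj J" and g: "g \<in> carrier G" "x \<in> pts (sp (fst X) V)"
  shows "adj_inv X Y \<phi> V (qp X V g x) = snd Y g V (\<phi> V x)"
proof -
  let ?P = "ind_prod G (sp (fst X) V)" and ?R = "ind_rel H G \<iota> X V"
  have s: "V \<in> tObj J \<Longrightarrow> x \<in> pts (sp (fst X) V) \<Longrightarrow> \<phi> V x \<in> pts (sp (fst Y) V)" for x
    using spec_mapsD(4)[OF gspec_mapsD(1)[OF \<phi>]] by (simp add: res_def)
  have sb: "\<phi> V (snd (sp (fst X) V)) = snd (sp (fst Y) V)"
    using spec_mapsD(5)[OF gspec_mapsD(1)[OF \<phi>] V] by (simp add: res_def)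
  have sh: "\<phi> V (snd X h V x) = snd Y (\<iota> h) V (\<phi> V x)" if "h \<in> carrier H" "x \<in> pts (sp (fst X) V)" for h x
    using gspec_mapsD(2)[OF \<phi> that(1) V that(2)] by (simp add: res_def)
  have gx: "(g, x) \<in> topspace ?P" using g by (simp add: topspace_ind_prod[OF X V])
  obtain b y where b: "inv_into (topspace ?P) (qproj ?R) (qp X V g x) = (b, y)" by (metis surj_pair)
  have "((g, x), (b, y)) \<in> ?R"
    using inv_into_qproj(2)[OF inj_code equiv_ind_rel[OF X V] gx] by (simp add: b)
  then have m: "b \<in> carrier G" "y \<in> pts (sp (fst X) V)"
    and d: "(\<exists>h\<in>carrier H. g = b \<otimes>\<^bsub>G\<^esub> \<iota> h \<and> y = snd X h V x) \<or> x = snd (sp (fst X) V) \<and> y = snd (sp (fst X) V)"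
    unfolding mem_ind_rel[OF X V] by auto
  have "snd Y b V (\<phi> V y) = snd Y g V (\<phi> V x)"
    using d
  proof (elim disjE bexE conjE)
    fix h assume "h \<in> carrier H" "g = b \<otimes>\<^bsub>G\<^esub> \<iota> h" "y = snd X h V x"
    then show ?thesis using m g V s sh by (simp add: is_gspecD(4)[OF Y] \<iota>_carrier)
  next
    assume "x = snd (sp (fst X) V)" "y = snd (sp (fst X) V)"
    then show ?thesis using m g V sb by (simp add: is_gspecD(7)[OF Y])
  qed
  then show ?thesis
    using qp_in_pts[OF X V g] V by (simp add: adj_inv_def b)
qed

lemma adj_inv_in:
  assumes X: "is_gspec J H (X :: ('o, 'm, 'h, 'u) gspec)" and Y: "is_gspec J G Y"
    and \<phi>: "\<phi> \<in> gspec_maps J H X (fst (res \<iota>) Y)"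
  shows "adj_inv X Y \<phi> \<in> gspec_maps J G (iG X) Y"
proof -
  note Xs = is_gspecD(1)[OF X]
  have f: "fst (fst (res \<iota>) Y) = fst Y" by (simp add: res_def)
  note s = spec_mapsD[OF gspec_mapsD(1)[OF \<phi>], unfolded f]
  note q = adj_inv_qp[OF X Y \<phi>]
  have "continuous_map (fst (sp (iX X) V)) (fst (sp (fst Y) V)) (adj_inv X Y \<phi> V)" if V: "V \<in> tObj J" for V
  proof (rule continuous_map_ind_single[OF X V], rule continuous_map_eq)
    let ?G = "top_of_set (carrier G)"
    \<comment> \<open>On representatives the extension is \<open>\<phi>\<close> followed by the
      action of \<open>G\<close> on \<open>Y\<close>, which is jointly continuous because
      \<open>G\<close> is compact.\<close>
    have "continuous_map (prod_topology ?G (fst (sp (fst X) V))) (prod_topology ?G (fst (sp (fst Y) V)))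
        (\<lambda>p. (fst p, (\<phi> V \<circ> snd) p))"
      by (intro continuous_map_pairedI continuous_map_fst continuous_map_compose[OF continuous_map_snd s(3)[OF V]])
    from continuous_map_compose[OF this continuous_action[OF compact_G Y V]]
    show "continuous_map (prod_topology ?G (fst (sp (fst X) V))) (fst (sp (fst Y) V)) (\<lambda>p. snd Y (fst p) V (\<phi> V (snd p)))"
      by (simp add: o_def)
  qed (auto simp: q V)
  moreover have "adj_inv X Y \<phi> V (snd (sp (iX X) V)) = snd (sp (fst Y) V)" if V: "V \<in> tObj J" for V
    unfolding snd_ind_spec using V is_specD(4)[OF Xs V] s(5) by (simp add: q is_gspecD(7)[OF Y])
  moreover have "adj_inv X Y \<phi> V (str (iX X) U V j z) = str (fst Y) U V j (adj_inv X Y \<phi> U z)"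
    if U: "U \<in> tObj J" "V \<in> tObj J" "j \<in> topspace (tHom J U V)" and z: "z \<in> pts (sp (iX X) U)" for U V j z
    using z U is_specD(8)[OF Xs U] s(4,6)
    by (elim ind_specE[OF X U(1)]) (simp add: str_ind_spec[OF X U] q spec_mapsD(6)[OF is_gspecD(3)[OF Y]])
  moreover have "adj_inv X Y \<phi> V (snd (iG X) \<gamma> V z) = snd Y \<gamma> V (adj_inv X Y \<phi> V z)"
    if "\<gamma> \<in> carrier G" and V: "V \<in> tObj J" and z: "z \<in> pts (sp (iX X) V)" for \<gamma> V z
    using z that s(4)
    by (elim ind_specE[OF X V]) (simp add: ind_act[OF X] q is_gspecD(4)[OF Y])
  ultimately show ?thesis
    unfolding gspec_maps_def spec_maps_iff fst_iG by (auto simp: adj_inv_def)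
qed

lemma left_adjoint_ind:
  "left_adjoint (SpG J H) (SpG J G) (ind J H G \<iota> :: (('o, 'm, 'h, 'u) gspec, _, _, _) ftor) (res \<iota>)"
  unfolding left_adjoint_def
proof (intro conjI exI[of _ "\<lambda>X Y. adj X"] ballI)
  show "is_functor (SpG J H) (SpG J G) (ind J H G \<iota> :: (('o, 'm, 'h, 'u) gspec, _, _, _) ftor)"
    by (rule is_functor_ind)
  show "is_functor (SpG J G) (SpG J H) (res \<iota> :: (('o, 'm, 'g, 'u) gspec, _, _, _) ftor)"
    by (rule is_functor_res[OF group_H hom_\<iota> cont_\<iota>])
next
  fix X :: "('o, 'm, 'h, 'u) gspec" and Y :: "('o, 'm, 'g, 'u) gspec"
  assume "X \<in> Obj (SpG J H)" "Y \<in> Obj (SpG J G)"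
  then have X: "is_gspec J H X" and Y: "is_gspec J G Y" by auto
  have f: "fst (fst (res \<iota>) Y) = fst Y" by (simp add: res_def)
  show "bij_betw (adj X) (Hom (SpG J G) (iG X) Y) (Hom (SpG J H) X (fst (res \<iota>) Y))"
    unfolding SpG_simps
  proof (rule bij_betw_byWitness[where f' = "adj_inv X Y"])
    show "\<forall>\<psi>\<in>gspec_maps J G (iG X) Y. adj_inv X Y (adj X \<psi>) = \<psi>"
    proof
      fix \<psi> assume \<psi>: "\<psi> \<in> gspec_maps J G (iG X) Y"
      note a = adj_in[OF X Y \<psi>]
      note s = spec_mapsD[OF gspec_mapsD(1)[OF \<psi>], unfolded fst_iG]
      show "adj_inv X Y (adj X \<psi>) = \<psi>"
      proof (rule ind_map_eqI[OF X])
        fix V g x assume V: "V \<in> tObj J" and g: "g \<in> carrier G" "x \<in> pts (sp (fst X) V)"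
        \<comment> \<open>Since \<open>[g, x] = g [1, x]\<close>, a \<open>G\<close>-equivariant map
          is recovered from its values on the classes \<open>[1, x]\<close>.\<close>
        have "adj_inv X Y (adj X \<psi>) V (qp X V g x) = snd Y g V (\<psi> V (qp X V \<one>\<^bsub>G\<^esub> x))"
          using V g by (simp add: adj_inv_qp[OF X Y a V g]) (simp add: adj_def)
        also have "\<dots> = \<psi> V (snd (iG X) g V (qp X V \<one>\<^bsub>G\<^esub> x))"
          using gspec_mapsD(2)[OF \<psi> g(1) V] qp_in_pts[OF X V G.one_closed g(2)] by simp
        also have "\<dots> = \<psi> V (qp X V g x)"
          using g by (simp add: ind_act[OF X V])
        finally show "adj_inv X Y (adj X \<psi>) V (qp X V g x) = \<psi> V (qp X V g x)" .
      qed (use s in \<open>auto simp: adj_inv_def\<close>)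
    qed
    show "\<forall>\<phi>\<in>gspec_maps J H X (fst (res \<iota>) Y). adj X (adj_inv X Y \<phi>) = \<phi>"
    proof
      fix \<phi> assume \<phi>: "\<phi> \<in> gspec_maps J H X (fst (res \<iota>) Y)"
      note s = spec_mapsD[OF gspec_mapsD(1)[OF \<phi>], unfolded f]
      show "adj X (adj_inv X Y \<phi>) = \<phi>"
      proof (rule extensionalityI[of _ "tObj J"])
        fix V assume V: "V \<in> tObj J"
        show "adj X (adj_inv X Y \<phi>) V = \<phi> V"
          by (rule extensionalityI[of _ "pts (sp (fst X) V)"])
             (use s V gspec_one[OF Y group_G V] in \<open>auto simp: adj_def adj_inv_qp[OF X Y \<phi>]\<close>)
      qed (use s in \<open>auto simp: adj_def\<close>)
    qed
  qed (use adj_in[OF X Y] adj_inv_in[OF X Y] in auto)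
next
  fix X X' :: "('o, 'm, 'h, 'u) gspec" and Y Y' :: "('o, 'm, 'g, 'u) gspec" and f g \<psi>
  assume "X \<in> Obj (SpG J H)" "X' \<in> Obj (SpG J H)" "Y \<in> Obj (SpG J G)" "Y' \<in> Obj (SpG J G)"
    and f: "f \<in> Hom (SpG J H) X' X" and g: "g \<in> Hom (SpG J G) Y Y'" and \<psi>: "\<psi> \<in> Hom (SpG J G) (iG X) Y"
  then have X: "is_gspec J H X" and X': "is_gspec J H X'" by auto
  note s = spec_mapsD[OF gspec_mapsD(1)[OF f[unfolded SpG_simps]]]
  show "adj X' (Cmp (SpG J G) (iG X') Y Y' g (Cmp (SpG J G) (iG X') (iG X) Y \<psi> (iM X' X f))) =
      Cmp (SpG J H) X' (fst (res \<iota>) Y) (fst (res \<iota>) Y') (snd (res \<iota>) Y Y' g)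
       (Cmp (SpG J H) X' X (fst (res \<iota>) Y) (adj X \<psi>) f)"
    using s(4) qp_in_pts[OF X' _ G.one_closed] ind_map[OF X' X f[unfolded SpG_simps] _ G.one_closed]
    by (auto simp: adj_def res_def compose_def fun_eq_iff)
qed

end

section \<open>The morphism spaces of the category of isometries\<close>

text \<open>A point is determined by the members of a countable basis that contain it, hence by a
  set of natural numbers.\<close>

lemma lepoll_real_second_countable: "(UNIV :: 'a::{second_countable_topology, t2_space} set) \<lesssim> (UNIV :: real set)"
proof -
  obtain B :: "'a set set" where B: "countable B" "topological_basis B"
    using ex_countable_basis by blast
  let ?e = "\<lambda>x :: 'a. {n. x \<in> from_nat_into B n}"
  have "inj ?e"
  proof (rule injI, rule ccontr)
    fix x y :: 'a assume e: "?e x = ?e y" and "x \<noteq> y"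
    then obtain U where U: "open U" "x \<in> U" "y \<notin> U" using t1_space by blast
    then obtain C where C: "C \<in> B" "x \<in> C" "C \<subseteq> U" using topological_basisE[OF B(2)] by metis
    then obtain n where "from_nat_into B n = C" using from_nat_into_surj[OF B(1)] by blast
    then show False using e C U by blast
  qed
  then have "(UNIV :: 'a set) \<lesssim> (UNIV :: nat set set)" by (auto simp: lepoll_def)
  then show ?thesis using nat_sets_eqpoll_reals lepoll_trans2 by blast
qed

text \<open>A function is coded by its graph, a subset of a product that still embeds in
  \<open>'u\<close>.\<close>

lemma UNIV_fun_lepoll:
  assumes inf: "infinite (UNIV :: 'u set)" and "(UNIV :: 'a set) \<lesssim> (UNIV :: 'u set)" "(UNIV :: 'b set) \<lesssim> (UNIV :: 'u set)"
  shows "(UNIV :: ('a \<Rightarrow> 'b) set) \<lesssim> (UNIV :: 'u set set)"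
proof -
  have "inj (\<lambda>f :: 'a \<Rightarrow> 'b. {(x, f x) | x. True})"
    by (auto simp: inj_on_def fun_eq_iff set_eq_iff)
  then have "(UNIV :: ('a \<Rightarrow> 'b) set) \<lesssim> (UNIV :: ('a \<times> 'b) set set)" by (auto simp: lepoll_def)
  then show ?thesis
    using UNIV_set_lepoll_mono[OF Times_UNIV_lepoll_infinite[OF assms]] lepoll_trans by blast
qed

lemma UNIV_option_lepoll: "(UNIV :: 'a option set) \<lesssim> (UNIV :: 'a set set)"
proof -
  have "inj (case_option {} (\<lambda>a :: 'a. {a}))"
    by (rule injI) (simp split: option.splits)
  then show ?thesis by (auto simp: lepoll_def)
qed

text \<open>Vectors form a second countable space and so are no more numerous than reals. Functions
  between them cost one powerset, and the added point \<open>None\<close> is paid for by a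
  second.\<close>

lemma jmor_lepoll:
  assumes u: "(UNIV :: real set) \<lesssim> (UNIV :: 'u set)"
  shows "(UNIV :: ('f::{second_countable_topology, metric_space}) jmor set) \<lesssim> (UNIV :: 'u set set set)"
proof -
  have inf: "infinite (UNIV :: 'u set)"
    using u infinite_UNIV_char_0[where 'a = real] by (meson infinite_le_lepoll lepoll_trans)
  have v: "(UNIV :: 'f vect set) \<lesssim> (UNIV :: 'u set)"
    by (rule lepoll_trans[OF lepoll_real_second_countable u])
  have inf': "infinite (UNIV :: 'u set set)"
    using inf Finite_Set.finite_set by (metis (mono_tags, lifting))
  have p: "(UNIV :: (('f vect \<Rightarrow> 'f vect) \<times> 'f vect) set) \<lesssim> (UNIV :: 'u set set)"
    by (rule Times_UNIV_lepoll_infinite[OF inf' UNIV_fun_lepoll[OF inf v v] lepoll_trans[OF v UNIV_lepoll_UNIV_set]])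
  show ?thesis
    by (rule lepoll_trans[OF UNIV_option_lepoll UNIV_set_lepoll_mono[OF p]])
qed

section \<open>Finite-dimensional subspaces of the space of sequences\<close>

abbreviation vscale :: "'f::field \<Rightarrow> 'f vect \<Rightarrow> 'f vect" where
  "vscale c x \<equiv> (\<lambda>i. c * x i)"

interpretation vect: vector_space vscale
  by unfold_locales (auto simp: fun_eq_iff algebra_simps)

lemma sum_vect_apply: "(\<Sum>b\<in>B. f b) i = (\<Sum>b\<in>B. f b i)" for f :: "'b \<Rightarrow> ('f::real_normed_field) vect"
  by (induction B rule: infinite_finite_induct) auto

lemma fd_subspaces_iff:
  "V \<in> fd_subspaces \<longleftrightarrow> (\<exists>B. finite B \<and> (\<forall>b\<in>B. finite {i. b i \<noteq> 0}) \<and> V = vect.span B)"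
proof -
  have "{\<lambda>i. \<Sum>b \<in> B. a b * b i | a. True} = vect.span B" if "finite B" for B :: "'a vect set"
    unfolding vect.span_finite[OF that] by (auto simp: fun_eq_iff sum_vect_apply)
  then show ?thesis
    unfolding fd_subspaces_def by auto
qed

lemma fd_subspaces_subspace: "V \<in> fd_subspaces \<Longrightarrow> vect.subspace V"
  by (auto simp: fd_subspaces_iff)

lemma subspace_bounded_support: "vect.subspace {v :: 'f::field vect. \<forall>i\<ge>N. v i = 0}"
  by (auto simp: vect.subspace_def)

text \<open>Finitely many finitely supported generators have a common bound on their supports. It
  replaces the vector-dependent index set of \<open>ip\<close> by a fixed finite one.\<close>

lemma fd_subspaces_support:
  assumes "V \<in> fd_subspaces"
  obtains N where "\<And>v i. v \<in> V \<Longrightarrow> N \<le> i \<Longrightarrow> v i = 0"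
proof -
  obtain B where B: "finite B" "\<forall>b\<in>B. finite {i. b i \<noteq> 0}" "V = vect.span B"
    using assms unfolding fd_subspaces_iff by blast
  have "finite (\<Union>b\<in>B. {i. b i \<noteq> 0})" using B by blast
  then obtain N where N: "\<forall>i \<in> (\<Union>b\<in>B. {i. b i \<noteq> 0}). i < N"
    using finite_nat_set_iff_bounded by blast
  have "b i = 0" if "b \<in> B" "N \<le> i" for b i
    using N that by (meson UN_I leD mem_Collect_eq)
  then have "B \<subseteq> {v. \<forall>i\<ge>N. v i = 0}" by blast
  then have "V \<subseteq> {v. \<forall>i\<ge>N. v i = 0}"
    unfolding B(3) by (intro vect.span_minimal subspace_bounded_support)
  then show thesis using that[of N] by blast
qed

text \<open>The projection is built up by Gaussian elimination; it exhibits the subspace as a closed set.\<close>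

lemma fd_projection:
  assumes "finite B"
  shows "\<exists>p :: 'f::real_normed_field vect \<Rightarrow> 'f vect. (\<forall>j. continuous_on UNIV (\<lambda>x. p x j)) \<and>
    (\<forall>x y. p (x + y) = p x + p y) \<and> (\<forall>c x. p (vscale c x) = vscale c (p x)) \<and>
    (\<forall>x. p x \<in> vect.span B) \<and> (\<forall>v \<in> vect.span B. p v = v)"
  using assms
proof induction
  case empty
  show ?case by (rule exI[of _ "\<lambda>x. 0"]) (auto simp: fun_eq_iff)
next
  case (insert b B)
  then obtain p :: "'f vect \<Rightarrow> 'f vect" where p: "\<And>j. continuous_on UNIV (\<lambda>x. p x j)"
    "\<And>x y. p (x + y) = p x + p y" "\<And>c x. p (vscale c x) = vscale c (p x)"
    "\<And>x. p x \<in> vect.span B" "\<And>v. v \<in> vect.span B \<Longrightarrow> p v = v" by blast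
  \<comment> \<open>The part of \<open>b\<close> that \<open>p\<close> misses; it vanishes exactly
    when \<open>b\<close> already lies in the span of \<open>B\<close>.\<close>
  define d where "d = b - p b"
  have dspan: "d \<in> vect.span (insert b B)"
    unfolding d_def
    by (rule vect.span_diff[OF vect.span_base subsetD[OF vect.span_mono p(4)]]) auto
  have decomp: "\<exists>k w. v = w + vscale k b \<and> w \<in> vect.span B" if v: "v \<in> vect.span (insert b B)" for v
  proof -
    obtain k where "v - vscale k b \<in> vect.span B" using iffD1[OF vect.span_breakdown_eq v] by blast
    moreover have "v = (v - vscale k b) + vscale k b" by simp
    ultimately show ?thesis by blast
  qed
  show ?case
  proof (cases "\<exists>i. d i \<noteq> 0")
    case False
    then have "p b = b" by (auto simp: d_def fun_eq_iff)
    then have "p v = v" if "v \<in> vect.span (insert b B)" for v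
      using decomp[OF that] p by auto
    moreover have "p x \<in> vect.span (insert b B)" for x
      by (rule subsetD[OF vect.span_mono[OF subset_insertI] p(4)])
    ultimately show ?thesis using p by blast
  next
    case True
    then obtain i where i: "d i \<noteq> 0" by blast
    \<comment> \<open>The coordinate \<open>i\<close> serves as pivot: the multiple of
      \<open>d\<close> is chosen so that \<open>?q x\<close> agrees with \<open>x\<close>
      there.\<close>
    let ?q = "\<lambda>x. p x + vscale ((x i - p x i) / d i) d"
    have "?q v = v" if v: "v \<in> vect.span (insert b B)" for v
    proof -
      obtain k w where v: "v = w + vscale k b" "w \<in> vect.span B" using decomp[OF v] by blast
      then have pv: "p v = w + vscale k (p b)" using p by simp
      have "(v i - p v i) / d i = k"
        by (subst pv, subst v(1)) (use i in \<open>simp add: d_def right_diff_distrib[symmetric]\<close>)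
      then have "?q v = p v + vscale k d" by simp
      also have "\<dots> = v"
        by (subst pv, subst v(1)) (simp add: d_def fun_eq_iff algebra_simps)
      finally show ?thesis .
    qed
    moreover have "continuous_on UNIV (\<lambda>x. ?q x j)" for j
      unfolding plus_fun_def
      by (intro continuous_intros p continuous_on_product_coordinates) (use i in auto)
    moreover have "?q x \<in> vect.span (insert b B)" for x
      using p(4)[of x] vect.span_mono[of B "insert b B"] dspan
      by (intro vect.span_add vect.span_scale[of d]) auto
    moreover have "?q (x + y) = ?q x + ?q y" "?q (vscale c x) = vscale c (?q x)" for x y c
      using i by (simp_all add: p fun_eq_iff field_simps)
    ultimately show ?thesis by (intro exI[of _ ?q]) blast
  qed
qed

lemma closed_fd_subspace:
  fixes V :: "'f::real_normed_field vect set"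
  assumes "V \<in> fd_subspaces" shows "closed V"
proof -
  obtain B where B: "finite B" "V = vect.span B" using assms unfolding fd_subspaces_iff by blast
  obtain p :: "'f vect \<Rightarrow> 'f vect" where p: "\<And>j. continuous_on UNIV (\<lambda>x. p x j)" 
    "\<And>x. p x \<in> vect.span B" "\<And>v. v \<in> vect.span B \<Longrightarrow> p v = v"
    using fd_projection[OF B(1)] by blast
  have "V = {x. p x = x}"
  proof (intro equalityI subsetI)
    fix x assume "x \<in> {x. p x = x}"
    then show "x \<in> V" using p(2)[of x] by (simp add: B(2))
  qed (simp add: B(2) p(3))
  also have "\<dots> = (\<Inter>j. {x. p x j = x j})" by (auto simp: fun_eq_iff)
  finally have V: "V = (\<Inter>j. {x. p x j = x j})" .
  show ?thesis
    unfolding V by (intro closed_INT ballI closed_Collect_eq p continuous_on_product_coordinates)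
qed

lemma ip_eq_sum: "(\<And>i. N \<le> i \<Longrightarrow> u i = 0) \<Longrightarrow> ip cj u v = (\<Sum>i<N. u i * cj (v i))"
  unfolding ip_def by (rule sum.mono_neutral_left) (auto simp: not_less[symmetric])

text \<open>Covers the identity on the reals and \<open>cnj\<close>. The law \<open>mult_cj\<close>
  makes \<open>ip cj u u\<close> a sum of squared norms, the source of all bounds below.\<close>

locale scalar_conjugation =
  fixes cj :: "'f::{real_normed_field, heine_borel} \<Rightarrow> 'f"
  assumes cont_cj: "continuous_on UNIV cj" and mult_cj: "\<And>z. z * cj z = of_real ((norm z)\<^sup>2)"
begin

abbreviation bundle_set :: "'f vect set \<Rightarrow> 'f vect set \<Rightarrow> (('f vect \<Rightarrow> 'f vect) \<times> 'f vect) set" where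
  "bundle_set U V \<equiv> {(f, x). f \<in> isometries cj U V \<and> x \<in> V \<and> (\<forall>u \<in> U. ip cj x (f u) = 0)}"

text \<open>Tychonoff's theorem, for the topology on function types.\<close>

lemma compact_coordinatewise:
  fixes C :: "'i \<Rightarrow> 'b::topological_space set"
  assumes "\<And>i. compact (C i)" shows "compact {f. \<forall>i. f i \<in> C i}"
proof -
  have "compactin (product_topology (\<lambda>i. euclidean) UNIV) (PiE UNIV C)"
    using assms by (simp add: compactin_PiE)
  then show ?thesis by (simp add: euclidean_product_topology PiE_UNIV_domain Pi_def)
qed

text \<open>The square of each coordinate is one summand of \<open>ip cj (f u) (f u)\<close>, and
  the isometry keeps this equal to \<open>ip cj u u\<close>.\<close>

lemma isometry_norm_le:
  assumes f: "f \<in> isometries cj U V" and u: "u \<in> U" and V: "V \<in> fd_subspaces"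
  shows "norm (f u i) \<le> sqrt (norm (ip cj u u))"
proof -
  obtain N where N: "\<And>v i. v \<in> V \<Longrightarrow> N \<le> i \<Longrightarrow> v i = 0" using fd_subspaces_support[OF V] by blast
  have fu: "f u \<in> V" "ip cj (f u) (f u) = ip cj u u" using f u by (auto simp: isometries_def)
  have "ip cj u u = of_real (\<Sum>i<N. (norm (f u i))\<^sup>2)"
    unfolding fu(2)[symmetric] using N[OF fu(1)] by (simp add: ip_eq_sum[of N] mult_cj)
  then have e: "norm (ip cj u u) = (\<Sum>i<N. (norm (f u i))\<^sup>2)"
    by (simp del: of_real_sum add: sum_nonneg)
  show ?thesis
  proof (cases "i < N")
    case True
    then have "(norm (f u i))\<^sup>2 \<le> norm (ip cj u u)"
      unfolding e by (intro member_le_sum) auto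
    then show ?thesis by (simp add: real_le_rsqrt)
  qed (use N[OF fu(1), of i] in simp)
qed

text \<open>Isometries are functions on an infinite set of vectors, yet each value is confined to a
  compact set, so Tychonoff applies. Linearity, isometry and orthogonality are pointwise equations
  and cut out a closed set \<open>Q\<close>.\<close>

lemma compact_bundle_bounded:
  assumes V: "V \<in> fd_subspaces" and r: "0 \<le> r"
  shows "compact {(f, x) \<in> bundle_set U V. \<forall>i. norm (x i) \<le> r}"
proof -
  obtain N where N: "\<And>v i. v \<in> V \<Longrightarrow> N \<le> i \<Longrightarrow> v i = 0" using fd_subspaces_support[OF V] by blast
  define D where "D s = {v :: 'f vect. \<forall>i. v i \<in> (if i < N then cball 0 s else {0})}" for s
  have cD: "compact (D s)" for s
    unfolding D_def by (rule compact_coordinatewise) auto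
  \<comment> \<open>Outside \<open>U\<close> an extensional function takes the value
    \<open>undefined\<close>, a compact singleton.\<close>
  define F where "F = {f :: 'f vect \<Rightarrow> 'f vect. \<forall>u. f u \<in> (if u \<in> U then D (sqrt (norm (ip cj u u))) else {undefined})}"
  have cF: "compact F"
    unfolding F_def by (rule compact_coordinatewise) (simp add: cD)
  \<comment> \<open>The sum in \<open>ip\<close> ranges over a support that varies with the vector;
    with the fixed range below \<open>N\<close> its continuity is evident, and on \<open>V\<close>
    the two agree.\<close>
  let ?ip = "\<lambda>u v. \<Sum>i<N. u i * cj (v i)"
  define Q where "Q = {(f, x). (\<forall>u \<in> U. f u \<in> V) \<and> x \<in> V \<and>
     (\<forall>u \<in> U. \<forall>w \<in> U. \<forall>i. f (\<lambda>i. u i + w i) i = f u i + f w i) \<and>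
     (\<forall>c. \<forall>u \<in> U. \<forall>i. f (\<lambda>i. c * u i) i = c * f u i) \<and>
     (\<forall>u \<in> U. \<forall>w \<in> U. ?ip (f u) (f w) = ip cj u w) \<and> (\<forall>u \<in> U. ?ip x (f u) = 0)}"
  have ev1: "continuous_on UNIV (\<lambda>p :: ('f vect \<Rightarrow> 'f vect) \<times> 'f vect. fst p u)" for u
    by (rule continuous_on_product_then_coordinatewise[OF continuous_on_fst[OF continuous_on_id]])
  have ev2: "continuous_on UNIV (\<lambda>p :: ('f vect \<Rightarrow> 'f vect) \<times> 'f vect. fst p u i)" for u i
    by (rule continuous_on_product_then_coordinatewise[OF ev1])
  have ev3: "continuous_on UNIV (\<lambda>p :: ('f vect \<Rightarrow> 'f vect) \<times> 'f vect. snd p i)" for i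
    by (rule continuous_on_product_then_coordinatewise[OF continuous_on_snd[OF continuous_on_id]])
  note cc = continuous_on_compose2[OF cont_cj _ subset_UNIV]
  have pre: "closed {p :: ('f vect \<Rightarrow> 'f vect) \<times> 'f vect. fst p u \<in> V}" for u
    using continuous_closed_preimage[OF ev1 closed_UNIV closed_fd_subspace[OF V]] by (simp add: vimage_def)
  have pre2: "closed {p :: ('f vect \<Rightarrow> 'f vect) \<times> 'f vect. snd p \<in> V}"
    using continuous_closed_preimage[OF continuous_on_snd[OF continuous_on_id] closed_UNIV closed_fd_subspace[OF V]] by (simp add: vimage_def)
  have ips: "?ip v w = ip cj v w" if "v \<in> V" for v w
    using N[OF that] by (simp add: ip_eq_sum[of N])
  have "closed Q"
    unfolding Q_def case_prod_beta Ball_def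
    by (intro closed_Collect_conj closed_Collect_all closed_Collect_imp pre pre2 closed_Collect_eq
        continuous_on_add continuous_on_mult continuous_on_const continuous_on_sum ev2 ev3 cc open_Collect_const)
  moreover have "{(f, x) \<in> bundle_set U V. \<forall>i. norm (x i) \<le> r} = (F \<times> D r) \<inter> Q"
  proof (intro equalityI subsetI)
    fix p assume "p \<in> {(f, x) \<in> bundle_set U V. \<forall>i. norm (x i) \<le> r}"
    then obtain f x where p: "p = (f, x)" and f: "f \<in> isometries cj U V" and x: "x \<in> V"
      "\<And>u. u \<in> U \<Longrightarrow> ip cj x (f u) = 0" "\<And>i. norm (x i) \<le> r" by auto
    have fV: "f u \<in> V" if "u \<in> U" for u using f that by (auto simp: isometries_def)
    have "f u \<in> D (sqrt (norm (ip cj u u)))" if "u \<in> U" for u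
      using isometry_norm_le[OF f that V] N[OF fV[OF that]] by (auto simp: D_def)
    moreover have "f u = undefined" if "u \<notin> U" for u
      using f that by (auto simp: isometries_def)
    moreover have "x \<in> D r" using x N[OF x(1)] by (auto simp: D_def)
    moreover have "p \<in> Q"
      using f x fV unfolding p Q_def isometries_def
      by (auto simp: ips)
    ultimately show "p \<in> (F \<times> D r) \<inter> Q" by (auto simp: p F_def)
  next
    fix p assume "p \<in> (F \<times> D r) \<inter> Q"
    then obtain f x where p: "p = (f, x)" and f: "f \<in> F" and x: "x \<in> D r" and q: "(f, x) \<in> Q" by auto
    have fV: "f u \<in> V" if "u \<in> U" for u using q that by (auto simp: Q_def)
    have xV: "x \<in> V" using q by (auto simp: Q_def)
    have "f \<in> U \<rightarrow>\<^sub>E V"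
      using f fV by (auto simp: F_def PiE_iff extensional_def split: if_splits)
    moreover have "norm (x i) \<le> r" for i
      using x r by (cases "i < N") (auto simp: D_def split: if_splits)
    ultimately show "p \<in> {(f, x) \<in> bundle_set U V. \<forall>i. norm (x i) \<le> r}"
      using q unfolding p Q_def isometries_def
      by (auto simp: ips fun_eq_iff)
  qed
  ultimately show ?thesis
    using compact_Times[OF cF cD[of r]] compact_Int_closed by metis
qed

lemma Hausdorff_isometry_bundle: "Hausdorff_space (isometry_bundle cj U V)"
proof -
  have "Hausdorff_space (euclidean :: ('f vect \<Rightarrow> 'f vect) topology)"
    unfolding euclidean_product_topology[symmetric]
    by (simp add: Hausdorff_space_product_topology Hausdorff_space_euclidean_t2)
  then have "Hausdorff_space (prod_topology (euclidean :: ('f vect \<Rightarrow> 'f vect) topology) (euclidean :: 'f vect topology))"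
    unfolding Hausdorff_space_prod_topology by (simp add: Hausdorff_space_euclidean_t2)
  then have "Hausdorff_space (euclidean :: (('f vect \<Rightarrow> 'f vect) \<times> 'f vect) topology)"
    by simp
  then show ?thesis
    unfolding isometry_bundle_def by (rule Hausdorff_space_subtopology)
qed

text \<open>Each coordinate of the fibre vector is bounded on a compact set, and only those below
  \<open>N\<close> can be nonzero, so the sum of their bounds serves for all.\<close>

lemma compact_bundle_imp_bounded:
  assumes V: "V \<in> fd_subspaces" and C: "compact C" "C \<subseteq> bundle_set U V"
  obtains r where "0 \<le> r" "\<And>f x i. (f, x) \<in> C \<Longrightarrow> norm (x i) \<le> r"
proof -
  obtain N where N: "\<And>v i. v \<in> V \<Longrightarrow> N \<le> i \<Longrightarrow> v i = 0" using fd_subspaces_support[OF V] by blast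
  have "\<exists>r. \<forall>p \<in> C. norm (snd p i) \<le> r" for i
  proof -
    have "continuous_on C (\<lambda>p :: ('f vect \<Rightarrow> 'f vect) \<times> 'f vect. snd p i)"
      by (rule continuous_on_product_then_coordinatewise[OF continuous_on_snd[OF continuous_on_id]])
    then have "compact ((\<lambda>p. snd p i) ` C)" using C(1) by (rule compact_continuous_image)
    then have "bounded ((\<lambda>p. snd p i) ` C)" by (rule compact_imp_bounded)
    then show ?thesis by (auto simp: bounded_iff)
  qed
  then obtain R where R: "\<And>i p. p \<in> C \<Longrightarrow> norm (snd p i) \<le> R i" by metis
  show thesis
  proof (rule that[of "\<Sum>i<N. \<bar>R i\<bar>"])
    show "0 \<le> (\<Sum>i<N. \<bar>R i\<bar>)" by (simp add: sum_nonneg)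
    fix f x i assume p: "(f, x) \<in> C"
    show "norm (x i) \<le> (\<Sum>i<N. \<bar>R i\<bar>)"
    proof (cases "i < N")
      case True
      have "norm (x i) \<le> \<bar>R i\<bar>" using R[OF p, of i] by simp
      also have "\<dots> \<le> (\<Sum>i<N. \<bar>R i\<bar>)" using True by (intro member_le_sum) auto
      finally show ?thesis .
    next
      case False
      then show ?thesis using N[of x i] p C(2) by (auto simp: sum_nonneg)
    qed
  qed
qed

text \<open>Local compactness is what makes the one-point compactification Hausdorff at the added
  point.\<close>

lemma locally_compact_isometry_bundle:
  assumes V: "V \<in> fd_subspaces"
  shows "locally_compact_space (isometry_bundle cj U V)"
  unfolding locally_compact_space_def isometry_bundle_def
proof (intro ballI)
  fix p assume "p \<in> topspace (top_of_set (bundle_set U V))"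
  then obtain f x where p: "p = (f, x)" "(f, x) \<in> bundle_set U V" by auto
  obtain N where N: "\<And>v i. v \<in> V \<Longrightarrow> N \<le> i \<Longrightarrow> v i = 0" using fd_subspaces_support[OF V] by blast
  obtain r where r: "0 \<le> r" "\<And>i. norm (x i) \<le> r"
  proof (rule compact_bundle_imp_bounded[OF V, of "{p}" U])
    show "{p} \<subseteq> bundle_set U V" using p by simp
  qed (use p in auto)
  \<comment> \<open>Restricting to coordinates below \<open>N\<close> keeps the intersection finite
    and hence open in the product topology; the other coordinates vanish on
    \<open>V\<close>.\<close>
  let ?W = "\<Inter>i<N. {p :: ('f vect \<Rightarrow> 'f vect) \<times> 'f vect. norm (snd p i) < r + 1}"
  let ?K = "{(f, x) \<in> bundle_set U V. \<forall>i. norm (x i) \<le> r + 1}"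
  have "continuous_on UNIV (\<lambda>p :: ('f vect \<Rightarrow> 'f vect) \<times> 'f vect. snd p i)" for i
    by (rule continuous_on_product_then_coordinatewise[OF continuous_on_snd[OF continuous_on_id]])
  then have "open ?W"
    by (intro open_INT finite_lessThan ballI open_Collect_less continuous_on_norm continuous_on_const)
  then have "openin (top_of_set (bundle_set U V)) (bundle_set U V \<inter> ?W)"
    by (rule openin_open_Int)
  moreover have "compactin (top_of_set (bundle_set U V)) ?K"
    using compact_bundle_bounded[OF V, of "r + 1" U] r by (auto simp: compactin_subtopology)
  moreover have "p \<in> bundle_set U V \<inter> ?W"
  proof -
    have "norm (x i) < r + 1" for i using r(2)[of i] by linarith
    then show ?thesis using p by simp
  qed
  moreover have "bundle_set U V \<inter> ?W \<subseteq> ?K"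
  proof
    fix q assume q: "q \<in> bundle_set U V \<inter> ?W"
    have "norm (snd q i) \<le> r + 1" for i
    proof (cases "i < N")
      case True
      then have "q \<in> {p. norm (snd p i) < r + 1}" using q by blast
      then show ?thesis by simp
    next
      case False
      then show ?thesis using N[of "snd q" i] q r(1) by auto
    qed
    then show "q \<in> ?K" using q by auto
  qed
  ultimately show "\<exists>W K. openin (top_of_set (bundle_set U V)) W \<and> compactin (top_of_set (bundle_set U V)) K \<and> p \<in> W \<and> W \<subseteq> K"
    by blast
qed

lemma tObj_J1 [simp]: "tObj (J1 cj) = fd_subspaces"
  by (simp add: J1_def)

lemma tHom_J1: "tHom (J1 cj) U V = Alexandroff_compactification (isometry_bundle cj U V)"
  by (simp add: J1_def)

lemma compact_tHom_J1: "compact_space (tHom (J1 cj) U V)"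
  by (simp add: tHom_J1)

lemma Hausdorff_tHom_J1: "V \<in> fd_subspaces \<Longrightarrow> Hausdorff_space (tHom (J1 cj) U V)"
  by (simp add: tHom_J1 Hausdorff_space_Alexandroff_compactification Hausdorff_isometry_bundle locally_compact_isometry_bundle)

end

interpretation real_conj: scalar_conjugation "\<lambda>c :: real. c"
  by unfold_locales (auto simp: power2_eq_square)

interpretation complex_conj: scalar_conjugation cnj
proof
  show "z * cnj z = of_real ((norm z)\<^sup>2)" for z by (rule complex_norm_square[symmetric])
qed (intro continuous_intros)

section \<open>Pullback along realification\<close>

text \<open>The hypotheses say that \<open>ro\<close> and \<open>rm\<close> form an enriched
  functor. Levels, mapping spaces and actions of the pullback are the original ones at
  \<open>ro V\<close>, so the laws are merely reindexed.\<close>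

lemma is_functor_pullback:
  fixes J :: "('o, 'm) tcat" and J' :: "('p, 'n) tcat" and K :: "('g::topological_space) monoid"
  assumes K: "group K"
    and ro: "\<And>V. V \<in> tObj J \<Longrightarrow> ro V \<in> tObj J'"
    and rm: "\<And>U V. \<lbrakk>U \<in> tObj J; V \<in> tObj J\<rbrakk> \<Longrightarrow> continuous_map (tHom J U V) (tHom J' (ro U) (ro V)) (rm U V)"
    and base: "\<And>U V. \<lbrakk>U \<in> tObj J; V \<in> tObj J\<rbrakk> \<Longrightarrow> rm U V (tBase J U V) = tBase J' (ro U) (ro V)"
    and id: "\<And>V. V \<in> tObj J \<Longrightarrow> rm V V (tId J V) = tId J' (ro V)"
    and comp: "\<And>U V W i j. \<lbrakk>U \<in> tObj J; V \<in> tObj J; W \<in> tObj J; i \<in> topspace (tHom J U V); j \<in> topspace (tHom J V W)\<rbrakk> \<Longrightarrow>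
       rm U W (tCmp J U V W j i) = tCmp J' (ro U) (ro V) (ro W) (rm V W j) (rm U V i)"
  shows "is_functor (SpG J' K) (SpG J K) (pullback J ro rm :: (('p, 'n, 'g, 'u) gspec, _, _, _) ftor)"
proof -
  let ?F = "pullback J ro rm :: (('p, 'n, 'g, 'u) gspec, _, _, _) ftor"
  have rmt: "rm U V j \<in> topspace (tHom J' (ro U) (ro V))"
    if "U \<in> tObj J" "V \<in> tObj J" "j \<in> topspace (tHom J U V)" for U V j
    using rm[OF that(1,2)] that(3) by (auto simp: continuous_map_def)
  have maps: "(\<lambda>V \<in> tObj J. \<phi> (ro V)) \<in> spec_maps J (fst (fst ?F X)) (fst (fst ?F Y))"
    if "\<phi> \<in> spec_maps J' (fst X) (fst Y)" for X Y :: "('p, 'n, 'g, 'u) gspec" and \<phi>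
    using that by (simp add: spec_maps_iff pullback_def ro rmt)
  have spec: "is_spec J (fst (fst ?F X))" if X: "is_spec J' (fst X)" for X :: "('p, 'n, 'g, 'u) gspec"
    unfolding is_spec_def
  proof (intro conjI ballI)
    fix U V assume U: "U \<in> tObj J" "V \<in> tObj J"
    show "continuous_map (tHom J U V) (based_maps (sp (fst (fst ?F X)) U) (sp (fst (fst ?F X)) V)) (str (fst (fst ?F X)) U V)"
      using continuous_map_compose[OF rm[OF U] is_specD(6)[OF X ro[OF U(1)] ro[OF U(2)]]]
      by (simp add: pullback_def o_def)
  qed (use is_specD[OF X] ro rmt base id comp in \<open>auto simp: pullback_def based_CGWH_def\<close>)
  have gspec: "is_gspec J K (fst ?F X)" if X: "is_gspec J' K X" for X :: "('p, 'n, 'g, 'u) gspec"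
  proof (rule is_gspecI[OF spec[OF is_gspecD(1)[OF X]] K])
    fix k assume k: "k \<in> carrier K"
    show "snd (fst ?F X) k \<in> spec_maps J (fst (fst ?F X)) (fst (fst ?F X))"
      using maps[OF is_gspecD(3)[OF X k]] by (simp add: pullback_def)
  qed (use is_gspecD(4,5)[OF X] gspec_one[OF X K] ro in \<open>auto simp: pullback_def\<close>)
  have gmaps: "(\<lambda>V \<in> tObj J. \<phi> (ro V)) \<in> gspec_maps J K (fst ?F X) (fst ?F Y)"
    if "\<phi> \<in> gspec_maps J' K X Y" for X Y :: "('p, 'n, 'g, 'u) gspec" and \<phi>
    using maps[OF gspec_mapsD(1)[OF that]] gspec_mapsD(2)[OF that] ro
    by (auto simp: gspec_maps_def pullback_def)
  have sndF: "snd ?F X Y \<phi> = (\<lambda>V \<in> tObj J. \<phi> (ro V))" for X Y \<phi>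
    by (simp add: pullback_def)
  show ?thesis
    unfolding is_functor_def SpG_simps sndF
  proof (intro conjI ballI)
    fix X :: "('p, 'n, 'g, 'u) gspec" assume "X \<in> {X. is_gspec J' K X}"
    then show "fst ?F X \<in> {X. is_gspec J K X}" using gspec by simp
    show "(\<lambda>V \<in> tObj J. cat.Id (Sp J') (fst X) (ro V)) = cat.Id (Sp J) (fst (fst ?F X))"
      by (auto simp: pullback_def fun_eq_iff ro)
  next
    fix X Y :: "('p, 'n, 'g, 'u) gspec" and f assume "f \<in> gspec_maps J' K X Y"
    then show "(\<lambda>V \<in> tObj J. f (ro V)) \<in> gspec_maps J K (fst ?F X) (fst ?F Y)"
      by (rule gmaps)
  next
    fix X Y Z :: "('p, 'n, 'g, 'u) gspec" and f g
    show "(\<lambda>V \<in> tObj J. Cmp (Sp J') (fst X) (fst Y) (fst Z) g f (ro V)) =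
       Cmp (Sp J) (fst (fst ?F X)) (fst (fst ?F Y)) (fst (fst ?F Z)) (\<lambda>V \<in> tObj J. g (ro V)) (\<lambda>V \<in> tObj J. f (ro V))"
      by (auto simp: pullback_def fun_eq_iff ro)
  qed
qed

section \<open>Interleaving real and imaginary parts\<close>

lemma r2c_c2r [simp]: "r2c (c2r z) = z"
  by (auto simp: r2c_def c2r_def fun_eq_iff complex_eq_iff)

lemma c2r_add: "c2r (\<lambda>i. z i + w i) = (\<lambda>i. c2r z i + c2r w i)"
  by (auto simp: c2r_def fun_eq_iff)

lemma c2r_scale: "c2r (\<lambda>i. complex_of_real a * z i) = (\<lambda>i. a * c2r z i)"
  by (auto simp: c2r_def fun_eq_iff)

lemma c2r_zero: "c2r (\<lambda>i. 0) = (\<lambda>i. 0)"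
  by (auto simp: c2r_def fun_eq_iff)

text \<open>The coordinates \<open>2 * i\<close> and \<open>2 * i + 1\<close> together contribute
  the product of the real parts plus that of the imaginary parts, which is
  \<open>Re (z i * cnj (w i))\<close>.\<close>

lemma ip_c2r:
  assumes "\<And>i. N \<le> i \<Longrightarrow> z i = 0"
  shows "ip (\<lambda>c. c) (c2r z) (c2r w) = Re (ip cnj z w)"
proof -
  have "ip (\<lambda>c. c) (c2r z) (c2r w) = (\<Sum>k<2 * N. c2r z k * c2r w k)"
    by (rule ip_eq_sum) (use assms in \<open>auto simp: c2r_def\<close>)
  also have "\<dots> = (\<Sum>i<N. Re (z i * cnj (w i)))"
    by (induction N) (auto simp: c2r_def)
  also have "\<dots> = Re (ip cnj z w)"
    using assms by (simp add: ip_eq_sum[of N])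
  finally show ?thesis .
qed

text \<open>If \<open>B\<close> spans a space over the complex numbers, then \<open>B\<close>
  together with its multiple by \<open>\<i>\<close> spans it over the reals.\<close>

lemma c2r_fd_subspaces:
  assumes "V \<in> fd_subspaces" shows "c2r ` V \<in> fd_subspaces"
proof -
  obtain B where B: "finite B" "\<And>b. b \<in> B \<Longrightarrow> finite {i. b i \<noteq> 0}" "V = vect.span B"
    using assms unfolding fd_subspaces_iff by blast
  let ?B = "c2r ` B \<union> c2r ` vscale \<i> ` B"
  have supp: "finite {k. c2r b k \<noteq> 0}" if "finite {i. b i \<noteq> 0}" for b
  proof (rule finite_subset)
    show "finite ((\<lambda>i. 2 * i) ` {i. b i \<noteq> 0} \<union> (\<lambda>i. 2 * i + 1) ` {i. b i \<noteq> 0})" using that by simp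
    show "{k. c2r b k \<noteq> 0} \<subseteq> (\<lambda>i. 2 * i) ` {i. b i \<noteq> 0} \<union> (\<lambda>i. 2 * i + 1) ` {i. b i \<noteq> 0}"
    proof
      fix k assume k: "k \<in> {k. c2r b k \<noteq> 0}"
      then have "b (k div 2) \<noteq> 0" by (auto simp: c2r_def split: if_splits)
      then show "k \<in> (\<lambda>i. 2 * i) ` {i. b i \<noteq> 0} \<union> (\<lambda>i. 2 * i + 1) ` {i. b i \<noteq> 0}"
        by (cases "even k") (auto simp: image_iff elim!: evenE oddE)
    qed
  qed
  have V: "vect.subspace V" using assms by (rule fd_subspaces_subspace)
  have "c2r ` V = vect.span ?B"
  proof
    \<comment> \<open>Asking the same of \<open>vscale \<i> z\<close> makes \<open>?S\<close> a
      complex subspace, so that minimality of the complex span applies.\<close>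
    let ?S = "{z. c2r z \<in> vect.span ?B \<and> c2r (vscale \<i> z) \<in> vect.span ?B}"
    have "B \<subseteq> ?S" by (auto intro: vect.span_base)
    moreover have "vect.subspace ?S"
      unfolding vect.subspace_def
    proof (intro conjI ballI allI)
      show "0 \<in> ?S" using vect.span_zero[of ?B] by (simp add: c2r_zero zero_fun_def)
    next
      fix x y assume x: "x \<in> ?S" and y: "y \<in> ?S"
      have "c2r (x + y) = c2r x + c2r y" "c2r (vscale \<i> (x + y)) = c2r (vscale \<i> x) + c2r (vscale \<i> y)"
        by (auto simp: c2r_def fun_eq_iff)
      then show "x + y \<in> ?S" using x y by (auto intro: vect.span_add simp del: plus_fun_apply)
    next
      fix c x assume x: "x \<in> ?S"
      have e: "c2r (vscale c x) = vscale (Re c) (c2r x) + vscale (Im c) (c2r (vscale \<i> x))"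
        "c2r (vscale \<i> (vscale c x)) = vscale (Re c) (c2r (vscale \<i> x)) + vscale (- Im c) (c2r x)"
        by (auto simp: c2r_def fun_eq_iff)
      have "c2r (vscale c x) \<in> vect.span ?B" "c2r (vscale \<i> (vscale c x)) \<in> vect.span ?B"
        unfolding e by (rule vect.span_add[OF vect.span_scale vect.span_scale]; use x in simp)+
      then show "vscale c x \<in> ?S" by simp
    qed
    ultimately have "vect.span B \<subseteq> ?S" by (rule vect.span_minimal)
    then show "c2r ` V \<subseteq> vect.span ?B" unfolding B(3) by blast
    have "B \<subseteq> V" unfolding B(3) by (rule vect.span_superset)
    then have "?B \<subseteq> c2r ` V" using vect.subspace_scale[OF V] by blast
    moreover have "vect.subspace (c2r ` V)"
      unfolding vect.subspace_def
    proof (intro conjI ballI allI)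
      show "0 \<in> c2r ` V" using vect.subspace_0[OF V] c2r_zero unfolding zero_fun_def by (metis imageI)
    next
      fix x y assume "x \<in> c2r ` V" "y \<in> c2r ` V"
      then obtain z w where "z \<in> V" "w \<in> V" "x = c2r z" "y = c2r w" by blast
      then show "x + y \<in> c2r ` V"
        using vect.subspace_add[OF V] c2r_add[of z w] unfolding plus_fun_def by (metis imageI)
    next
      fix c x assume "x \<in> c2r ` V"
      then obtain z where "z \<in> V" "x = c2r z" by blast
      then show "vscale c x \<in> c2r ` V"
        using vect.subspace_scale[OF V, of z] c2r_scale[of c z] by (metis imageI)
    qed
    ultimately show "vect.span ?B \<subseteq> c2r ` V" by (rule vect.span_minimal)
  qed
  moreover have "finite {k. b k \<noteq> 0}" if b: "b \<in> ?B" for b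
  proof -
    obtain z where z: "b = c2r z" "finite {i. z i \<noteq> 0}"
      using b B(2) by auto
    then show ?thesis using supp by simp
  qed
  ultimately show ?thesis
    unfolding fd_subspaces_iff using B(1) by (intro exI[of _ ?B]) auto
qed

text \<open>Realification on the total space of the bundle, before the point \<open>None\<close> is
  added.\<close>

definition real_pair :: "complex vect set \<Rightarrow> (complex vect \<Rightarrow> complex vect) \<times> complex vect \<Rightarrow>
    (real vect \<Rightarrow> real vect) \<times> real vect" where
  "real_pair U = (\<lambda>(f, x). (\<lambda>u \<in> c2r ` U. c2r (f (r2c u)), c2r x))"

lemma real_mor_eq: "real_mor U V = map_option (real_pair U)"
  by (simp add: real_mor_def real_pair_def)

text \<open>The real inner product is the real part of the Hermitian one, so isometries stay
  isometries and Hermitian orthogonality implies real orthogonality.\<close>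

lemma real_pair_bundle:
  assumes U: "U \<in> fd_subspaces" and V: "V \<in> fd_subspaces"
    and p: "p \<in> complex_conj.bundle_set U V"
  shows "real_pair U p \<in> real_conj.bundle_set (c2r ` U) (c2r ` V)"
proof -
  obtain f x where p': "p = (f, x)" and f: "f \<in> isometries cnj U V" and x: "x \<in> V" "\<And>u. u \<in> U \<Longrightarrow> ip cnj x (f u) = 0"
    using p by auto
  obtain N where N: "\<And>v i. v \<in> V \<Longrightarrow> N \<le> i \<Longrightarrow> v i = 0" using fd_subspaces_support[OF V] by blast
  obtain M where M: "\<And>v i. v \<in> U \<Longrightarrow> M \<le> i \<Longrightarrow> v i = 0" using fd_subspaces_support[OF U] by blast
  have sU: "vect.subspace U" by (rule fd_subspaces_subspace[OF U])
  have fV: "f u \<in> V" if "u \<in> U" for u using f that by (auto simp: isometries_def)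
  let ?f = "\<lambda>u \<in> c2r ` U. c2r (f (r2c u))"
  have "?f \<in> isometries (\<lambda>c. c) (c2r ` U) (c2r ` V)"
    unfolding isometries_def
  proof (intro CollectI conjI ballI allI)
    show "?f \<in> c2r ` U \<rightarrow>\<^sub>E c2r ` V" using fV by auto
  next
    fix u w assume "u \<in> c2r ` U" "w \<in> c2r ` U"
    then obtain z y where z: "z \<in> U" "y \<in> U" "u = c2r z" "w = c2r y" by blast
    then have "(\<lambda>i. z i + y i) \<in> U" using vect.subspace_add[OF sU, of z y] by (simp add: plus_fun_def)
    then show "?f (\<lambda>i. u i + w i) = (\<lambda>i. ?f u i + ?f w i)"
      using z f by (simp add: c2r_add[symmetric] isometries_def)
    show "ip (\<lambda>c. c) (?f u) (?f w) = ip (\<lambda>c. c) u w"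
      using z f fV N M by (simp add: ip_c2r[of N] ip_c2r[of M] isometries_def)
  next
    fix c :: real and u assume "u \<in> c2r ` U"
    then obtain z where z: "z \<in> U" "u = c2r z" by blast
    then have "(\<lambda>i. complex_of_real c * z i) \<in> U" using vect.subspace_scale[OF sU, of z] by simp
    then show "?f (\<lambda>i. c * u i) = (\<lambda>i. c * ?f u i)"
      using z f by (simp add: c2r_scale[symmetric] isometries_def)
  qed
  moreover have "ip (\<lambda>c. c) (c2r x) (c2r (f z)) = 0" if "z \<in> U" for z
    using that x N[OF x(1)] by (auto simp: ip_c2r[of N])
  ultimately show ?thesis using x(1) by (auto simp: p' real_pair_def)
qed

lemma continuous_c2r: "continuous_on UNIV (\<lambda>z. c2r z k)"
proof -
  have "continuous_on UNIV (\<lambda>z :: complex vect. Re (z (k div 2)))" "continuous_on UNIV (\<lambda>z :: complex vect. Im (z (k div 2)))"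
    by (intro continuous_intros continuous_on_product_coordinates)+
  then show ?thesis by (cases "even k") (simp_all add: c2r_def)
qed

lemma continuous_real_pair: "continuous_on S (real_pair U)"
proof -
  have ev: "continuous_on S (\<lambda>p :: (complex vect \<Rightarrow> complex vect) \<times> complex vect. fst p u)" for u
    by (rule continuous_on_product_then_coordinatewise[OF continuous_on_fst[OF continuous_on_id]])
  have "continuous_on S (\<lambda>p. (\<lambda>u \<in> c2r ` U. c2r (fst p (r2c u))) u)" for u
  proof (cases "u \<in> c2r ` U")
    case True
    have "continuous_on S (\<lambda>p. c2r (fst p (r2c u)))"
      by (intro continuous_on_coordinatewise_then_product continuous_on_compose2[OF continuous_c2r ev]) auto
    then show ?thesis using True by simp
  qed simp
  then have 1: "continuous_on S (\<lambda>p. \<lambda>u \<in> c2r ` U. c2r (fst p (r2c u)))"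
    by (rule continuous_on_coordinatewise_then_product)
  have 2: "continuous_on S (\<lambda>p :: (complex vect \<Rightarrow> complex vect) \<times> complex vect. c2r (snd p))"
    by (intro continuous_on_coordinatewise_then_product continuous_on_compose2[OF continuous_c2r continuous_on_snd[OF continuous_on_id]]) auto
  show ?thesis
    using continuous_on_Pair[OF 1 2] by (simp add: real_pair_def case_prod_beta')
qed

text \<open>Open neighbourhoods of the added point are complements of closed compact sets, so
  continuity there is the properness condition \<open>proper\<close>.\<close>

lemma continuous_map_Alexandroff_map_option:
  assumes f: "continuous_map X Y f"
    and proper: "\<And>C. \<lbrakk>compactin Y C; closedin Y C\<rbrakk> \<Longrightarrow> compactin X {x \<in> topspace X. f x \<in> C}"
  shows "continuous_map (Alexandroff_compactification X) (Alexandroff_compactification Y) (map_option f)"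
  unfolding continuous_map_def
proof (intro conjI allI impI)
  show "map_option f \<in> topspace (Alexandroff_compactification X) \<rightarrow> topspace (Alexandroff_compactification Y)"
    using f by (auto simp: continuous_map_def)
  fix U assume "openin (Alexandroff_compactification Y) U"
  then consider W where "openin Y W" "U = Some ` W"
    | C where "compactin Y C" "closedin Y C" "U = insert None (Some ` (topspace Y - C))"
    unfolding openin_Alexandroff_compactification by blast
  then show "openin (Alexandroff_compactification X) {x \<in> topspace (Alexandroff_compactification X). map_option f x \<in> U}"
  proof cases
    case 1
    have "{x \<in> topspace (Alexandroff_compactification X). map_option f x \<in> U} = Some ` {x \<in> topspace X. f x \<in> W}"
      unfolding 1 by auto
    then show ?thesis using openin_continuous_map_preimage[OF f 1(1)] by simp
  next
    case 2
    let ?C = "{x \<in> topspace X. f x \<in> C}"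
    have "{x \<in> topspace (Alexandroff_compactification X). map_option f x \<in> U} = insert None (Some ` (topspace X - ?C))"
      unfolding 2 using f by (auto simp: continuous_map_def)
    then show ?thesis
      unfolding openin_Alexandroff_compactification
      using proper[OF 2(1,2)] closedin_continuous_map_preimage[OF f 2(2)] by blast
  qed
qed

lemma continuous_real_mor:
  assumes U: "U \<in> fd_subspaces" and V: "V \<in> fd_subspaces"
  shows "continuous_map (tHom JU U V) (tHom JO (c2r ` U) (c2r ` V)) (real_mor U V)"
  unfolding real_conj.tHom_J1 complex_conj.tHom_J1 real_mor_eq
proof (rule continuous_map_Alexandroff_map_option)
  let ?X = "isometry_bundle cnj U V" and ?Y = "isometry_bundle (\<lambda>c. c) (c2r ` U) (c2r ` V)"
  show c: "continuous_map ?X ?Y (real_pair U)"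
    unfolding isometry_bundle_def
    unfolding continuous_map_subtopology_eu
    by (intro conjI continuous_real_pair Pi_I real_pair_bundle[OF U V])
  fix C assume C: "compactin ?Y C" "closedin ?Y C"
  have C': "compact C" "C \<subseteq> real_conj.bundle_set (c2r ` U) (c2r ` V)"
    using C(1) unfolding isometry_bundle_def compactin_subtopology by auto
  obtain r where r: "0 \<le> r" "\<And>f x i. (f, x) \<in> C \<Longrightarrow> norm (x i) \<le> r"
    using real_conj.compact_bundle_imp_bounded[OF c2r_fd_subspaces[OF V] C'] by metis
  let ?P = "{p \<in> topspace ?X. real_pair U p \<in> C}"
  \<comment> \<open>Real and imaginary parts are each bounded by \<open>r\<close>, hence the modulus
    by \<open>2 * r\<close>. The preimage of \<open>C\<close> is then a closed subset of a compact
    set.\<close>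
  let ?K = "{(f, x) \<in> complex_conj.bundle_set U V. \<forall>i. norm (x i) \<le> 2 * r}"
  have "compact ?K" using complex_conj.compact_bundle_bounded[OF V] r(1) by simp
  then have "compactin ?X ?K"
    unfolding isometry_bundle_def compactin_subtopology by auto
  moreover have "?P \<subseteq> ?K"
  proof
    fix p assume p: "p \<in> ?P"
    obtain f x where fx: "p = (f, x)" by (cases p)
    have "norm (x i) \<le> 2 * r" for i
    proof -
      have C: "(fst (real_pair U p), c2r x) \<in> C" using p by (simp add: fx real_pair_def)
      have "norm (c2r x (2 * i)) \<le> r" "norm (c2r x (2 * i + 1)) \<le> r" by (rule r(2)[OF C])+
      then have "\<bar>Re (x i)\<bar> \<le> r" "\<bar>Im (x i)\<bar> \<le> r" by (simp_all add: c2r_def)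
      then show ?thesis using cmod_le[of "x i"] by linarith
    qed
    then show "p \<in> ?K" using p by (auto simp: fx isometry_bundle_def)
  qed
  moreover have "closedin ?X ?P" by (rule closedin_continuous_map_preimage[OF c C(2)])
  ultimately show "compactin ?X ?P" by (rule closed_compactin)
qed

lemma is_functor_rpull:
  fixes K :: "('g::topological_space) monoid"
  assumes "group K"
  shows "is_functor (SpG JO K) (SpG JU K) (rpull :: ((real vect set, real jmor, 'g, 'u) gspec, _, _, _) ftor)"
proof (rule is_functor_pullback[OF assms])
  show "c2r ` V \<in> tObj JO" if "V \<in> tObj JU" for V
    using that c2r_fd_subspaces by simp
  show "continuous_map (tHom JU U V) (tHom JO (c2r ` U) (c2r ` V)) (real_mor U V)"
    if "U \<in> tObj JU" "V \<in> tObj JU" for U V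
    using that continuous_real_mor by simp
  show "real_mor U V (tBase JU U V) = tBase JO (c2r ` U) (c2r ` V)" for U V
    by (simp add: J1_def real_mor_def)
  show "real_mor V V (tId JU V) = tId JO (c2r ` V)" for V
    by (auto simp: J1_def real_mor_def c2r_zero fun_eq_iff)
  fix U V W i j
  assume U: "U \<in> tObj JU" "V \<in> tObj JU" "W \<in> tObj JU" and i: "i \<in> topspace (tHom JU U V)" and j: "j \<in> topspace (tHom JU V W)"
  show "real_mor U W (tCmp JU U V W j i) = tCmp JO (c2r ` U) (c2r ` V) (c2r ` W) (real_mor V W j) (real_mor U V i)"
  proof (cases i)
    case (Some p)
    obtain f x where p: "p = (f, x)" by (cases p)
    show ?thesis
    proof (cases j)
      case (Some q)
      obtain g y where q: "q = (g, y)" by (cases q)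
      have f: "f \<in> U \<rightarrow>\<^sub>E V" "x \<in> V"
        using i unfolding \<open>i = Some p\<close> p complex_conj.tHom_J1 by (auto simp: isometry_bundle_def isometries_def)
      then have "(\<lambda>u \<in> c2r ` U. c2r (compose U g f (r2c u))) =
          compose (c2r ` U) (\<lambda>u \<in> c2r ` V. c2r (g (r2c u))) (\<lambda>u \<in> c2r ` U. c2r (f (r2c u)))"
        by (auto simp: compose_def fun_eq_iff)
      then show ?thesis
        using f(2) unfolding Some \<open>i = Some p\<close> p q by (simp add: J1_def real_mor_def c2r_add)
    qed (simp add: J1_def real_mor_def)
  qed (auto simp: J1_def real_mor_def split: option.splits)
qed

section \<open>Orthogonal and unitary groups\<close>

lemma bounded_matrix_entries:
  "bounded {A :: 'a::real_normed_vector^'n^'m. \<forall>i j. norm (A $ i $ j) \<le> b}"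
proof (rule boundedI)
  fix A :: "'a^'n^'m" assume A: "A \<in> {A. \<forall>i j. norm (A $ i $ j) \<le> b}"
  have "norm A \<le> (\<Sum>i\<in>UNIV. norm (A $ i))"
    unfolding norm_vec_def[of A] by (rule L2_set_le_sum) simp
  also have "\<dots> \<le> (\<Sum>i\<in>(UNIV :: 'm set). \<Sum>j\<in>(UNIV :: 'n set). norm (A $ i $ j))"
    by (rule sum_mono) (simp add: norm_vec_def L2_set_le_sum)
  also have "\<dots> \<le> (\<Sum>i\<in>(UNIV :: 'm set). \<Sum>j\<in>(UNIV :: 'n set). b)"
    using A by (intro sum_mono) simp
  finally show "norm A \<le> (\<Sum>i\<in>(UNIV :: 'm set). \<Sum>j\<in>(UNIV :: 'n set). b)" .
qed

lemma continuous_on_matrix_mult: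
  fixes f g :: "'x::topological_space \<Rightarrow> 'a::real_normed_algebra_1^'n^'n"
  assumes "continuous_on S f" "continuous_on S g"
  shows "continuous_on S (\<lambda>x. f x ** g x)"
  unfolding matrix_matrix_mult_def
  by (intro continuous_on_vec_lambda continuous_on_sum continuous_on_mult continuous_on_component assms)

text \<open>With the identity on the reals \<open>star\<close> is the transpose and the group below
  is orthogonal; with \<open>cnj\<close> it is the conjugate transpose and the group is
  unitary.\<close>

locale scalar_involution = scalar_conjugation cj for cj :: "'f::{real_normed_field, heine_borel} \<Rightarrow> 'f" +
  assumes cj_add: "cj (a + b) = cj a + cj b" and cj_mult: "cj (a * b) = cj a * cj b" and cj_cj: "cj (cj a) = a"
begin

definition star :: "'f^'n^'n \<Rightarrow> 'f^'n^'n" where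
  "star A = (\<chi> i j. cj (A $ j $ i))"

definition isom_group :: "('f^'n^'n) monoid" where
  "isom_group = \<lparr>carrier = {A. star A ** A = mat 1 \<and> A ** star A = mat 1}, mult = (**), one = mat 1\<rparr>"

lemma cj_0: "cj 0 = 0"
  using cj_add[of 0 0] by simp

lemma cj_1: "cj 1 = 1"
  using mult_cj[of 1] by simp

lemma cj_sum: "cj (sum f S) = (\<Sum>x\<in>S. cj (f x))"
  by (induction S rule: infinite_finite_induct) (auto simp: cj_0 cj_add)

lemma star_mult: "star (A ** B) = star B ** star A"
  by (simp add: star_def matrix_matrix_mult_def vec_eq_iff cj_sum cj_mult mult.commute)

lemma star_star: "star (star A) = A"
  by (simp add: star_def vec_eq_iff cj_cj)

lemma star_1: "star (mat 1) = mat 1"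
  by (simp add: star_def mat_def vec_eq_iff cj_0 cj_1)

lemma isom_group_closed:
  assumes "A \<in> carrier isom_group" "B \<in> carrier isom_group"
  shows "A ** B \<in> carrier isom_group"
proof -
  have "star B ** (star A ** (A ** B)) = mat 1" "A ** (B ** (star B ** star A)) = mat 1"
    using assms by (simp_all add: isom_group_def matrix_mul_assoc)
  then show ?thesis by (simp add: isom_group_def star_mult matrix_mul_assoc)
qed

lemma group_isom_group: "group (isom_group :: ('f^'n^'n) monoid)"
proof (rule groupI)
  show "\<exists>B\<in>carrier isom_group. B \<otimes>\<^bsub>isom_group\<^esub> A = \<one>\<^bsub>isom_group\<^esub>" if "A \<in> carrier isom_group" for A :: "'f^'n^'n"
    using that by (intro bexI[of _ "star A"]) (auto simp: isom_group_def star_star)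
qed (use isom_group_closed in \<open>auto simp: isom_group_def star_1 matrix_mul_assoc\<close>)

lemma inv_isom_group: "A \<in> carrier isom_group \<Longrightarrow> inv\<^bsub>isom_group\<^esub> A = star A"
  by (rule group.inv_equality[OF group_isom_group]) (auto simp: isom_group_def star_star)

lemma continuous_star: "continuous_on S star"
  unfolding star_def
  by (intro continuous_on_vec_lambda continuous_on_compose2[OF cont_cj] continuous_on_component continuous_on_id) auto

text \<open>The diagonal entries of \<open>A ** star A\<close> are 1, so each row of
  \<open>A\<close> is a unit vector.\<close>

lemma norm_entry_isom_group:
  assumes "A \<in> carrier isom_group" shows "norm (A $ i $ j) \<le> 1"
proof -
  have "(A ** star A) $ i $ i = 1" using assms by (simp add: isom_group_def mat_def)
  then have "of_real (\<Sum>k\<in>UNIV. (norm (A $ i $ k))\<^sup>2) = (1 :: 'f)"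
    by (simp add: star_def matrix_matrix_mult_def mult_cj)
  then have "(\<Sum>k\<in>UNIV. (norm (A $ i $ k))\<^sup>2) = 1"
    using of_real_eq_1_iff by blast
  moreover have "(norm (A $ i $ j))\<^sup>2 \<le> (\<Sum>k\<in>UNIV. (norm (A $ i $ k))\<^sup>2)"
    by (rule member_le_sum) auto
  ultimately show ?thesis by (simp add: power_le_one_iff abs_square_le_1)
qed

lemma compact_isom_group: "compact (carrier isom_group)"
  unfolding compact_eq_bounded_closed
proof
  show "bounded (carrier isom_group)"
    by (rule bounded_subset[OF bounded_matrix_entries[of 1]]) (use norm_entry_isom_group in auto)
  show "closed (carrier isom_group)"
    unfolding isom_group_def
    by (simp, intro closed_Collect_conj closed_Collect_eq continuous_on_matrix_mult continuous_star continuous_on_id continuous_on_const)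
qed

lemma compact_inclusion_isom_group:
  fixes G :: "('g::t2_space) monoid" and \<iota> :: "'f^'n^'n \<Rightarrow> 'g"
  assumes "group G" "compact (carrier G)" "continuous_on (carrier G \<times> carrier G) (\<lambda>(a, b). a \<otimes>\<^bsub>G\<^esub> b)"
    and "\<And>A. A \<in> carrier isom_group \<Longrightarrow> \<iota> A \<in> carrier G"
    and "\<And>A B. \<iota> (A ** B) = \<iota> A \<otimes>\<^bsub>G\<^esub> \<iota> B"
    and "inj \<iota>" "continuous_on UNIV \<iota>"
  shows "compact_inclusion isom_group G \<iota>"
proof (rule compact_inclusion.intro)
  show "\<iota> \<in> hom isom_group G" using assms by (auto simp: hom_def isom_group_def)
  show "inj_on \<iota> (carrier isom_group)" using assms(6) inj_on_subset by blast
  show "continuous_on (carrier isom_group) \<iota>" using assms(7) continuous_on_subset by blast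
  show "continuous_on (carrier isom_group) (\<lambda>h. inv\<^bsub>isom_group\<^esub> h)"
    by (rule continuous_on_eq[OF continuous_star]) (simp add: inv_isom_group)
qed (rule assms group_isom_group compact_isom_group)+

lemma mult_isom_group: "A \<otimes>\<^bsub>isom_group\<^esub> B = A ** B"
  by (simp add: isom_group_def)

lemma continuous_mult_isom_group:
  "continuous_on (carrier isom_group \<times> carrier isom_group) (\<lambda>(a, b). a \<otimes>\<^bsub>isom_group\<^esub> b)"
  using continuous_on_matrix_mult[OF continuous_on_fst[OF continuous_on_id] continuous_on_snd[OF continuous_on_id]]
  by (simp add: mult_isom_group case_prod_beta')

end

interpretation real_inv: scalar_involution "\<lambda>c :: real. c"
  by unfold_locales auto

interpretation complex_inv: scalar_involution cnj
  by unfold_locales auto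

lemma star_real: "real_inv.star A = transpose A"
  by (simp add: real_inv.star_def transpose_def)

lemma Ogrp_eq: "Ogrp = real_inv.isom_group"
  by (simp add: Ogrp_def real_inv.isom_group_def star_real orthogonal_matrix_def)

lemma Ugrp_eq: "Ugrp = complex_inv.isom_group"
  by (simp add: Ugrp_def complex_inv.isom_group_def complex_inv.star_def)

section \<open>The inclusions of O(n) in U(n) and of U(n) in O(2n)\<close>

lemma complexify_mult: "complexify (A ** B) = complexify A ** complexify B"
  by (simp add: complexify_def matrix_matrix_mult_def vec_eq_iff)

lemma compact_inclusion_complexify:
  "compact_inclusion (Ogrp :: (real^'n^'n) monoid) Ugrp complexify"
  unfolding Ogrp_eq Ugrp_eq
proof (rule real_inv.compact_inclusion_isom_group[OF complex_inv.group_isom_group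
      complex_inv.compact_isom_group complex_inv.continuous_mult_isom_group])
  show "inj (complexify :: real^'n^'n \<Rightarrow> _)"
    by (rule injI) (simp add: complexify_def vec_eq_iff)
  show "continuous_on UNIV (complexify :: real^'n^'n \<Rightarrow> _)"
    unfolding complexify_def
    by (intro continuous_on_vec_lambda continuous_on_of_real continuous_on_component continuous_on_id)
  have 1: "complexify (mat 1 :: real^'n^'n) = mat 1"
    by (simp add: complexify_def mat_def vec_eq_iff)
  have "complex_inv.star (complexify A) = complexify (real_inv.star A)" for A :: "real^'n^'n"
    by (simp add: complex_inv.star_def real_inv.star_def complexify_def vec_eq_iff)
  then show "complexify A \<in> carrier complex_inv.isom_group" if "A \<in> carrier real_inv.isom_group" for A :: "real^'n^'n"
    using that by (simp add: complex_inv.isom_group_def real_inv.isom_group_def complexify_mult[symmetric] 1)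
qed (simp add: complex_inv.mult_isom_group complexify_mult)

lemma sum_UNIV_Plus: "(\<Sum>k\<in>(UNIV :: ('a::finite + 'b::finite) set). f k) = (\<Sum>k\<in>UNIV. f (Inl k)) + (\<Sum>k\<in>UNIV. f (Inr k))"
  using sum.Plus[of "UNIV :: 'a set" "UNIV :: 'b set" f] by (simp add: o_def)

text \<open>The middle index runs over \<open>'n + 'n\<close>; splitting its sum into the two halves
  leaves the real and imaginary parts of a complex product in each block.\<close>

lemma realify_mult: "realify (A ** B) = realify A ** realify B"
proof -
  have "realify (A ** B) $ i $ j = (realify A ** realify B) $ i $ j" for i j
    by (cases i; cases j)
       (simp_all add: realify_def matrix_matrix_mult_def sum_UNIV_Plus sum.distrib sum_subtractf sum_negf algebra_simps)
  then show ?thesis by (simp add: vec_eq_iff)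
qed

lemma compact_inclusion_realify:
  "compact_inclusion (Ugrp :: (complex^'n^'n) monoid) Ogrp realify"
  unfolding Ogrp_eq Ugrp_eq
proof (rule complex_inv.compact_inclusion_isom_group[OF real_inv.group_isom_group
      real_inv.compact_isom_group real_inv.continuous_mult_isom_group])
  show "inj (realify :: complex^'n^'n \<Rightarrow> _)"
  proof (rule injI)
    fix A B :: "complex^'n^'n" assume "realify A = realify B"
    then have "realify A $ Inl i $ Inl j = realify B $ Inl i $ Inl j"
      "realify A $ Inr i $ Inl j = realify B $ Inr i $ Inl j" for i j by simp_all
    then show "A = B" by (simp add: realify_def vec_eq_iff complex_eq_iff)
  qed
  show "continuous_on UNIV (realify :: complex^'n^'n \<Rightarrow> _)"
    unfolding realify_def
  proof (intro continuous_on_vec_lambda)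
    fix i j :: "'n + 'n"
    show "continuous_on UNIV (\<lambda>A :: complex^'n^'n. case (i, j) of
       (Inl a, Inl b) \<Rightarrow> Re (A $ a $ b)
     | (Inl a, Inr b) \<Rightarrow> - Im (A $ a $ b)
     | (Inr a, Inl b) \<Rightarrow> Im (A $ a $ b)
     | (Inr a, Inr b) \<Rightarrow> Re (A $ a $ b))"
      by (cases i; cases j; simp; intro continuous_intros)
  qed
  have 1: "realify (mat 1 :: complex^'n^'n) = mat 1"
  proof -
    have "realify (mat 1 :: complex^'n^'n) $ i $ j = mat 1 $ i $ j" for i j
      by (cases i; cases j) (simp_all add: realify_def mat_def)
    then show ?thesis by (simp add: vec_eq_iff)
  qed
  \<comment> \<open>Transposing the block matrix moves the sign between its off-diagonal blocks,
    which is conjugation of the entries.\<close>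
  have "real_inv.star (realify A) = realify (complex_inv.star A)" for A :: "complex^'n^'n"
  proof -
    have "real_inv.star (realify A) $ i $ j = realify (complex_inv.star A) $ i $ j" for i j
      by (cases i; cases j) (simp_all add: realify_def real_inv.star_def complex_inv.star_def)
    then show ?thesis by (simp add: vec_eq_iff)
  qed
  then show "realify A \<in> carrier real_inv.isom_group" if "A \<in> carrier complex_inv.isom_group" for A :: "complex^'n^'n"
    using that by (simp add: complex_inv.isom_group_def real_inv.isom_group_def realify_mult[symmetric] 1)
qed (simp add: real_inv.mult_isom_group realify_mult)

section \<open>The square of adjunctions\<close>

lemma res_rpull: "res \<iota> \<circ>\<^sub>F rpull = rpull \<circ>\<^sub>F res \<iota>"
  by (simp add: res_def pullback_def fcomp_def fun_eq_iff)

lemma adjoint_square_commutesI: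
  fixes H :: "('h::t2_space) monoid" and G :: "('g::{second_countable_topology, t2_space}) monoid"
  assumes incl: "compact_inclusion H G \<iota>" and u: "(UNIV :: real set) \<lesssim> (UNIV :: 'u set)"
  shows "adjoint_square_commutes TYPE('u) H G \<iota>"
proof -
  interpret compact_inclusion H G \<iota> by fact
  have G: "(UNIV :: 'g set) \<lesssim> (UNIV :: 'u set)"
    by (rule lepoll_trans[OF lepoll_real_second_countable u])
  have inf: "infinite (UNIV :: 'u set)"
    using u infinite_UNIV_char_0[where 'a = real] by (meson infinite_le_lepoll lepoll_trans)
  interpret O: induction_setting H G \<iota> JO "TYPE('u)"
    by unfold_locales (simp_all add: G inf real_conj.compact_tHom_J1 real_conj.Hausdorff_tHom_J1 jmor_lepoll[OF u])
  interpret U: induction_setting H G \<iota> JU "TYPE('u)"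
    by unfold_locales (simp_all add: G inf complex_conj.compact_tHom_J1 complex_conj.Hausdorff_tHom_J1 jmor_lepoll[OF u])
  have F: "is_functor (SpG JO G) (SpG JU H) (res \<iota> \<circ>\<^sub>F rpull :: ((real vect set, real jmor, 'g, 'u) gspec, _, _, _) ftor)"
    by (rule is_functor_fcomp[OF is_functor_rpull[OF group_G] is_functor_res[OF group_H hom_\<iota> cont_\<iota>]])
  \<comment> \<open>The right adjoints compose in opposite order to the left ones: \<open>rG\<close>
    after induction belongs to restriction after \<open>rpull\<close>, and induction after
    \<open>rH\<close> to \<open>rpull\<close> after restriction; \<open>res_rpull\<close> identifies
    the two.\<close>
  have "nat_isomorphic (SpG JU H) (SpG JO G) (rG \<circ>\<^sub>F ind JU H G \<iota>) (ind JO H G \<iota> \<circ>\<^sub>F rH)"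
    if "left_adjoint (SpG JU H) (SpG JO H) rH rpull" "left_adjoint (SpG JU G) (SpG JO G) rG rpull"
    for rH :: "((complex vect set, complex jmor, 'h, 'u) gspec, _, (real vect set, real jmor, 'h, 'u) gspec, _) ftor" and rG
    by (rule left_adjoint_unique[OF is_cat_SpG is_cat_SpG left_adjoint_fcomp[OF U.left_adjoint_ind that(2)]])
       (use left_adjoint_fcomp[OF that(1) O.left_adjoint_ind] in \<open>simp add: res_rpull\<close>)
  then show ?thesis
    unfolding adjoint_square_commutes_def Let_def
    using O.left_adjoint_ind U.left_adjoint_ind nat_isomorphic_refl[OF is_cat_SpG F, unfolded res_rpull]
    by (simp add: res_rpull)
qed

theorem lemma7p10:
  assumes "\<exists>e :: real \<Rightarrow> 'u. inj e"
  shows "adjoint_square_commutes TYPE('u) (Ogrp :: (real^'n^'n) monoid) Ugrp complexify \<and>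
         adjoint_square_commutes TYPE('u) (Ugrp :: (complex^'n^'n) monoid) Ogrp realify"
proof -
  have "(UNIV :: real set) \<lesssim> (UNIV :: 'u set)"
    using assms by (auto simp: lepoll_def)
  then show ?thesis
    by (intro conjI adjoint_square_commutesI compact_inclusion_complexify compact_inclusion_realify)
qed

end
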